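(* Let $\mathcal{V}$ be a variety in a finite language $F$ with a $\mathsf{d}$-cube term ($\mathsf{d}>1$), and let $\mathcal{K}$ be a finite set of finite algebras in $\mathcal{V}$. Let $a_1,\dots,a_k,b\in\mathbf{A}_1\times\dots\times\mathbf{A}_n$ with $\mathbf{A}_1,\dots,\mathbf{A}_n\in\mathcal{K}$. If $b$ is in the subalgebra of $\mathbf{A}_1\times\dots\times\mathbf{A}_n$ generated by $\{a_1,\dots,a_k\}$, then there exists a term $t$ in the language $F$ such that $t(a_1,\dots,a_k)=b$ and the minimal $F$-circuit representing $t$ has size $O(kn^{\mathsf{d}+2})$. Consequently, $\mathrm{SMP}(\mathcal{K})\in\mathsf{NP}$.
   Context: A $\mathsf{d}$-cube term for $\mathcal{V}$ is a term $t$ satisfying identities $t(M)=(y,\dots,y)^T$ where $M$ is a matrix with $\mathsf{d}$ rows, entries among the variables $x,y$, each column containing at least one $x$. An $F$-circuit is a circuit whose gates are labelled by operation symbols of $F$ (with fan-in equal to the arity); a minimal $F$-circuit representing a term computes each distinct subterm exactly once, and its size is its number of gates. The implied constant depends only on $\mathcal{K}$ (and $\mathsf{d}$, $F$). $\mathrm{SMP}(\mathcal{K})$: given $a_1,\dots,a_k,b\in\mathbf{A}_1\times\dots\times\mathbf{A}_n$ with $\mathbf{A}_i\in\mathcal{K}$, decide whether $b$ lies in the subalgebra generated by $\{a_1,\dots,a_k\}$. *)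

theory Defs
  imports Complex_Main "HOL-Computational_Algebra.Polynomial"
begin

section \<open>Algebras, terms and varieties\<close>

text \<open>A language is a set \<open>F\<close> of operation symbols with an arity function \<open>ar\<close>.\<close>

record ('f, 'a) algebra =
  univ :: "'a set"
  oper :: "'f \<Rightarrow> 'a list \<Rightarrow> 'a"

definition is_algebra :: "'f set \<Rightarrow> ('f \<Rightarrow> nat) \<Rightarrow> ('f, 'a) algebra \<Rightarrow> bool" where
  "is_algebra F ar A \<longleftrightarrow> univ A \<noteq> {} \<and>
     (\<forall>f\<in>F. \<forall>xs\<in>lists (univ A). length xs = ar f \<longrightarrow> oper A f xs \<in> univ A)"

datatype 'f trm = Var nat | Fun 'f "'f trm list"

inductive_set terms :: "'f set \<Rightarrow> ('f \<Rightarrow> nat) \<Rightarrow> nat set \<Rightarrow> 'f trm set"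
  for F :: "'f set" and ar :: "'f \<Rightarrow> nat" and X :: "nat set"
  where
    "i \<in> X \<Longrightarrow> Var i \<in> terms F ar X"
  | "f \<in> F \<Longrightarrow> length ts = ar f \<Longrightarrow> (\<And>t. t \<in> set ts \<Longrightarrow> t \<in> terms F ar X)
       \<Longrightarrow> Fun f ts \<in> terms F ar X"

primrec eval :: "('f, 'a) algebra \<Rightarrow> (nat \<Rightarrow> 'a) \<Rightarrow> 'f trm \<Rightarrow> 'a" where
  "eval A \<rho> (Var i) = \<rho> i"
| "eval A \<rho> (Fun f ts) = oper A f (map (eval A \<rho>) ts)"

primrec subst :: "(nat \<Rightarrow> 'f trm) \<Rightarrow> 'f trm \<Rightarrow> 'f trm" where
  "subst \<sigma> (Var i) = \<sigma> i"
| "subst \<sigma> (Fun f ts) = Fun f (map (subst \<sigma>) ts)"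

fun subterms :: "'f trm \<Rightarrow> 'f trm set" where
  "subterms (Var i) = {Var i}"
| "subterms (Fun f ts) = insert (Fun f ts) (\<Union>s\<in>set ts. subterms s)"

definition satisfies :: "('f, 'a) algebra \<Rightarrow> 'f trm \<Rightarrow> 'f trm \<Rightarrow> bool" where
  "satisfies A s t \<longleftrightarrow> (\<forall>\<rho>. range \<rho> \<subseteq> univ A \<longrightarrow> eval A \<rho> s = eval A \<rho> t)"

text \<open>A variety is an equational class. As HOL has no classes ranging over all types, \<open>V\<close>
  consists of the members of the class whose universe is a subset of the type \<open>'a\<close>. For a
  cube term this is no loss: the variety generated by a set \<open>K\<close> of algebras has
  the cube terms of \<open>K\<close>.\<close>

definition variety :: "'f set \<Rightarrow> ('f \<Rightarrow> nat) \<Rightarrow> ('f, 'a) algebra set \<Rightarrow> bool" where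
  "variety F ar V \<longleftrightarrow> (\<exists>E \<subseteq> terms F ar UNIV \<times> terms F ar UNIV.
     V = {A. is_algebra F ar A \<and> (\<forall>(s, t)\<in>E. satisfies A s t)})"

text \<open>The matrix entries \<open>0\<close> and \<open>1\<close> are the indices of the variables \<open>x\<close> and \<open>y\<close>.\<close>

definition is_cube_term ::
  "'f set \<Rightarrow> ('f \<Rightarrow> nat) \<Rightarrow> ('f, 'a) algebra set \<Rightarrow> nat \<Rightarrow> 'f trm \<Rightarrow> bool" where
  "is_cube_term F ar V d t \<longleftrightarrow> (\<exists>m. t \<in> terms F ar {..<m} \<and>
     (\<exists>M :: nat \<Rightarrow> nat \<Rightarrow> nat.
        (\<forall>i<d. \<forall>j<m. M i j \<in> {0, 1}) \<and>
        (\<forall>j<m. \<exists>i<d. M i j = 0) \<and>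
        (\<forall>A\<in>V. \<forall>i<d. satisfies A (subst (\<lambda>j. Var (M i j)) t) (Var 1))))"

section \<open>Products and generated subalgebras\<close>

definition prod_alg :: "('f, 'a) algebra list \<Rightarrow> ('f, 'a list) algebra" where
  "prod_alg As = \<lparr>univ = listset (map univ As),
     oper = (\<lambda>f xs. map (\<lambda>i. oper (As ! i) f (map (\<lambda>x. x ! i) xs)) [0..<length As])\<rparr>"

definition subuniverse ::
  "'f set \<Rightarrow> ('f \<Rightarrow> nat) \<Rightarrow> ('f, 'a) algebra \<Rightarrow> 'a set \<Rightarrow> bool" where
  "subuniverse F ar A S \<longleftrightarrow> S \<subseteq> univ A \<and>
     (\<forall>f\<in>F. \<forall>xs\<in>lists S. length xs = ar f \<longrightarrow> oper A f xs \<in> S)"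

definition Sg :: "'f set \<Rightarrow> ('f \<Rightarrow> nat) \<Rightarrow> ('f, 'a) algebra \<Rightarrow> 'a set \<Rightarrow> 'a set" where
  "Sg F ar A X = subuniverse F ar A hull X"

section \<open>Circuits\<close>

text \<open>The gates of a circuit are listed in a topological order; a wire leads from an input
  or from a gate, given by its position in the list.\<close>

datatype wire = Input nat | Gate nat

record 'f circuit =
  gates :: "('f \<times> wire list) list"
  out_wire :: wire

primrec wire_ok :: "nat \<Rightarrow> nat \<Rightarrow> wire \<Rightarrow> bool" where
  "wire_ok k l (Input i) \<longleftrightarrow> i < k"
| "wire_ok k l (Gate j) \<longleftrightarrow> j < l"

definition is_circuit :: "'f set \<Rightarrow> ('f \<Rightarrow> nat) \<Rightarrow> nat \<Rightarrow> 'f circuit \<Rightarrow> bool" where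
  "is_circuit F ar k C \<longleftrightarrow>
     (\<forall>l<length (gates C). case gates C ! l of (f, ws) \<Rightarrow>
        f \<in> F \<and> length ws = ar f \<and> (\<forall>w\<in>set ws. wire_ok k l w)) \<and>
     wire_ok k (length (gates C)) (out_wire C)"

primrec wire_term :: "'f trm list \<Rightarrow> wire \<Rightarrow> 'f trm" where
  "wire_term ts (Input i) = Var i"
| "wire_term ts (Gate j) = ts ! j"

definition gate_terms :: "'f circuit \<Rightarrow> 'f trm list" where
  "gate_terms C = foldl (\<lambda>ts (f, ws). ts @ [Fun f (map (wire_term ts) ws)]) [] (gates C)"

definition represents :: "'f circuit \<Rightarrow> 'f trm \<Rightarrow> bool" where
  "represents C t \<longleftrightarrow> wire_term (gate_terms C) (out_wire C) = t"

text \<open>The subterms that are variables are computed by the inputs, all others by gates.\<close>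

definition is_minimal_circuit ::
  "'f set \<Rightarrow> ('f \<Rightarrow> nat) \<Rightarrow> nat \<Rightarrow> 'f circuit \<Rightarrow> 'f trm \<Rightarrow> bool" where
  "is_minimal_circuit F ar k C t \<longleftrightarrow> is_circuit F ar k C \<and> represents C t \<and>
     distinct (gate_terms C) \<and> set (gate_terms C) = subterms t - range Var"

definition circuit_size :: "'f circuit \<Rightarrow> nat" where
  "circuit_size C = length (gates C)"

section \<open>Nondeterministic Turing machines and NP\<close>

text \<open>Multi-tape machines with two-way infinite tapes. A tape symbol is an input symbol
  \<open>Inl s\<close> or an auxiliary symbol \<open>Inr i\<close>; the blank is \<open>Inr 0\<close>.
  A transition \<open>(q, as, q', bs, ms)\<close> reads \<open>as\<close> in state \<open>q\<close>, writes \<open>bs\<close>, moves the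
  heads by \<open>ms\<close> and enters \<open>q'\<close>.\<close>

datatype move = MoveLeft | Stay | MoveRight

type_synonym 's tape_sym = "'s + nat"

abbreviation blank :: "'s tape_sym" where
  "blank \<equiv> Inr 0"

record 's ntm =
  tapes :: nat
  states :: "nat set"
  symbols :: "'s tape_sym set"
  start :: nat
  accept :: nat
  transitions :: "(nat \<times> 's tape_sym list \<times> nat \<times> 's tape_sym list \<times> move list) set"

definition is_ntm :: "'s set \<Rightarrow> 's ntm \<Rightarrow> bool" where
  "is_ntm \<Sigma> M \<longleftrightarrow>
     tapes M \<ge> 1 \<and> finite (states M) \<and> finite (symbols M) \<and>
     start M \<in> states M \<and> accept M \<in> states M \<and>
     Inl ` \<Sigma> \<subseteq> symbols M \<and> blank \<in> symbols M \<and>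
     (\<forall>(q, as, q', bs, ms)\<in>transitions M. q \<in> states M \<and> q' \<in> states M \<and>
        as \<in> lists (symbols M) \<and> bs \<in> lists (symbols M) \<and>
        length as = tapes M \<and> length bs = tapes M \<and> length ms = tapes M)"

text \<open>A tape is given by its contents and the position of its head.\<close>

type_synonym 's tape = "(int \<Rightarrow> 's tape_sym) \<times> int"

type_synonym 's config = "nat \<times> 's tape list"

definition read :: "'s tape \<Rightarrow> 's tape_sym" where
  "read \<tau> = fst \<tau> (snd \<tau>)"

primrec offset :: "move \<Rightarrow> int" where
  "offset MoveLeft = -1"
| "offset Stay = 0"
| "offset MoveRight = 1"

definition act :: "'s tape_sym \<Rightarrow> move \<Rightarrow> 's tape \<Rightarrow> 's tape" where
  "act a m \<tau> = ((fst \<tau>)(snd \<tau> := a), snd \<tau> + offset m)"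

definition step :: "'s ntm \<Rightarrow> ('s config \<times> 's config) set" where
  "step M = {((q, \<tau>s), (q', \<tau>s')). \<exists>bs ms. (q, map read \<tau>s, q', bs, ms) \<in> transitions M \<and>
     \<tau>s' = map (\<lambda>i. act (bs ! i) (ms ! i) (\<tau>s ! i)) [0..<length \<tau>s]}"

definition input_tape :: "'s list \<Rightarrow> 's tape" where
  "input_tape w =
     ((\<lambda>i. if 0 \<le> i \<and> i < int (length w) then Inl (w ! nat i) else blank), 0)"

definition init_config :: "'s ntm \<Rightarrow> 's list \<Rightarrow> 's config" where
  "init_config M w = (start M, input_tape w # replicate (tapes M - 1) (input_tape []))"

definition accepts_in :: "'s ntm \<Rightarrow> 's list \<Rightarrow> nat \<Rightarrow> bool" where
  "accepts_in M w n \<longleftrightarrow>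
     (\<exists>\<tau>s. (init_config M w, (accept M, \<tau>s)) \<in> step M ^^ n)"

text \<open>The languages over the finite alphabet \<open>\<Sigma>\<close> accepted by a nondeterministic machine in
  polynomial time, where the running time on an accepted word is the length of a shortest
  accepting computation.\<close>

definition NP :: "'s set \<Rightarrow> 's list set set" where
  "NP \<Sigma> = {L. finite \<Sigma> \<and> (\<exists>M. \<exists>p :: nat poly. is_ntm \<Sigma> M \<and>
     L = {w \<in> lists \<Sigma>. \<exists>n. accepts_in M w n} \<and>
     (\<forall>w\<in>L. \<exists>n \<le> poly p (length w). accepts_in M w n))}"

section \<open>The subpower membership problem\<close>

text \<open>As \<open>K\<close> is a fixed finite set of finite algebras, its members and their elements are
  letters of the input alphabet.\<close>

datatype ('f, 'a) smp_sym = Alg "('f, 'a) algebra" | Elem 'a | Sep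

definition smp_alphabet :: "('f, 'a) algebra set \<Rightarrow> ('f, 'a) smp_sym set" where
  "smp_alphabet K = Alg ` K \<union> Elem ` (\<Union>A\<in>K. univ A) \<union> {Sep}"

definition smp_encode ::
  "('f, 'a) algebra list \<Rightarrow> 'a list list \<Rightarrow> 'a list \<Rightarrow> ('f, 'a) smp_sym list" where
  "smp_encode As as b =
     map Alg As @ [Sep] @ concat (map (\<lambda>a. map Elem a @ [Sep]) as) @ map Elem b"

definition SMP ::
  "'f set \<Rightarrow> ('f \<Rightarrow> nat) \<Rightarrow> ('f, 'a) algebra set \<Rightarrow> ('f, 'a) smp_sym list set" where
  "SMP F ar K = {smp_encode As as b | As as b.
     As \<in> lists K \<and> as \<in> lists (univ (prod_alg As)) \<and> b \<in> univ (prod_alg As) \<and>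
     b \<in> Sg F ar (prod_alg As) (set as)}"

end

theory Submission
  imports Defs "HOL-Library.Nat_Bijection"
begin

text \<open>A cube term whose columns are all nonempty sets of rows can be composed with itself until only
  the singletons and the column \<open>{0, 1}\<close> remain; this is an edge term. From an edge term one
  gets the following correction step: if \<open>u\<close> agrees with \<open>b\<close> below \<open>i\<close>, if two elements
  \<open>\<gamma>, \<delta>\<close> agree below \<open>i\<close> and have the entries of \<open>u\<close> and \<open>b\<close> at \<open>i\<close> (a fork), and if
  there are elements agreeing with \<open>b\<close> at \<open>i\<close> and at any \<open>d - 2\<close> further places, then
  polynomially many operations yield an element that agrees with \<open>b\<close> up to \<open>i\<close>. Elements
  with few prescribed entries have derivations of bounded length, since a projection to few
  coordinates has bounded size. Hence, once a set contains witnesses for all forks of the generated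
  subalgebra, each element is obtained coordinate by coordinate. If applying an operation to
  elements obtained in this way leads to an element that cannot be obtained, this exhibits a new
  fork. As there are only linearly many forks, all of them are found by a polynomial
  derivation.

  Membership is in NP because a machine can guess such a derivation, listing the tuples on its
  tapes and computing each new one in a simultaneous sweep over its arguments and the list of
  algebras.\<close>

section \<open>Generated subalgebras and terms\<close>

text \<open>Cost is measured by operations performed, not by the size of terms: a term may become
  exponentially long when written out, whereas a derivation with \<open>N\<close> operations yields
  a circuit with at most \<open>N\<close> gates and can be replayed by a machine. The cube term is
  treated semantically too: a term with prescribed columns exists as soon as a generation statement
  holds in all products of members of \<open>K\<close>, so no composed term is ever written down. In
  an edge term the columns \<open>{0}\<close>, \<open>{0, 1}\<close>, \<open>{1}\<close> act like
  the arguments of a Maltsev term, while the \<open>d - 2\<close> other singletons absorb errors: an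
  error confined to one such argument is removed by the row of that column. This is the origin of
  the \<open>d - 2\<close> further places. The exponent comes about as follows. There are at most
  \<open>n ^ (d - 2)\<close> lists of such places, and enlarging the correct part takes at most
  \<open>n\<close> rounds, hence \<open>n ^ (d - 1)\<close> per coordinate and \<open>n ^ d\<close>
  per element, up to constants; the number of forks contributes the last factor \<open>n\<close>.
  The number of generators does not enter, because generators are available at no cost.\<close>

lemma subuniverse_univ: "is_algebra F ar A \<Longrightarrow> subuniverse F ar A (univ A)"
  by (auto simp: is_algebra_def subuniverse_def)

lemma subset_Sg: "G \<subseteq> Sg F ar A G"
  by (simp add: Sg_def hull_subset)

lemma Sg_mono: "G \<subseteq> H \<Longrightarrow> Sg F ar A G \<subseteq> Sg F ar A H"
  by (simp add: Sg_def hull_mono)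

lemma Sg_minimal: "subuniverse F ar A S \<Longrightarrow> G \<subseteq> S \<Longrightarrow> Sg F ar A G \<subseteq> S"
  by (simp add: Sg_def hull_minimal)

lemma subuniverse_Sg:
  assumes "is_algebra F ar A" "G \<subseteq> univ A"
  shows "subuniverse F ar A (Sg F ar A G)"
proof -
  have sub: "Sg F ar A G \<subseteq> univ A"
    by (rule Sg_minimal[OF subuniverse_univ[OF assms(1)] assms(2)])
  have "oper A f xs \<in> Sg F ar A G"
    if "f \<in> F" "xs \<in> lists (Sg F ar A G)" "length xs = ar f" for f xs
    unfolding Sg_def hull_def
  proof
    fix S assume "S \<in> {S. subuniverse F ar A S \<and> G \<subseteq> S}"
    then have "subuniverse F ar A S" "xs \<in> lists S"
      using that(2) Sg_minimal[of F ar A S G] by auto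
    then show "oper A f xs \<in> S" using that by (auto simp: subuniverse_def)
  qed
  with sub show ?thesis by (auto simp: subuniverse_def)
qed

lemma Sg_subset_univ: "is_algebra F ar A \<Longrightarrow> G \<subseteq> univ A \<Longrightarrow> Sg F ar A G \<subseteq> univ A"
  using subuniverse_Sg[of F ar A G] by (auto simp: subuniverse_def)

lemma Sg_oper:
  assumes "is_algebra F ar A" "G \<subseteq> univ A" "f \<in> F" "set xs \<subseteq> Sg F ar A G" "length xs = ar f"
  shows "oper A f xs \<in> Sg F ar A G"
  using subuniverse_Sg[OF assms(1,2)] assms(3-)
  unfolding subuniverse_def by (meson in_lists_conv_set subsetD)

lemma eval_in_subuniverse:
  assumes "t \<in> terms F ar X" "\<And>i. i \<in> X \<Longrightarrow> \<rho> i \<in> S" "subuniverse F ar A S"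
  shows "eval A \<rho> t \<in> S"
  using assms(1)
proof induction
  case (2 f ts)
  then have "map (eval A \<rho>) ts \<in> lists S" by auto
  then show ?case using 2 assms(3) by (auto simp: subuniverse_def)
qed (use assms in auto)

lemma eval_cong:
  assumes "t \<in> terms F ar X" "\<And>i. i \<in> X \<Longrightarrow> \<rho> i = \<rho>' i"
  shows "eval A \<rho> t = eval A \<rho>' t"
  using assms(1)
proof induction
  case (2 f ts)
  then have "map (eval A \<rho>) ts = map (eval A \<rho>') ts" by auto
  then show ?case by (metis eval.simps(2))
qed (use assms in auto)

lemma eval_subst: "eval A \<rho> (subst \<sigma> t) = eval A (\<lambda>i. eval A \<rho> (\<sigma> i)) t"
  by (induction t) (simp_all add: o_def cong: map_cong)

lemma subst_in_terms:
  assumes "t \<in> terms F ar X" "\<And>i. i \<in> X \<Longrightarrow> \<sigma> i \<in> terms F ar Y"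
  shows "subst \<sigma> t \<in> terms F ar Y"
  using assms(1) by induction (auto intro!: terms.intros(2) assms(2))

lemma Sg_image_terms:
  assumes "is_algebra F ar A" "\<rho> ` X \<subseteq> univ A" "b \<in> Sg F ar A (\<rho> ` X)"
  obtains t where "t \<in> terms F ar X" "eval A \<rho> t = b"
proof -
  let ?S = "eval A \<rho> ` terms F ar X"
  have "subuniverse F ar A ?S"
    unfolding subuniverse_def
  proof (intro conjI ballI impI)
    show "?S \<subseteq> univ A"
      using eval_in_subuniverse[OF _ _ subuniverse_univ[OF assms(1)]] assms(2) by blast
  next
    fix f xs assume f: "f \<in> F" and xs: "xs \<in> lists ?S" "length xs = ar f"
    then have "\<forall>x\<in>set xs. \<exists>t\<in>terms F ar X. eval A \<rho> t = x" by auto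
    then obtain g where g: "\<forall>x\<in>set xs. g x \<in> terms F ar X \<and> eval A \<rho> (g x) = x" by metis
    then have "map (eval A \<rho>) (map g xs) = xs" by (simp add: map_idI)
    moreover have "Fun f (map g xs) \<in> terms F ar X" using f xs g by (auto intro!: terms.intros(2))
    ultimately show "oper A f xs \<in> ?S" by (metis eval.simps(2) imageI)
  qed
  moreover have "\<rho> ` X \<subseteq> ?S" by (force intro: terms.intros)
  ultimately have "b \<in> ?S" using Sg_minimal[of F ar A ?S "\<rho> ` X"] assms(3) by auto
  then show ?thesis using that by auto
qed

section \<open>Derivations with a bounded number of operations\<close>

text \<open>A straight-line program seen as a growing set: every step may reuse all elements
  obtained so far. Steps are counted even if they reproduce an old element.\<close>

inductive derives ::
  "'f set \<Rightarrow> ('f \<Rightarrow> nat) \<Rightarrow> ('f, 'b) algebra \<Rightarrow> 'b set \<Rightarrow> nat \<Rightarrow> 'b set \<Rightarrow> bool"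
  for F ar A G where
  derives_0: "derives F ar A G 0 G"
| derives_Suc: "derives F ar A G N S \<Longrightarrow> f \<in> F \<Longrightarrow> set xs \<subseteq> S \<Longrightarrow> length xs = ar f \<Longrightarrow>
    derives F ar A G (Suc N) (insert (oper A f xs) S)"

lemma derives_superset: "derives F ar A G N S \<Longrightarrow> G \<subseteq> S"
  by (induction rule: derives.induct) auto

lemma derives_mono: "derives F ar A G N S \<Longrightarrow> G \<subseteq> H \<Longrightarrow> derives F ar A H N (H \<union> S)"
proof (induction rule: derives.induct)
  case derives_0
  then show ?case by (simp add: derives.derives_0 Un_absorb2)
next
  case (derives_Suc N S f xs)
  then show ?case using derives.derives_Suc[of F ar A H N "H \<union> S" f xs] by auto
qed

lemma derives_trans:
  "derives F ar A H M T \<Longrightarrow> derives F ar A G N H \<Longrightarrow> derives F ar A G (N + M) T"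
  by (induction rule: derives.induct) (auto intro: derives.intros)

lemma derives_in_Sg:
  assumes "is_algebra F ar A" "G \<subseteq> univ A"
  shows "derives F ar A G N S \<Longrightarrow> S \<subseteq> Sg F ar A G"
  by (induction rule: derives.induct) (auto simp: subset_Sg intro!: Sg_oper[OF assms])

definition reach ::
  "'f set \<Rightarrow> ('f \<Rightarrow> nat) \<Rightarrow> ('f, 'b) algebra \<Rightarrow> nat \<Rightarrow> 'b set \<Rightarrow> 'b set \<Rightarrow> bool" where
  "reach F ar A N S T \<longleftrightarrow> (\<exists>N' S'. N' \<le> N \<and> derives F ar A S N' S' \<and> T \<subseteq> S')"

lemma reach_refl: "T \<subseteq> S \<Longrightarrow> reach F ar A N S T"
  by (auto simp: reach_def intro: derives_0)

text \<open>The second derivation is run on top of everything produced by the first. The loose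
  inclusions for \<open>R\<close> and \<open>W\<close> build weakening into composition, so that
  chained derivations need no separate monotonicity steps.\<close>

lemma reach_trans:
  assumes "reach F ar A N S T" "reach F ar A M R U" "R \<subseteq> S \<union> T" "W \<subseteq> S \<union> T \<union> U" "N + M \<le> L"
  shows "reach F ar A L S W"
proof -
  obtain N' S' where 1: "N' \<le> N" "derives F ar A S N' S'" "T \<subseteq> S'"
    using assms(1) by (auto simp: reach_def)
  obtain M' R' where 2: "M' \<le> M" "derives F ar A R M' R'" "U \<subseteq> R'"
    using assms(2) by (auto simp: reach_def)
  have "S \<subseteq> S'" using derives_superset[OF 1(2)] .
  then have "derives F ar A S' M' (S' \<union> R')" 
    using \<open>S \<subseteq> S'\<close> 1(3) assms(3) by (intro derives_mono[OF 2(2)]) auto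
  then have "derives F ar A S (N' + M') (S' \<union> R')" using 1 derives_trans by blast
  moreover have "W \<subseteq> S' \<union> R'" using \<open>S \<subseteq> S'\<close> 1 2 assms(4) by auto
  moreover have "N' + M' \<le> L" using 1 2 assms(5) by linarith
  ultimately show ?thesis unfolding reach_def by blast
qed

lemma reach_mono:
  assumes "reach F ar A N S T" "S \<subseteq> S'" "T' \<subseteq> S' \<union> T" "N \<le> N'"
  shows "reach F ar A N' S' T'"
  using reach_trans[OF reach_refl[of S S' F ar A 0] assms(1)] assms by auto

lemma reach_Un:
  assumes "reach F ar A N S T" "reach F ar A M S U"
  shows "reach F ar A (N + M) S (T \<union> U)"
  by (rule reach_trans[OF assms]) auto

lemma reach_UN:
  assumes "finite I" "\<And>x. x \<in> I \<Longrightarrow> reach F ar A N S (T x)"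
  shows "reach F ar A (card I * N) S (\<Union>x\<in>I. T x)"
  using assms
proof (induction I rule: finite_induct)
  case (insert x I)
  then have "reach F ar A (N + card I * N) S (T x \<union> (\<Union>x\<in>I. T x))" by (intro reach_Un) auto
  then show ?case using insert by simp
qed (auto intro: reach_refl)

lemma reach_oper:
  assumes "reach F ar A N S (set xs)" "f \<in> F" "length xs = ar f"
  shows "reach F ar A (Suc N) S {oper A f xs}"
proof -
  obtain N' S' where 1: "N' \<le> N" "derives F ar A S N' S'" "set xs \<subseteq> S'"
    using assms(1) by (auto simp: reach_def)
  then have "derives F ar A S (Suc N') (insert (oper A f xs) S')"
    using assms by (intro derives_Suc) auto
  then show ?thesis using 1 unfolding reach_def by blast
qed

lemma reach_in_Sg:
  assumes "is_algebra F ar A" "G \<subseteq> univ A" "reach F ar A N G T"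
  shows "T \<subseteq> Sg F ar A G"
  using derives_in_Sg[OF assms(1,2)] assms(3) unfolding reach_def by blast

text \<open>Repeated subterms are counted repeatedly. This is harmless because the cost bounds apply
  it to a fixed edge term only, where it is a constant.\<close>

primrec gate_count :: "'f trm \<Rightarrow> nat" where
  "gate_count (Var i) = 0"
| "gate_count (Fun f ts) = Suc (sum_list (map gate_count ts))"

lemma reach_list:
  "(\<And>t. t \<in> set ts \<Longrightarrow> reach F ar A (c t) S {h t}) \<Longrightarrow>
   reach F ar A (sum_list (map c ts)) S (h ` set ts)"
proof (induction ts)
  case (Cons t ts)
  then have "reach F ar A (c t + sum_list (map c ts)) S ({h t} \<union> h ` set ts)"
    by (intro reach_Un) auto
  then show ?case by simp
qed (simp add: reach_refl)

lemma reach_eval: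
  assumes "t \<in> terms F ar X" "\<rho> ` X \<subseteq> S"
  shows "reach F ar A (gate_count t) S {eval A \<rho> t}"
  using assms(1)
proof induction
  case (1 i)
  then show ?case using assms(2) by (auto intro: reach_refl)
next
  case (2 f ts)
  then have "reach F ar A (sum_list (map gate_count ts)) S (eval A \<rho> ` set ts)"
    by (intro reach_list) auto
  then show ?case using 2 reach_oper[of F ar A _ S "map (eval A \<rho>) ts" f] by simp
qed

text \<open>A derivation producing a new value of \<open>\<phi>\<close> in every step stops after at most
  \<open>card \<Phi>\<close> steps, and then all values on the generated subalgebra have been produced.\<close>

lemma reach_up_to_kernel:
  assumes alg: "is_algebra F ar A" "G \<subseteq> univ A"
    and fin: "finite \<Phi>" "\<phi> ` univ A \<subseteq> \<Phi>"
    and compat: "\<And>f xs ys. \<lbrakk>f \<in> F; set xs \<subseteq> univ A; set ys \<subseteq> univ A; length xs = ar f;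
      length ys = ar f; map \<phi> xs = map \<phi> ys\<rbrakk> \<Longrightarrow> \<phi> (oper A f xs) = \<phi> (oper A f ys)"
    and w: "w \<in> Sg F ar A G"
  obtains w' where "\<phi> w' = \<phi> w" "reach F ar A (card \<Phi>) G {w'}"
proof -
  let ?P = "\<lambda>N. \<exists>S. derives F ar A G N S \<and> N \<le> card (\<phi> ` S)"
  note SgU = Sg_subset_univ[OF alg]
  have fS: "\<phi> ` S \<subseteq> \<Phi>" if "derives F ar A G N S" for N S
    using derives_in_Sg[OF alg that] SgU fin(2) by blast
  have bnd: "\<forall>N. ?P N \<longrightarrow> N < Suc (card \<Phi>)"
  proof (intro allI impI)
    fix N assume "?P N"
    then obtain S where S: "derives F ar A G N S" "N \<le> card (\<phi> ` S)" by blast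
    then show "N < Suc (card \<Phi>)" using card_mono[OF fin(1) fS[OF S(1)]] by simp
  qed
  have "?P 0" using derives_0[of F ar A G] by auto
  from ex_has_greatest_nat[where f = "\<lambda>x. x", OF this bnd]
  obtain N where N: "?P N" "\<And>N'. ?P N' \<Longrightarrow> N' \<le> N" by auto
  then obtain S where S: "derives F ar A G N S" "N \<le> card (\<phi> ` S)" by blast
  note SSg = derives_in_Sg[OF alg S(1)]
  have closed: "\<phi> (oper A f xs) \<in> \<phi> ` S" if "f \<in> F" "set xs \<subseteq> S" "length xs = ar f" for f xs
  proof (rule ccontr)
    assume new: "\<phi> (oper A f xs) \<notin> \<phi> ` S"
    have "derives F ar A G (Suc N) (insert (oper A f xs) S)" using S that by (intro derives_Suc)
    moreover have "Suc N \<le> card (\<phi> ` insert (oper A f xs) S)"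
      using new S(2) finite_subset[OF fS[OF S(1)] fin(1)] by simp
    ultimately show False using N(2)[of "Suc N"] by force
  qed
  \<comment> \<open>\<open>S\<close> itself need not be closed under the operations. Its saturation
    under the kernel of \<open>\<phi>\<close> is: arguments can be exchanged for elements of
    \<open>S\<close> with the same values.\<close>
  let ?T = "{v \<in> Sg F ar A G. \<phi> v \<in> \<phi> ` S}"
  have "subuniverse F ar A ?T"
    unfolding subuniverse_def
  proof (intro conjI ballI impI)
    show "?T \<subseteq> univ A" using SgU by auto
  next
    fix f xs assume f: "f \<in> F" and xs: "xs \<in> lists ?T" "length xs = ar f"
    then have "\<forall>x\<in>set xs. \<exists>y\<in>S. \<phi> y = \<phi> x" by fastforce
    then obtain g where g: "\<forall>x\<in>set xs. g x \<in> S \<and> \<phi> (g x) = \<phi> x" by metis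
    have xs': "set xs \<subseteq> Sg F ar A G" using xs by auto
    have "\<phi> (oper A f xs) = \<phi> (oper A f (map g xs))"
      by (rule compat) (use f xs xs' g SgU SSg in auto)
    also have "\<dots> \<in> \<phi> ` S" using closed[of f "map g xs"] f xs g by auto
    finally show "oper A f xs \<in> ?T" using Sg_oper[OF alg f xs' xs(2)] by simp
  qed
  moreover have "G \<subseteq> ?T" using subset_Sg derives_superset[OF S(1)] by fastforce
  ultimately have "w \<in> ?T" using Sg_minimal[of F ar A ?T G] w by auto
  then obtain w' where "w' \<in> S" "\<phi> w' = \<phi> w" by force
  moreover have "N \<le> card \<Phi>" using bnd N(1) less_Suc_eq_le by blast
  ultimately show ?thesis using that S(1) unfolding reach_def by blast
qed

section \<open>Products\<close>

lemma in_listset: "xs \<in> listset Bs \<longleftrightarrow> length xs = length Bs \<and> (\<forall>i<length Bs. xs ! i \<in> Bs ! i)"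
proof (induction Bs arbitrary: xs)
  case (Cons B Bs)
  then show ?case by (cases xs) (auto simp: set_Cons_def less_Suc_eq_0_disj nth_Cons')
qed simp

lemma univ_prod_alg: "x \<in> univ (prod_alg As) \<longleftrightarrow>
    length x = length As \<and> (\<forall>p<length As. x ! p \<in> univ (As ! p))"
  by (auto simp: prod_alg_def in_listset)

lemma oper_prod_nth: "p < length As \<Longrightarrow>
    oper (prod_alg As) f xs ! p = oper (As ! p) f (map (\<lambda>x. x ! p) xs)"
  by (simp add: prod_alg_def)

lemma length_oper_prod: "length (oper (prod_alg As) f xs) = length As"
  by (simp add: prod_alg_def)

lemma eval_prod_nth: "p < length As \<Longrightarrow>
    eval (prod_alg As) \<rho> t ! p = eval (As ! p) (\<lambda>i. \<rho> i ! p) t"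
  by (induction t) (simp_all add: oper_prod_nth o_def cong: map_cong)

lemma is_algebra_prod:
  assumes "\<And>A. A \<in> set As \<Longrightarrow> is_algebra F ar A"
  shows "is_algebra F ar (prod_alg As)"
  unfolding is_algebra_def
proof (intro conjI ballI impI)
  have "\<forall>A\<in>set As. \<exists>x. x \<in> univ A" using assms by (meson is_algebra_def ex_in_conv)
  then obtain g where "\<forall>A\<in>set As. g A \<in> univ A" by metis
  then have "map g As \<in> univ (prod_alg As)" by (simp add: univ_prod_alg)
  then show "univ (prod_alg As) \<noteq> {}" by auto
next
  fix f xs assume f: "f \<in> F" and xs: "xs \<in> lists (univ (prod_alg As))" "length xs = ar f"
  have "oper (As ! p) f (map (\<lambda>x. x ! p) xs) \<in> univ (As ! p)" if p: "p < length As" for p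
  proof -
    have "map (\<lambda>x. x ! p) xs \<in> lists (univ (As ! p))" using xs p by (auto simp: univ_prod_alg)
    then show ?thesis using assms[of "As ! p"] p f xs by (auto simp: is_algebra_def)
  qed
  then show "oper (prod_alg As) f xs \<in> univ (prod_alg As)"
    by (simp add: univ_prod_alg length_oper_prod oper_prod_nth)
qed

section \<open>From a cube term to an edge term\<close>

text \<open>The variety is not mentioned here: once the cube term has been turned into a
  \<open>column_term\<close>, its identities are needed in the members of \<open>K\<close>
  only.\<close>

locale cube_algebras =
  fixes F :: "'f set" and ar :: "'f \<Rightarrow> nat" and d :: nat and K :: "('f, 'a) algebra set"
  assumes finite_F: "finite F" and finite_K: "finite K" and d: "d > 1"
    and algebra: "\<And>A. A \<in> K \<Longrightarrow> is_algebra F ar A"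
    and finite_univ: "\<And>A. A \<in> K \<Longrightarrow> finite (univ A)"
begin

text \<open>Columns are identified with the set of rows in which they contain the variable \<open>x\<close>,
  and the variable of \<open>q\<close> with index \<open>j\<close> stands for the column \<open>set_decode j\<close>.\<close>

definition column_term :: "nat set set \<Rightarrow> 'f trm \<Rightarrow> bool" where
  "column_term \<C> q \<longleftrightarrow> q \<in> terms F ar (set_encode ` \<C>) \<and>
     (\<forall>A\<in>K. \<forall>k<d. \<forall>x\<in>univ A. \<forall>y\<in>univ A.
        eval A (\<lambda>j. if k \<in> set_decode j then x else y) q = y)"

text \<open>Since \<open>q\<close> has no variables other than the codes of columns in
  \<open>\<C>\<close>, it suffices to control \<open>\<phi>\<close> on these. Later assignments are
  defined by cases on the column.\<close>

lemma column_term_row: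
  assumes "column_term \<C> q" "\<And>c. c \<in> \<C> \<Longrightarrow> finite c" "A \<in> K" "k < d" "x \<in> univ A" "y \<in> univ A"
    and "\<And>c. c \<in> \<C> \<Longrightarrow> \<phi> c = (if k \<in> c then x else y)"
  shows "eval A (\<lambda>j. \<phi> (set_decode j)) q = y"
proof -
  have "eval A (\<lambda>j. \<phi> (set_decode j)) q = eval A (\<lambda>j. if k \<in> set_decode j then x else y) q"
    using assms(1) by (intro eval_cong[of q F ar "set_encode ` \<C>"])
      (auto simp: column_term_def assms(2,7))
  then show ?thesis using assms by (simp add: column_term_def)
qed

lemma column_term_idem:
  assumes "column_term \<C> q" "\<And>c. c \<in> \<C> \<Longrightarrow> finite c" "A \<in> K" "y \<in> univ A"
    and "\<And>c. c \<in> \<C> \<Longrightarrow> \<phi> c = y"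
  shows "eval A (\<lambda>j. \<phi> (set_decode j)) q = y"
  using assms d by (intro column_term_row[where k = 0 and x = y]) auto

lemma column_term_closed:
  assumes "column_term \<C> q" "\<And>c. c \<in> \<C> \<Longrightarrow> finite c" "subuniverse F ar A S"
    and "\<And>c. c \<in> \<C> \<Longrightarrow> \<phi> c \<in> S"
  shows "eval A (\<lambda>j. \<phi> (set_decode j)) q \<in> S"
  using assms by (intro eval_in_subuniverse[of q F ar "set_encode ` \<C>"])
    (auto simp: column_term_def)

text \<open>A free algebra argument: in the product with one factor for every choice of an algebra,
  a row and a pair \<open>x, y\<close>, a single term that produces \<open>b\<close> from the
  corners satisfies all required identities at once. Finiteness of \<open>K\<close> and of its
  members makes the number of factors finite.\<close>

lemma column_term_exists:
  assumes fin: "\<And>c. c \<in> \<C> \<Longrightarrow> finite c"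
    and sem: "\<And>As row e b. \<lbrakk>As \<in> lists K; \<And>p. p < length As \<Longrightarrow> row p < d;
      \<And>p. p < length As \<Longrightarrow> e p \<in> univ (As ! p); \<And>p. p < length As \<Longrightarrow> b p \<in> univ (As ! p)\<rbrakk>
      \<Longrightarrow> map b [0..<length As] \<in> Sg F ar (prod_alg As)
        ((\<lambda>c. map (\<lambda>p. if row p \<in> c then e p else b p) [0..<length As]) ` \<C>)"
  shows "\<exists>q. column_term \<C> q"
proof -
  define \<Theta> where "\<Theta> = (SIGMA A:K. {..<d} \<times> univ A \<times> univ A)"
  have "finite \<Theta>" using finite_K finite_univ by (auto simp: \<Theta>_def)
  then obtain \<theta>s where \<theta>s: "set \<theta>s = \<Theta>" using finite_list by blast
  define As where "As = map fst \<theta>s"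
  define row where "row p = fst (snd (\<theta>s ! p))" for p
  define e where "e p = fst (snd (snd (\<theta>s ! p)))" for p
  define b where "b p = snd (snd (snd (\<theta>s ! p)))" for p
  have mem: "As ! p \<in> K \<and> row p < d \<and> e p \<in> univ (As ! p) \<and> b p \<in> univ (As ! p)"
    if "p < length As" for p
  proof -
    have "\<theta>s ! p \<in> \<Theta>" using that \<theta>s by (auto simp: As_def)
    then show ?thesis using that by (auto simp: \<Theta>_def As_def row_def e_def b_def)
  qed
  have As: "As \<in> lists K" using mem by (auto simp: in_set_conv_nth)
  define corner where
    "corner c = map (\<lambda>p. if row p \<in> c then e p else b p) [0..<length As]" for c
  have U: "corner c \<in> univ (prod_alg As)" for c
    using mem by (auto simp: corner_def univ_prod_alg)
  have alg: "is_algebra F ar (prod_alg As)" using As algebra by (intro is_algebra_prod) auto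
  have im: "(\<lambda>j. corner (set_decode j)) ` set_encode ` \<C> = corner ` \<C>"
    unfolding image_image by (rule image_cong) (auto simp: fin)
  have "map b [0..<length As] \<in> Sg F ar (prod_alg As) ((\<lambda>j. corner (set_decode j)) ` set_encode ` \<C>)"
    unfolding im unfolding corner_def by (rule sem) (use As mem in auto)
  from Sg_image_terms[OF alg _ this]
  obtain q where q: "q \<in> terms F ar (set_encode ` \<C>)"
    "eval (prod_alg As) (\<lambda>j. corner (set_decode j)) q = map b [0..<length As]"
    using U by auto
  have "eval A (\<lambda>j. if k \<in> set_decode j then x else y) q = y"
    if "A \<in> K" "k < d" "x \<in> univ A" "y \<in> univ A" for A k x y
  proof -
    have "(A, k, x, y) \<in> set \<theta>s" using that \<theta>s by (simp add: \<Theta>_def)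
    then obtain p where p: "p < length As" "\<theta>s ! p = (A, k, x, y)"
      by (auto simp: in_set_conv_nth As_def)
    have "eval (prod_alg As) (\<lambda>j. corner (set_decode j)) q ! p = y"
      using p q(2) by (simp add: b_def)
    moreover have "As ! p = A" using p by (simp add: As_def)
    ultimately show ?thesis using p(1) p(2)
      by (simp add: eval_prod_nth corner_def row_def e_def b_def cong: if_cong)
  qed
  then show ?thesis using q(1) by (auto simp: column_term_def)
qed

text \<open>The parameter interpolates between the two kinds of terms: \<open>columns d\<close>
  consists of all nonempty sets of rows, \<open>columns 2\<close> of \<open>{0, 1}\<close> and the
  \<open>d\<close> singletons.\<close>

definition columns :: "nat \<Rightarrow> nat set set" where
  "columns r = {c. c \<noteq> {} \<and> c \<subseteq> {..<r}} \<union> (\<lambda>j. {j}) ` {r..<d}"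

lemma finite_columns: "c \<in> columns r \<Longrightarrow> finite c"
  by (auto simp: columns_def intro: finite_subset)

text \<open>Renaming each variable to the code of its column identifies variables with equal
  columns. The columns are nonempty because each of them contains an \<open>x\<close>.\<close>

lemma column_term_of_cube_term:
  assumes "is_cube_term F ar V d t" "K \<subseteq> V"
  shows "\<exists>q. column_term (columns d) q"
proof -
  obtain m M where t: "t \<in> terms F ar {..<m}"
    and M: "\<And>j. j < m \<Longrightarrow> \<exists>i<d. M i j = 0"
    and sat: "\<And>A i. A \<in> V \<Longrightarrow> i < d \<Longrightarrow> satisfies A (subst (\<lambda>j. Var (M i j)) t) (Var 1)"
    using assms(1) unfolding is_cube_term_def by blast
  define col where "col j = {i. i < d \<and> M i j = 0}" for j
  define q where "q = subst (\<lambda>j. Var (set_encode (col j))) t"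
  have "q \<in> terms F ar (set_encode ` columns d)"
    unfolding q_def using t by (rule subst_in_terms)
      (use M in \<open>auto simp: col_def columns_def intro!: terms.intros(1)\<close>)
  moreover have "eval A (\<lambda>j. if k \<in> set_decode j then x else y) q = y"
    if "A \<in> K" "k < d" "x \<in> univ A" "y \<in> univ A" for A k x y
  proof -
    let ?\<rho> = "\<lambda>v. if v = 0 then x else y"
    have "eval A ?\<rho> (subst (\<lambda>j. Var (M k j)) t) = eval A ?\<rho> (Var 1)"
      using sat[of A k] assms(2) that unfolding satisfies_def by (force dest!: spec[of _ ?\<rho>])
    moreover have "finite (col j)" for j by (simp add: col_def)
    ultimately show ?thesis using that
      by (simp add: q_def eval_subst) (simp add: col_def)
  qed
  ultimately show ?thesis by (auto simp: column_term_def)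
qed

text \<open>The corners of a cube with \<open>Suc r\<close> directions are produced for new deviations \<open>e'\<close>: below
  \<open>r\<close>, the values \<open>e'\<close> arise from \<open>e\<close> by putting \<open>b\<close> at the singleton columns \<open>{r}, \<dots>, {d - 1}\<close>, where
  the elements deviating in a single direction \<open>\<ge> r\<close> can be used.\<close>

lemma column_term_reduce:
  assumes q: "column_term (columns (Suc r)) q" and r: "2 \<le> r" "r < d"
  shows "\<exists>q'. column_term (columns r) q'"
proof (rule column_term_exists)
  fix As :: "('f, 'a) algebra list" and row e b
  assume As: "As \<in> lists K" and row: "\<And>p. p < length As \<Longrightarrow> row p < d"
    and e: "\<And>p. p < length As \<Longrightarrow> e p \<in> univ (As ! p)"
    and b: "\<And>p. p < length As \<Longrightarrow> b p \<in> univ (As ! p)"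
  define n where "n = length As"
  define E where "E c = (\<lambda>p. if row p \<in> c then e p else b p)" for c
  define B where "B = Sg F ar (prod_alg As) ((\<lambda>c. map (E c) [0..<n]) ` columns r)"
  define U where "U = (\<lambda>j. {j}) ` {r..<d}"
  define In where "In h \<longleftrightarrow> map h [0..<n] \<in> B" for h
  have AK: "As ! p \<in> K" if "p < n" for p using As that by (auto simp: n_def)
  have alg: "is_algebra F ar (prod_alg As)" using As algebra by (intro is_algebra_prod) auto
  have EU: "(\<lambda>c. map (E c) [0..<n]) ` columns r \<subseteq> univ (prod_alg As)"
    using e b by (auto simp: E_def univ_prod_alg n_def)
  have Bsub: "subuniverse F ar (prod_alg As) B"
    unfolding B_def by (rule subuniverse_Sg[OF alg EU])
  have InE: "In (E c)" if "c \<in> columns r" for c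
    unfolding In_def B_def by (rule subsetD[OF subset_Sg]) (use that in auto)
  have app: "In h"
    if g: "\<And>c. c \<in> columns (Suc r) \<Longrightarrow> In (g c)"
      and h: "\<And>p. p < n \<Longrightarrow> h p = eval (As ! p) (\<lambda>j. g (set_decode j) p) q" for g h
  proof -
    let ?v = "eval (prod_alg As) (\<lambda>j. map (g (set_decode j)) [0..<n]) q"
    have v: "?v \<in> B"
      by (rule column_term_closed[OF q finite_columns Bsub]) (use g in \<open>auto simp: In_def\<close>)
    then have "length ?v = n"
      using Bsub by (auto simp: subuniverse_def univ_prod_alg n_def)
    then have "?v = map h [0..<n]"
      by (intro nth_equalityI) (auto simp: h eval_prod_nth n_def)
    then show ?thesis using v by (simp add: In_def)
  qed
  have qcong: "eval A (\<lambda>j. \<phi> (set_decode j)) q = eval A (\<lambda>j. \<psi> (set_decode j)) q"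
    if "\<And>c. c \<in> columns (Suc r) \<Longrightarrow> \<phi> c = \<psi> c" for A :: "('f, 'a) algebra" and \<phi> \<psi>
    using q that by (intro eval_cong[of q F ar "set_encode ` columns (Suc r)"])
      (auto simp: column_term_def finite_columns)
  have qrow: "eval (As ! p) (\<lambda>j. \<phi> (set_decode j)) q = b p"
    if "p < n" "k < d" "x \<in> univ (As ! p)"
      "\<And>c. c \<in> columns (Suc r) \<Longrightarrow> \<phi> c = (if k \<in> c then x else b p)" for p k x \<phi>
    using that b by (intro column_term_row[OF q finite_columns AK]) (auto simp: n_def)
  have qidem: "eval (As ! p) (\<lambda>j. \<phi> (set_decode j)) q = y"
    if "p < n" "y \<in> univ (As ! p)" "\<And>c. c \<in> columns (Suc r) \<Longrightarrow> \<phi> c = y" for p y \<phi>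
    using that by (intro column_term_idem[OF q finite_columns AK]) auto
  have col: "(\<exists>j. c = {j} \<and> r \<le> j \<and> j < d \<and> c \<in> U) \<or> (c \<notin> U \<and> c \<subseteq> {..r} \<and> c \<inter> {..<r} \<noteq> {})"
    if "c \<in> columns (Suc r)" for c
  proof (cases "c \<in> U")
    case True
    then show ?thesis by (auto simp: U_def)
  next
    case False
    then have "c \<noteq> {}" "c \<subseteq> {..r}" "c \<noteq> {r}"
      using that r by (auto simp: columns_def U_def)
    then have "\<exists>j\<in>c. j \<noteq> r" using subset_singletonD[of c r] by blast
    then show ?thesis using False \<open>c \<subseteq> {..r}\<close> by force
  qed
  \<comment> \<open>Row \<open>r\<close> is special: the only generator deviating from
    \<open>b\<close> there is \<open>E {r}\<close>, so \<open>q\<close> is evaluated with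
    \<open>e\<close> at \<open>{r}\<close> alone. Rows above \<open>r\<close> keep \<open>e\<close>,
    because the corner for their singleton column is already a generator.\<close>
  define e' where "e' p = (if row p < r
      then eval (As ! p) (\<lambda>j. if set_decode j \<in> U then b p else e p) q
      else if row p = r then eval (As ! p) (\<lambda>j. if set_decode j = {r} then e p else b p) q
      else e p)" for p
  have e': "e' p \<in> univ (As ! p)" if "p < n" for p
  proof -
    have "subuniverse F ar (As ! p) (univ (As ! p))"
      using AK[OF that] algebra subuniverse_univ by blast
    then show ?thesis using e b that q unfolding e'_def n_def column_term_def
      by (auto intro!: eval_in_subuniverse)
  qed
  define M where "M S T = (\<lambda>p. if row p \<in> S then e' p else if row p \<in> T then e p else b p)" for S T
  have Mu: "M S T p \<in> univ (As ! p)" if "p < n" for S T p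
    using that e e' b by (auto simp: M_def n_def)
  have InE_sub: "In (E c)" if "c \<noteq> {}" "c \<subseteq> {..<r}" for c
    using that by (intro InE) (auto simp: columns_def)
  have InE_U: "In (E c)" if "c \<in> U" for c
    using that by (intro InE) (auto simp: columns_def U_def)
  have single: "In (M {j} {})" if j: "j < r" for j
  proof -
    \<comment> \<open>A second direction below \<open>r\<close> exists as \<open>2 \<le> r\<close>.
      The family \<open>g\<close> deviates in direction \<open>k\<close> exactly at the columns
      containing \<open>r\<close>, so row \<open>r\<close> of the identities removes these
      deviations; putting \<open>E {r}\<close> at \<open>{r}\<close> instead would leave a deviation
      at \<open>{r}\<close> alone.\<close>
    obtain k where k: "k < r" "k \<noteq> j" using that[of "if j = 0 then 1 else 0"] r(1) by auto
    define g where "g c = (if r \<in> c then if c = {r} then E {k} else E {j, k}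
       else if c \<in> U then E c else E {j})" for c
    show ?thesis
    proof (rule app[of g])
      fix c assume "c \<in> columns (Suc r)"
      then show "In (g c)" using j k by (simp add: g_def InE_sub InE_U)
    next
      fix p assume p: "p < n"
      then have p': "p < length As" by (simp add: n_def)
      consider "row p = j" | "row p = k" | "row p = r" | "row p > r" | "row p < r" "row p \<noteq> j" "row p \<noteq> k"
        by linarith
      then show "M {j} {} p = eval (As ! p) (\<lambda>i. g (set_decode i) p) q"
      proof cases
        case 1
        then have "e' p = eval (As ! p) (\<lambda>i. (\<lambda>c. if c \<in> U then b p else e p) (set_decode i)) q"
          using j by (simp add: e'_def)
        also have "\<dots> = eval (As ! p) (\<lambda>i. g (set_decode i) p) q"
          by (rule qcong[of _ "\<lambda>c. g c p"], drule col) (use 1 j k in \<open>auto simp: g_def E_def\<close>)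
        finally show ?thesis using 1 by (simp add: M_def)
      next
        case 2
        have "eval (As ! p) (\<lambda>i. g (set_decode i) p) q = b p"
          by (rule qrow[OF p r(2) e[of p], of "\<lambda>c. g c p"])
            (use p 2 j k in \<open>auto simp: g_def E_def n_def U_def\<close>)
        then show ?thesis using 2 k by (simp add: M_def)
      next
        case 3
        have "eval (As ! p) (\<lambda>i. g (set_decode i) p) q = b p"
          by (rule qidem[OF p b[of p], of "\<lambda>c. g c p"])
            (use p 3 j k in \<open>auto simp: g_def E_def n_def U_def\<close>)
        then show ?thesis using 3 j by (simp add: M_def)
      next
        case 4
        have "eval (As ! p) (\<lambda>i. g (set_decode i) p) q = b p"
        proof (rule qrow[OF p row[OF p'] e[OF p'], of "\<lambda>c. g c p"])
          fix c assume c: "c \<in> columns (Suc r)"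
          show "g c p = (if row p \<in> c then e p else b p)"
            using col[OF c] 4 j k by (auto simp: g_def E_def)
        qed
        then show ?thesis using 4 j by (simp add: M_def)
      next
        case 5
        have "eval (As ! p) (\<lambda>i. g (set_decode i) p) q = b p"
          by (rule qidem[OF p b[of p], of "\<lambda>c. g c p"])
            (use p 5 j k in \<open>auto simp: g_def E_def n_def U_def\<close>)
        then show ?thesis using 5 by (simp add: M_def)
      qed
    qed
  qed
  have mixed: "In (M S T)" if "finite S" "S \<union> T \<noteq> {}" "S \<subseteq> {..<r}" "T \<subseteq> {..<r}" "S \<inter> T = {}" for S T
    using that
  proof (induction S arbitrary: T rule: finite_induct)
    case empty
    have "M {} T = E T" by (auto simp: M_def E_def)
    then show ?case using empty InE_sub by auto
  next
    case (insert j S)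
    show ?case
    proof (cases "S \<union> T = {}")
      case True
      then show ?thesis using single[of j] insert by auto
    next
      case False
      \<comment> \<open>In row \<open>j\<close> this is the pattern defining \<open>e'\<close>; in
        every other row \<open>g\<close> is constant over the columns, and idempotence preserves the
        entry. Since \<open>M S T\<close> itself is used, \<open>S \<union> T\<close> must not be
        empty, which is why \<open>single\<close> was treated separately.\<close>
      define g where "g c = (if c \<in> U then M S T else M S (insert j T))" for c
      show ?thesis
      proof (rule app[of g])
        fix c assume "c \<in> columns (Suc r)"
        show "In (g c)"
          using insert.IH[of T] insert.IH[of "insert j T"] insert.prems insert.hyps False
          by (auto simp: g_def)
      next
        fix p assume p: "p < n"
        show "M (insert j S) T p = eval (As ! p) (\<lambda>i. g (set_decode i) p) q"
        proof (cases "row p = j")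
          case True
          then have "e' p = eval (As ! p) (\<lambda>i. (\<lambda>c. if c \<in> U then b p else e p) (set_decode i)) q"
            using insert.prems by (simp add: e'_def)
          also have "\<dots> = eval (As ! p) (\<lambda>i. g (set_decode i) p) q"
            by (rule qcong[of _ "\<lambda>c. g c p"])
              (use True insert.prems insert.hyps in \<open>auto simp: g_def M_def\<close>)
          finally show ?thesis using True by (simp add: M_def)
        next
          case False
          have "eval (As ! p) (\<lambda>i. g (set_decode i) p) q = M S T p"
            by (rule qidem[OF p Mu[OF p], of "\<lambda>c. g c p"]) (use False in \<open>auto simp: g_def M_def\<close>)
          then show ?thesis using False by (simp add: M_def)
        qed
      qed
    qed
  qed
  have with_r: "In (M (insert r S) {})" if "S \<subseteq> {..<r}" for S
  proof -
    \<comment> \<open>Row \<open>r\<close> deviates at \<open>{r}\<close> only, the pattern defining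
      \<open>e'\<close> there. For \<open>S = {}\<close> the element \<open>E S\<close> would be
      \<open>b\<close> itself, which is still to be generated; \<open>E (c \<inter> {..<r})\<close>
      replaces it, and its deviation in each row below \<open>r\<close> occurs exactly at the
      columns containing that row.\<close>
    define g where "g c = (if c \<in> U then E c else if S = {} then E (c \<inter> {..<r}) else E S)" for c
    show ?thesis
    proof (rule app[of g])
      fix c assume c: "c \<in> columns (Suc r)"
      show "In (g c)" 
        using col[OF c] that by (cases "c \<in> U") (simp_all add: g_def InE_sub InE_U)
    next
      fix p assume p: "p < n"
      then have p': "p < length As" by (simp add: n_def)
      consider "row p \<in> S" | "row p < r" "row p \<notin> S" "S \<noteq> {}" | "row p < r" "S = {}"
        | "row p = r" | "row p > r"
        by linarith
      then show "M (insert r S) {} p = eval (As ! p) (\<lambda>i. g (set_decode i) p) q"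
      proof cases
        case 1
        then have "e' p = eval (As ! p) (\<lambda>i. (\<lambda>c. if c \<in> U then b p else e p) (set_decode i)) q"
          using that by (auto simp: e'_def)
        also have "\<dots> = eval (As ! p) (\<lambda>i. g (set_decode i) p) q"
          by (rule qcong[of _ "\<lambda>c. g c p"]) (use 1 that in \<open>auto simp: g_def E_def U_def\<close>)
        finally show ?thesis using 1 by (simp add: M_def)
      next
        case 2
        have "eval (As ! p) (\<lambda>i. g (set_decode i) p) q = b p"
          by (rule qidem[OF p b[of p], of "\<lambda>c. g c p"])
            (use p 2 in \<open>auto simp: g_def E_def n_def U_def\<close>)
        then show ?thesis using 2 by (simp add: M_def)
      next
        case 3
        have "eval (As ! p) (\<lambda>i. g (set_decode i) p) q = b p"
          by (rule qrow[OF p row[of p] e[of p], of "\<lambda>c. g c p"])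
            (use p 3 in \<open>auto simp: g_def E_def n_def U_def\<close>)
        then show ?thesis using 3 by (simp add: M_def)
      next
        case 4
        then have "e' p = eval (As ! p) (\<lambda>i. (\<lambda>c. if c = {r} then e p else b p) (set_decode i)) q"
          by (simp add: e'_def)
        also have "\<dots> = eval (As ! p) (\<lambda>i. g (set_decode i) p) q"
          by (rule qcong[of _ "\<lambda>c. g c p"], drule col)
            (use 4 that r in \<open>auto simp: g_def E_def U_def\<close>)
        finally show ?thesis using 4 by (simp add: M_def)
      next
        case 5
        have "eval (As ! p) (\<lambda>i. g (set_decode i) p) q = b p"
        proof (rule qrow[OF p row[OF p'] e[OF p'], of "\<lambda>c. g c p"])
          fix c assume c: "c \<in> columns (Suc r)"
          show "g c p = (if row p \<in> c then e p else b p)"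
            using col[OF c] 5 that by (auto simp: g_def E_def)
        qed
        then show ?thesis using 5 that by (auto simp: M_def)
      qed
    qed
  qed
  \<comment> \<open>A final application of \<open>q\<close>, now to the corners deviating by
    \<open>e'\<close>: these are available for all columns of \<open>q\<close>, so every row of its
    identities returns \<open>b\<close>.\<close>
  have "In b"
  proof (rule app[of "\<lambda>c. M c {}"])
    fix c assume c: "c \<in> columns (Suc r)"
    then consider j where "c = {j}" "r < j" "j < d" | "r \<in> c" "c \<subseteq> {..r}"
      | "r \<notin> c" "c \<noteq> {}" "c \<subseteq> {..<Suc r}"
      by (fastforce simp: columns_def)
    then show "In (M c {})"
    proof cases
      case 1
      then have "M c {} = E c" by (auto simp: M_def E_def e'_def)
      moreover have "c \<in> columns r" using 1 by (auto simp: columns_def)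
      ultimately show ?thesis using InE by simp
    next
      case 2
      then have "c = insert r (c \<inter> {..<r})" by (auto simp: subset_iff le_less)
      then show ?thesis using with_r[of "c \<inter> {..<r}"] by simp
    next
      case 3
      then have "c \<subseteq> {..<r}" by (auto simp: less_Suc_eq)
      then show ?thesis using 3 finite_subset[of c] by (intro mixed) auto
    qed
  next
    fix p assume p: "p < n"
    show "b p = eval (As ! p) (\<lambda>j. M (set_decode j) {} p) q"
      by (rule qrow[OF p row[of p] e'[OF p], of "\<lambda>c. M c {} p", symmetric])
        (use p in \<open>auto simp: M_def n_def\<close>)
  qed
  then show "map b [0..<length As] \<in> Sg F ar (prod_alg As)
      ((\<lambda>c. map (\<lambda>p. if row p \<in> c then e p else b p) [0..<length As]) ` columns r)"
    by (simp add: In_def B_def E_def n_def)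
qed (rule finite_columns)

lemma edge_term_exists:
  assumes "column_term (columns d) q"
  shows "\<exists>q. column_term (columns 2) q"
proof -
  have "\<exists>q. column_term (columns (d - m)) q" if "m \<le> d - 2" for m
    using that
  proof (induction m)
    case (Suc m)
    then have "Suc (d - Suc m) = d - m" by simp
    then show ?case using Suc column_term_reduce[of "d - Suc m"] d by force
  qed (use assms in auto)
  from this[of "d - 2"] show ?thesis using d by simp
qed

section \<open>Correcting one coordinate\<close>

lemma is_algebra_prod_K: "As \<in> lists K \<Longrightarrow> is_algebra F ar (prod_alg As)"
  using algebra by (intro is_algebra_prod) auto

lemma nth_in_K: "As \<in> lists K \<Longrightarrow> p < length As \<Longrightarrow> As ! p \<in> K"
  by auto

text \<open>Each round replaces \<open>\<gamma>, \<delta>\<close> by elements that agree with \<open>b\<close> wherever \<open>\<gamma>, \<delta>\<close> did so and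
  moreover at all places at which only \<open>v k\<close> deviates from \<open>b\<close>. The element \<open>u\<close> has to follow
  since the rounds change the entry of \<open>\<gamma>\<close> at \<open>i\<close>.\<close>

lemma reach_parallelogram:
  assumes q: "column_term (columns 2) q"
    and As: "As \<in> lists K" and i: "i < length As" and X: "X \<subseteq> {..<length As}"
    and U: "b \<in> univ (prod_alg As)" "u \<in> univ (prod_alg As)" "\<gamma> \<in> univ (prod_alg As)"
      "\<delta> \<in> univ (prod_alg As)" "\<And>m. m < d - 1 \<Longrightarrow> v m \<in> univ (prod_alg As)"
    and u: "\<And>p. p \<in> X \<Longrightarrow> u ! p = b ! p" and \<gamma>\<delta>: "\<And>p. p \<in> X \<Longrightarrow> \<gamma> ! p = \<delta> ! p"
    and fork: "u ! i = \<gamma> ! i" "\<delta> ! i = b ! i"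
    and vi: "\<And>m. m < d - 1 \<Longrightarrow> v m ! i = b ! i"
    and dev: "\<And>p m. p \<in> X \<Longrightarrow> m < d - 1 \<Longrightarrow> m \<noteq> dev p \<Longrightarrow> v m ! p = b ! p"
      "\<And>p. p \<in> X \<Longrightarrow> dev p < d - 1"
  obtains w where "w \<in> univ (prod_alg As)" "w ! i = b ! i" "\<And>p. p \<in> X \<Longrightarrow> w ! p = b ! p"
    "reach F ar (prod_alg As) (3 * (d - 1) * gate_count q) ({u, \<gamma>, \<delta>} \<union> v ` {..<d - 1}) {w}"
proof -
  let ?P = "prod_alg As" and ?G = "{u, \<gamma>, \<delta>} \<union> v ` {..<d - 1}"
  \<comment> \<open>\<open>slot k\<close> maps the indices \<open>2, ..., d - 1\<close> bijectively
    onto the \<open>m < d - 1\<close> other than \<open>k\<close>. In round \<open>k\<close> the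
    singleton columns thus carry all elements \<open>v m\<close> except \<open>v k\<close>.\<close>
  define slot where "slot k j = (if j - 2 < k then j - 2 else j - 1)" for k j :: nat
  define g where "g x y z k c = (if c = {0} then x else if c = {0, 1} then y
    else if c = {1} then z else v (slot k (the_elem c)))" for x y z k and c :: "nat set"
  define app where "app x y z k = eval ?P (\<lambda>j. g x y z k (set_decode j)) q" for x y z k
  have slot: "slot k j < d - 1" "slot k j \<noteq> k" if "2 \<le> j" "j < d" for k j
    using that by (auto simp: slot_def)
  have slot_inj: "slot k j = slot k j' \<Longrightarrow> j = j'" if "2 \<le> j" "2 \<le> j'" for k j j'
    using that by (auto simp: slot_def split: if_splits)
  have pU: "x ! p \<in> univ (As ! p)" if "x \<in> univ ?P" "p < length As" for x p
    using that by (simp add: univ_prod_alg)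
  have col: "c = {0} \<or> c = {1} \<or> c = {0, 1} \<or> (\<exists>j. c = {j} \<and> 2 \<le> j \<and> j < d)"
    if "c \<in> columns 2" for c
  proof -
    have "Pow {..<2} = {{}, {0}, {1}, {0, 1 :: nat}}"
      by (auto simp: numeral_2_eq_2 lessThan_Suc Pow_insert)
    then have "c \<subseteq> {..<2} \<Longrightarrow> c \<in> {{}, {0}, {1}, {0, 1}}" by blast
    then show ?thesis using that unfolding columns_def by auto
  qed
  have gs: "g x y z k {0} = x" "g x y z k {Suc 0} = z" "g x y z k {0, Suc 0} = y"
    "2 \<le> j \<Longrightarrow> g x y z k {j} = v (slot k j)" for x y z k j
    by (auto simp: g_def)
  have gU: "g x y z k c \<in> T"
    if "x \<in> T" "y \<in> T" "z \<in> T" "\<And>m. m < d - 1 \<Longrightarrow> v m \<in> T" "c \<in> columns 2" for x y z k c T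
    using col[OF that(5)] by (elim disjE exE conjE) (use that(1-4) slot in \<open>simp_all add: gs\<close>)
  have app_univ: "app x y z k \<in> univ ?P"
    if "x \<in> univ ?P" "y \<in> univ ?P" "z \<in> univ ?P" for x y z k
    unfolding app_def
    by (rule column_term_closed[OF q finite_columns subuniverse_univ[OF is_algebra_prod_K[OF As]]])
      (use that U gU[of x "univ ?P" y z] in auto)
  have app_nth: "app x y z k ! p = eval (As ! p) (\<lambda>j. g x y z k (set_decode j) ! p) q"
    if "p < length As" for x y z k p
    using that by (simp add: app_def eval_prod_nth)
  have app_reach: "reach F ar ?P (gate_count q) (?G \<union> {x, y, z}) {app x y z k}" for x y z k
    unfolding app_def
  proof (rule reach_eval[of _ _ _ "set_encode ` columns 2"])
    show "q \<in> terms F ar (set_encode ` columns 2)" using q by (simp add: column_term_def)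
    have "g x y z k c \<in> ?G \<union> {x, y, z}" if "c \<in> columns 2" for c
      using gU[of x "?G \<union> {x, y, z}" y z c k] that by simp
    then show "(\<lambda>j. g x y z k (set_decode j)) ` set_encode ` columns 2 \<subseteq> ?G \<union> {x, y, z}"
      by (force simp: finite_columns)
  qed
  \<comment> \<open>Where only the omitted \<open>v k\<close> deviates, all arguments have the entry
    of \<open>b\<close> except those at \<open>{0, 1}\<close> and \<open>{1}\<close>, and these two
    agree. This is the pattern of row \<open>1\<close>.\<close>
  have one: "app x y z k ! p = b ! p"
    if p: "p \<in> X" and xyz: "x ! p = b ! p" "y ! p = z ! p" "y \<in> univ ?P"
      and k: "dev p = k" for x y z k p
  proof -
    have p': "p < length As" using p X by auto
    have "eval (As ! p) (\<lambda>j. (\<lambda>c. g x y z k c ! p) (set_decode j)) q = b ! p"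
    proof (rule column_term_row[OF q finite_columns nth_in_K[OF As p'] d pU[OF xyz(3) p'] pU[OF U(1) p']])
      fix c assume c: "c \<in> columns 2"
      show "g x y z k c ! p = (if 1 \<in> c then y ! p else b ! p)"
        using col[OF c]
        by (elim disjE exE conjE) (use xyz slot k dev(1)[OF p] in \<open>simp_all add: gs\<close>)
    qed
    then show ?thesis using app_nth[OF p'] by simp
  qed
  \<comment> \<open>By injectivity of \<open>slot k\<close> at most one argument deviates at such a
    place. It stands at a singleton column, whose own row restores \<open>b\<close>.\<close>
  have keep: "app x y z k ! p = b ! p"
    if p: "p \<in> X" and xyz: "x ! p = b ! p" "y ! p = b ! p" "z ! p = b ! p" for x y z k p
  proof -
    have p': "p < length As" using p X by auto
    have "eval (As ! p) (\<lambda>j. (\<lambda>c. g x y z k c ! p) (set_decode j)) q = b ! p"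
    proof (cases "\<exists>j. 2 \<le> j \<and> j < d \<and> slot k j = dev p")
      case True
      then obtain j where j: "2 \<le> j" "j < d" "slot k j = dev p" by blast
      show ?thesis
      proof (rule column_term_row[OF q finite_columns nth_in_K[OF As p'] j(2)
            pU[OF U(5)[OF dev(2)[OF p]] p'] pU[OF U(1) p']])
        fix c assume c: "c \<in> columns 2"
        show "g x y z k c ! p = (if j \<in> c then v (dev p) ! p else b ! p)"
          using col[OF c]
        proof (elim disjE exE conjE)
          fix j' assume j': "c = {j'}" "2 \<le> j'" "j' < d"
          show ?thesis
          proof (cases "j = j'")
            case False
            then have "slot k j' \<noteq> dev p" using slot_inj[of j j' k] j j' by auto
            then show ?thesis using dev(1)[OF p slot(1)[OF j'(2,3)]] False j' by (simp add: gs)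
          qed (use j j' in \<open>simp add: gs\<close>)
        qed (use xyz j in \<open>simp_all add: gs\<close>)
      qed
    next
      case False
      show ?thesis
      proof (rule column_term_idem[OF q finite_columns nth_in_K[OF As p'] pU[OF U(1) p']])
        fix c assume c: "c \<in> columns 2"
        show "g x y z k c ! p = b ! p"
          using col[OF c]
          by (elim disjE exE conjE) (use xyz slot(1) False dev(1)[OF p] in \<open>auto simp: gs\<close>)
      qed
    qed
    then show ?thesis using app_nth[OF p'] by simp
  qed
  \<comment> \<open>After \<open>k\<close> rounds \<open>z\<close> is correct at the places with
    \<open>dev p < k\<close>. The new triple applies \<open>q\<close> to \<open>x x x\<close>,
    \<open>x y y\<close> and \<open>x y z\<close> in the columns \<open>{0}\<close>,
    \<open>{0, 1}\<close>, \<open>{1}\<close>: the last two results agree where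
    \<open>y = z\<close>, the first two where \<open>x = y\<close>, so both agreements survive. At
    \<open>i\<close> the third result is \<open>b ! i\<close> by row \<open>0\<close>.\<close>
  have "\<exists>x y z. x \<in> univ ?P \<and> y \<in> univ ?P \<and> z \<in> univ ?P \<and>
      reach F ar ?P (3 * k * gate_count q) ?G {x, y, z} \<and>
      (\<forall>p\<in>X. x ! p = b ! p \<and> y ! p = z ! p \<and> (dev p < k \<longrightarrow> z ! p = b ! p)) \<and>
      x ! i = y ! i \<and> z ! i = b ! i" for k
  proof (induction k)
    case 0
    show ?case
      by (intro exI[of _ u] exI[of _ \<gamma>] exI[of _ \<delta>]) (auto simp: U u \<gamma>\<delta> fork intro: reach_refl)
  next
    case (Suc k)
    then obtain x y z where xyz: "x \<in> univ ?P" "y \<in> univ ?P" "z \<in> univ ?P"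
      and re: "reach F ar ?P (3 * k * gate_count q) ?G {x, y, z}"
      and X': "\<And>p. p \<in> X \<Longrightarrow> x ! p = b ! p \<and> y ! p = z ! p \<and> (dev p < k \<longrightarrow> z ! p = b ! p)"
      and i': "x ! i = y ! i" "z ! i = b ! i" by auto
    let ?x = "app x x x k" and ?y = "app x y y k" and ?z = "app x y z k"
    have r1: "reach F ar ?P (gate_count q) (?G \<union> {x, y, z}) {app a b c k}"
      if "{a, b, c} \<subseteq> {x, y, z}" for a b c
      by (rule reach_mono[OF app_reach[of a b c k]]) (use that in auto)
    have "reach F ar ?P (gate_count q + (gate_count q + gate_count q)) (?G \<union> {x, y, z})
       ({?x} \<union> ({?y} \<union> {?z}))"
      by (intro reach_Un r1) auto
    then have re': "reach F ar ?P (3 * Suc k * gate_count q) ?G {?x, ?y, ?z}"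
      by (rule reach_trans[OF re]) (auto simp: algebra_simps)
    have X'': "?x ! p = b ! p \<and> ?y ! p = ?z ! p \<and> (dev p < Suc k \<longrightarrow> ?z ! p = b ! p)"
      if p: "p \<in> X" for p
    proof -
      have p': "p < length As" using p X by auto
      have "(\<lambda>j. g x y y k (set_decode j) ! p) = (\<lambda>j. g x y z k (set_decode j) ! p)"
        using X'[OF p] by (auto simp: g_def)
      then have "?y ! p = ?z ! p" by (simp only: app_nth[OF p'])
      then show ?thesis using keep[OF p] one[OF p] X'[OF p] xyz by (auto simp: less_Suc_eq)
    qed
    have xy: "?x ! i = ?y ! i"
    proof -
      have "(\<lambda>j. g x x x k (set_decode j) ! i) = (\<lambda>j. g x y y k (set_decode j) ! i)"
        using i'(1) by (auto simp: g_def)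
      then show ?thesis by (simp only: app_nth[OF i])
    qed
    have zb: "?z ! i = b ! i"
    proof -
      have "eval (As ! i) (\<lambda>j. (\<lambda>c. g x y z k c ! i) (set_decode j)) q = b ! i"
      proof (rule column_term_row[OF q finite_columns nth_in_K[OF As i] _ pU[OF xyz(1) i] pU[OF U(1) i]])
        show "0 < d" using d by simp
        fix c assume c: "c \<in> columns 2"
        show "g x y z k c ! i = (if 0 \<in> c then x ! i else b ! i)"
          using col[OF c]
          by (elim disjE exE conjE) (use i' vi slot(1) in \<open>simp_all add: gs\<close>)
      qed
      then show ?thesis using app_nth[OF i] by simp
    qed
    show ?case
      by (intro exI[of _ ?x] exI[of _ ?y] exI[of _ ?z] conjI ballI app_univ re' xy zb)
        (use xyz X'' in auto)
  qed
  from this[of "d - 1"] obtain x y z where *: "z \<in> univ ?P" "z ! i = b ! i"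
    "reach F ar ?P (3 * (d - 1) * gate_count q) ?G {x, y, z}"
    "\<And>p. p \<in> X \<Longrightarrow> z ! p = b ! p"
    using dev(2) by blast
  then show ?thesis using that[of z] reach_mono[OF *(3), of ?G "{z}"] by auto
qed

definition elements :: "'a set" where
  "elements = (\<Union>A\<in>K. univ A)"

lemma finite_elements: "finite elements"
  using finite_K finite_univ by (simp add: elements_def)

text \<open>The first summand pays for an element with \<open>d - 1\<close> prescribed entries, the
  second for one use of \<open>reach_parallelogram\<close>: \<open>d - 1\<close> rounds with three
  applications of the edge term.\<close>

definition correction_cost :: "'f trm \<Rightarrow> nat" where
  "correction_cost q = card elements ^ (d - 1) + 3 * (d - 1) * gate_count q"

text \<open>An approximation is kept for every list of \<open>d - 2\<close> places up to
  \<open>i\<close>, each of them also correct at \<open>i\<close>. All lists have to advance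
  together, because enlarging the correct part for one list needs the approximations for
  \<open>d - 1\<close> lists.\<close>

lemma reach_correction:
  assumes q: "column_term (columns 2) q"
    and As: "As \<in> lists K" and i: "i < length As" and G: "G \<subseteq> univ (prod_alg As)"
    and b: "b \<in> Sg F ar (prod_alg As) G"
    and U: "u \<in> univ (prod_alg As)" "\<gamma> \<in> univ (prod_alg As)" "\<delta> \<in> univ (prod_alg As)"
    and u: "\<And>p. p < i \<Longrightarrow> u ! p = b ! p" and \<gamma>\<delta>: "\<And>p. p < i \<Longrightarrow> \<gamma> ! p = \<delta> ! p"
    and fork: "u ! i = \<gamma> ! i" "\<delta> ! i = b ! i"
  obtains w where "w \<in> univ (prod_alg As)" "\<And>p. p \<le> i \<Longrightarrow> w ! p = b ! p"
    "reach F ar (prod_alg As) (length As ^ (d - 1) * correction_cost q) (G \<union> {u, \<gamma>, \<delta>}) {w}"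
proof -
  let ?P = "prod_alg As" and ?S = "G \<union> {u, \<gamma>, \<delta>}"
  define n where "n = length As"
  define cp where "cp = 3 * (d - 1) * gate_count q"
  define N where "N = card elements ^ (d - 1)"
  define LL where "LL = {I. set I \<subseteq> {..i} \<and> length I = d - 2}"
  note alg = is_algebra_prod_K[OF As]
  have bU: "b \<in> univ ?P" using b Sg_subset_univ[OF alg G] by blast
  have finLL: "finite LL" unfolding LL_def by (rule finite_lists_length_eq) simp
  have cardLL: "card LL \<le> n ^ (d - 2)"
    using i card_lists_length_eq[of "{..i}" "d - 2"] by (simp add: LL_def n_def power_mono)
  \<comment> \<open>The projection to the \<open>d - 1\<close> places in \<open>i # I\<close> takes
    at most \<open>N\<close> values, so an element with the right values is derived in
    \<open>N\<close> operations.\<close>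
  have base: "\<exists>w. w \<in> univ ?P \<and> (\<forall>p\<in>set (i # I). w ! p = b ! p) \<and> reach F ar ?P N G {w}"
    if I: "I \<in> LL" for I
  proof -
    let ?J = "i # I" and ?\<Phi> = "{xs. set xs \<subseteq> elements \<and> length xs = d - 1}"
    let ?\<phi> = "\<lambda>x. map (\<lambda>p. x ! p) (i # I)"
    have J: "p < n" if "p \<in> set ?J" for p using that I i by (auto simp: LL_def n_def)
    have lenJ: "length ?J = d - 1" using I d by (simp add: LL_def)
    have xe: "x ! p \<in> elements" if "x \<in> univ ?P" "p < n" for x p
      using that nth_in_K[OF As, of p] by (auto simp: univ_prod_alg elements_def n_def)
    have im: "?\<phi> ` univ ?P \<subseteq> ?\<Phi>" using J xe lenJ by auto
    have compat: "?\<phi> (oper ?P f xs) = ?\<phi> (oper ?P f ys)" if "map ?\<phi> xs = map ?\<phi> ys" for f xs ys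
    proof (rule map_cong[OF refl])
      fix p assume p: "p \<in> set ?J"
      then obtain m where m: "m < length ?J" "?J ! m = p"
        unfolding in_set_conv_nth by blast
      have "map (\<lambda>x. x ! p) zs = map (\<lambda>s. s ! m) (map ?\<phi> zs)" for zs :: "'a list list"
        using m nth_map[of m ?J] by (simp del: list.map)
      then have "map (\<lambda>x. x ! p) xs = map (\<lambda>x. x ! p) ys" using that by metis
      then show "oper ?P f xs ! p = oper ?P f ys ! p"
        using J[OF p] by (simp add: oper_prod_nth n_def)
    qed
    have fin: "finite ?\<Phi>" and card: "card ?\<Phi> = N"
      using finite_lists_length_eq[OF finite_elements] card_lists_length_eq[OF finite_elements]
      by (auto simp: N_def)
    obtain w where w: "?\<phi> w = ?\<phi> b" "reach F ar ?P (card ?\<Phi>) G {w}"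
      by (rule reach_up_to_kernel[OF alg G fin im compat b])
    note w = w[unfolded card]
    then have "w \<in> univ ?P" using reach_in_Sg[OF alg G w(2)] Sg_subset_univ[OF alg G] by auto
    then show ?thesis using w by (intro exI[of _ w]) auto
  qed
  \<comment> \<open>An element that is correct on \<open>{..<Suc l}\<close> and \<open>I\<close> comes from the \<open>d - 1\<close> elements that are
    correct on \<open>{..<l}\<close> and on all but one of the places in \<open>l # I\<close>.\<close>
  have "\<exists>v. (\<forall>I\<in>LL. v I \<in> univ ?P \<and> (\<forall>p\<in>{..<l} \<union> set I \<union> {i}. v I ! p = b ! p)) \<and>
      reach F ar ?P (card LL * N + l * (card LL * cp)) ?S (v ` LL)" if "l \<le> i" for l
    using that
  proof (induction l)
    case 0
    have "\<forall>I\<in>LL. \<exists>w. w \<in> univ ?P \<and> (\<forall>p\<in>set (i # I). w ! p = b ! p) \<and> reach F ar ?P N G {w}"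
      using base by blast
    from bchoice[OF this] obtain v where v: "\<And>I. I \<in> LL \<Longrightarrow> v I \<in> univ ?P \<and> (\<forall>p\<in>set (i # I). v I ! p = b ! p)
        \<and> reach F ar ?P N G {v I}"
      by blast
    have "reach F ar ?P (card LL * N) G (\<Union>I\<in>LL. {v I})"
      using finLL v by (intro reach_UN) auto
    then have "reach F ar ?P (card LL * N) ?S (v ` LL)"
      by (rule reach_mono) auto
    then show ?case using v by (intro exI[of _ v]) auto
  next
    case (Suc l)
    from Suc.IH[OF Suc_leD[OF Suc.prems]]
    obtain v where v: "\<And>I. I \<in> LL \<Longrightarrow> v I \<in> univ ?P"
      "\<And>I p. I \<in> LL \<Longrightarrow> p \<in> {..<l} \<union> set I \<union> {i} \<Longrightarrow> v I ! p = b ! p"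
      and re: "reach F ar ?P (card LL * N + l * (card LL * cp)) ?S (v ` LL)"
      by blast
    have "\<exists>w. (w \<in> univ ?P \<and> (\<forall>p\<in>{..<Suc l} \<union> set I \<union> {i}. w ! p = b ! p)) \<and>
        reach F ar ?P cp (?S \<union> v ` LL) {w}" if I: "I \<in> LL" for I
    proof -
      define J where "J = l # I"
      define J' where "J' m = take m J @ drop (Suc m) J" for m
      have lenJ: "length J = d - 1" using I d by (simp add: J_def LL_def)
      have setJ: "set J \<subseteq> {..i}" using I Suc.prems by (auto simp: J_def LL_def)
      have J': "J' m \<in> LL" if "m < d - 1" for m
        using that lenJ setJ set_take_subset[of m J] set_drop_subset[of "Suc m" J]
        by (auto simp: J'_def LL_def)
      have J'_nth: "J ! k \<in> set (J' m)" if "k < d - 1" "m < d - 1" "k \<noteq> m" for k m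
      proof (cases "k < m")
        case True
        then show ?thesis using that lenJ by (auto simp: J'_def in_set_conv_nth intro!: disjI1 exI[of _ k])
      next
        case False
        then have "J ! k = drop (Suc m) J ! (k - Suc m)" "k - Suc m < length (drop (Suc m) J)"
          using that lenJ by auto
        then have "J ! k \<in> set (drop (Suc m) J)" by (metis nth_mem)
        then show ?thesis by (simp add: J'_def)
      qed
      \<comment> \<open>The place \<open>i\<close> is left out, as \<open>u\<close> may differ from
        \<open>b\<close> and \<open>\<gamma>\<close> from \<open>\<delta>\<close> there. Correctness
        at \<open>i\<close> is supplied by the fork.\<close>
      define X where "X = ({..<l} \<union> set J) - {i}"
      have Xi: "p < i" if "p \<in> X" for p using that setJ Suc.prems by (auto simp: X_def le_less)
      \<comment> \<open>A place may occur repeatedly in \<open>J\<close>; any of its positions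
        serves, since deleting another position keeps the place in the list. Places of
        \<open>X\<close> outside \<open>J\<close> lie below \<open>l\<close>, where every
        approximation is correct, and the value 0 is a dummy.\<close>
      define dev where "dev p = (if p \<in> set J then SOME k. k < d - 1 \<and> J ! k = p else 0)" for p
      have dev: "dev p < d - 1 \<and> J ! dev p = p" if "p \<in> set J" for p
      proof -
        have "\<exists>k. k < d - 1 \<and> J ! k = p" using that lenJ by (auto simp: in_set_conv_nth)
        from someI_ex[OF this] show ?thesis using that by (simp add: dev_def)
      qed
      obtain w where w: "w \<in> univ ?P" "w ! i = b ! i" "\<And>p. p \<in> X \<Longrightarrow> w ! p = b ! p"
        "reach F ar ?P (3 * (d - 1) * gate_count q)
           ({u, \<gamma>, \<delta>} \<union> (\<lambda>m. v (J' m)) ` {..<d - 1}) {w}"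
      proof (rule reach_parallelogram[OF q As i _ bU U, of X "\<lambda>m. v (J' m)" dev])
        show "X \<subseteq> {..<length As}" using Xi i by force
        show "v (J' m) ! p = b ! p" if "p \<in> X" "m < d - 1" "m \<noteq> dev p" for p m
        proof (rule v(2)[OF J'[OF that(2)]])
          show "p \<in> {..<l} \<union> set (J' m) \<union> {i}"
          proof (cases "p \<in> set J")
            case True
            then show ?thesis using dev[of p] J'_nth[of "dev p" m] that by auto
          qed (use that X_def in auto)
        qed
        show "dev p < d - 1" for p using dev[of p] d by (cases "p \<in> set J") (auto simp: dev_def)
      qed (use u \<gamma>\<delta> fork Xi v J' in auto)
      have "reach F ar ?P cp (?S \<union> v ` LL) {w}"
        unfolding cp_def by (rule reach_mono[OF w(4)]) (use J' in auto)
      moreover have "w ! p = b ! p" if "p \<in> {..<Suc l} \<union> set I \<union> {i}" for p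
        using that w(2,3) by (cases "p = i") (auto simp: X_def J_def less_Suc_eq)
      ultimately show ?thesis using w(1) by blast
    qed
    then have "\<forall>I\<in>LL. \<exists>w. (w \<in> univ ?P \<and> (\<forall>p\<in>{..<Suc l} \<union> set I \<union> {i}. w ! p = b ! p)) \<and>
        reach F ar ?P cp (?S \<union> v ` LL) {w}" by blast
    from bchoice[OF this] obtain v' where v': "\<And>I. I \<in> LL \<Longrightarrow> (v' I \<in> univ ?P \<and>
        (\<forall>p\<in>{..<Suc l} \<union> set I \<union> {i}. v' I ! p = b ! p)) \<and> reach F ar ?P cp (?S \<union> v ` LL) {v' I}"
      by blast
    have "reach F ar ?P (card LL * cp) (?S \<union> v ` LL) (\<Union>I\<in>LL. {v' I})"
      using finLL v' by (intro reach_UN) auto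
    then have "reach F ar ?P (card LL * N + Suc l * (card LL * cp)) ?S (v' ` LL)"
      by (rule reach_trans[OF re]) auto
    then show ?case using v' by blast
  qed
  from this[OF order_refl] obtain v where v: "\<And>I. I \<in> LL \<Longrightarrow> v I \<in> univ ?P"
      "\<And>I p. I \<in> LL \<Longrightarrow> p \<in> {..<i} \<union> set I \<union> {i} \<Longrightarrow> v I ! p = b ! p"
    and re: "reach F ar ?P (card LL * N + i * (card LL * cp)) ?S (v ` LL)"
    by blast
  \<comment> \<open>The choice of the list is immaterial: at this stage every approximation is
    correct on all of \<open>{..i}\<close>.\<close>
  have I: "replicate (d - 2) i \<in> LL" by (auto simp: LL_def)
  have nd: "n ^ (d - 1) = n * n ^ (d - 2)" using d
    by (metis Suc_diff_Suc Suc_1 diff_Suc_1' power_Suc)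
  have "card LL * N + i * (card LL * cp) \<le> n * n ^ (d - 2) * N + n * (n ^ (d - 2) * cp)"
    using cardLL i by (intro add_mono mult_mono) (auto simp: n_def intro: order_trans[OF cardLL[unfolded n_def]])
  also have "\<dots> = n ^ (d - 1) * (N + cp)" unfolding nd by (simp add: algebra_simps)
  finally have cost: "card LL * N + i * (card LL * cp) \<le> n ^ (d - 1) * (N + cp)" .
  have "reach F ar ?P (n ^ (d - 1) * (N + cp)) ?S {v (replicate (d - 2) i)}"
    by (rule reach_mono[OF re _ _ cost]) (use I in auto)
  moreover have "v (replicate (d - 2) i) ! p = b ! p" if "p \<le> i" for p
    using v(2)[OF I, of p] that by (cases "p = i") auto
  ultimately show ?thesis
    using that v(1)[OF I] unfolding n_def N_def cp_def correction_cost_def by blast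
qed

section \<open>Collecting forks\<close>

text \<open>This is the signature used in compact representations of subpowers. Triples with
  \<open>x = y\<close> are included, which avoids a case distinction at coordinates that are already
  correct.\<close>

definition forks :: "nat \<Rightarrow> 'a list set \<Rightarrow> (nat \<times> 'a \<times> 'a) set" where
  "forks n S = {(i, x, y). i < n \<and>
     (\<exists>\<gamma>\<in>S. \<exists>\<delta>\<in>S. (\<forall>p<i. \<gamma> ! p = \<delta> ! p) \<and> \<gamma> ! i = x \<and> \<delta> ! i = y)}"

lemma forks_mono: "S \<subseteq> T \<Longrightarrow> forks n S \<subseteq> forks n T"
  unfolding forks_def by blast

lemma forks_subset:
  assumes "As \<in> lists K" "S \<subseteq> univ (prod_alg As)"
  shows "forks (length As) S \<subseteq> {..<length As} \<times> elements \<times> elements"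
proof -
  have "x ! p \<in> elements" if "x \<in> S" "p < length As" for x p
  proof -
    have "x \<in> univ (prod_alg As)" using that assms by auto
    then have "x ! p \<in> univ (As ! p)" using that by (simp add: univ_prod_alg)
    then show ?thesis using nth_in_K[OF assms(1) that(2)] by (auto simp: elements_def)
  qed
  then show ?thesis by (auto simp: forks_def)
qed

text \<open>Starting from an arbitrary element of \<open>S\<close>, the coordinates are corrected in
  order, each at cost \<open>s\<close>. A correction is impossible only if the fork formed by the
  current \<open>u\<close> and \<open>e\<close> has no witness in \<open>S\<close>, and then this
  \<open>u\<close> establishes the second alternative.\<close>

lemma reach_or_new_fork:
  assumes q: "column_term (columns 2) q" and As: "As \<in> lists K"
    and S: "G \<subseteq> S" "S \<subseteq> univ (prod_alg As)" "S \<noteq> {}" and e: "e \<in> Sg F ar (prod_alg As) G"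
  defines "Q \<equiv> length As ^ d * correction_cost q"
  shows "reach F ar (prod_alg As) Q S {e} \<or> (\<exists>i u. i < length As \<and> u \<in> univ (prod_alg As) \<and>
      (\<forall>p<i. u ! p = e ! p) \<and> (i, u ! i, e ! i) \<notin> forks (length As) S \<and>
      reach F ar (prod_alg As) Q S {u})" (is "_ \<or> ?new")
proof (cases ?new)
  case False
  let ?P = "prod_alg As" and ?n = "length As"
  define s where "s = ?n ^ (d - 1) * correction_cost q"
  have Qs: "Q = ?n * s"
    using d power_Suc[of ?n "d - 1"] by (simp add: Q_def s_def)
  have G: "G \<subseteq> univ ?P" using S by auto
  have eU: "e \<in> univ ?P" using e Sg_subset_univ[OF is_algebra_prod_K[OF As] G] by auto
  have "\<exists>w. w \<in> univ ?P \<and> (\<forall>p<j. w ! p = e ! p) \<and> reach F ar ?P (j * s) S {w}" if "j \<le> ?n" for j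
    using that
  proof (induction j)
    case 0
    then show ?case using S by (auto intro: reach_refl)
  next
    case (Suc j)
    then obtain u where u: "u \<in> univ ?P" "\<And>p. p < j \<Longrightarrow> u ! p = e ! p" "reach F ar ?P (j * s) S {u}"
      by auto
    have j: "j < ?n" using Suc.prems by simp
    have "reach F ar ?P Q S {u}"
      by (rule reach_mono[OF u(3)]) (use j in \<open>auto simp: Qs\<close>)
    then have "(j, u ! j, e ! j) \<in> forks ?n S" using False j u(1,2) by blast
    then obtain \<gamma> \<delta> where \<gamma>\<delta>: "\<gamma> \<in> S" "\<delta> \<in> S" "\<And>p. p < j \<Longrightarrow> \<gamma> ! p = \<delta> ! p" "\<gamma> ! j = u ! j" "\<delta> ! j = e ! j"
      by (auto simp: forks_def)
    obtain w where w: "w \<in> univ ?P" "\<And>p. p \<le> j \<Longrightarrow> w ! p = e ! p"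
      "reach F ar ?P s (G \<union> {u, \<gamma>, \<delta>}) {w}"
      unfolding s_def
      by (rule reach_correction[OF q As j G e u(1), of \<gamma> \<delta>]) (use \<gamma>\<delta> S u(2) in auto)
    have "reach F ar ?P (Suc j * s) S {w}"
      by (rule reach_trans[OF u(3) w(3)]) (use S \<gamma>\<delta> in auto)
    then show ?case using w by (auto simp: less_Suc_eq_le)
  qed
  from this[OF order_refl] obtain w where w: "w \<in> univ ?P" "\<forall>p<?n. w ! p = e ! p"
    "reach F ar ?P (?n * s) S {w}" by blast
  then have "w = e" using eU by (auto simp: univ_prod_alg intro: nth_equalityI)
  then show ?thesis using w Qs by simp
qed simp

text \<open>Among the sets derivable at cost \<open>D\<close> per fork, take one with the largest number of forks.\<close>

theorem reach_polynomial:
  assumes q: "column_term (columns 2) q"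
  obtains c where "\<And>As G b. \<lbrakk>As \<in> lists K; G \<subseteq> univ (prod_alg As); G \<noteq> {};
      b \<in> Sg F ar (prod_alg As) G\<rbrakk> \<Longrightarrow> reach F ar (prod_alg As) (c * length As ^ (d + 1)) G {b}"
proof -
  define R where "R = Max (insert 0 (ar ` F))"
  have R: "ar f \<le> R" if "f \<in> F" for f using that finite_F by (simp add: R_def)
  define c1 where "c1 = correction_cost q"
  define E where "E = card elements"
  \<comment> \<open>There are at most \<open>n * (E * E)\<close> forks for \<open>n\<close> factors.
    A new fork costs up to \<open>R\<close> arguments, one operation and the element
    \<open>u\<close>, that is \<open>Suc R * Q + 1\<close> with \<open>Q = n ^ d * c1\<close>. The
    last summand pays for the derivation of \<open>b\<close> once \<open>S\<close> is
    complete.\<close>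
  define c where "c = E * E * (Suc R * c1 + 1) + c1"
  have main: "reach F ar (prod_alg As) (c * length As ^ (d + 1)) G {b}"
    if As: "As \<in> lists K" and G: "G \<subseteq> univ (prod_alg As)" "G \<noteq> {}"
      and b: "b \<in> Sg F ar (prod_alg As) G" for As G b
  proof (cases "As = []")
    case True
    \<comment> \<open>The empty product has only one element, so the nonempty set \<open>G\<close>
      contains \<open>b\<close>; the bound is 0 in this case.\<close>
    have "b \<in> univ (prod_alg As)" using b Sg_subset_univ[OF is_algebra_prod_K[OF As] G(1)] by auto
    then have "b \<in> G" using True G by (auto simp: univ_prod_alg)
    then show ?thesis by (auto intro: reach_refl)
  next
    case False
    let ?P = "prod_alg As" and ?n = "length As"
    note alg = is_algebra_prod_K[OF As]
    define Q where "Q = ?n ^ d * c1"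
    define D where "D = Suc R * Q + 1"
    let ?pr = "\<lambda>m. \<exists>S N. derives F ar ?P G N S \<and> N \<le> m * D \<and> m \<le> card (forks ?n S)"
    have SU: "S \<subseteq> univ ?P" if "derives F ar ?P G N S" for N S
      using derives_in_Sg[OF alg G(1) that] Sg_subset_univ[OF alg G(1)] by auto
    have finB: "finite ({..<?n} \<times> elements \<times> elements)" using finite_elements by simp
    have cardS: "card (forks ?n S) \<le> ?n * (E * E)" if "derives F ar ?P G N S" for N S
      using card_mono[OF finB forks_subset[OF As SU[OF that]]] by (simp add: E_def card_cartesian_product)
    have "?pr 0" using derives_0[of F ar ?P G] by auto
    moreover have "\<forall>m. ?pr m \<longrightarrow> m < Suc (?n * (E * E))"
    proof (intro allI impI)
      fix m assume "?pr m"
      then obtain S N where "derives F ar ?P G N S" "m \<le> card (forks ?n S)" by blast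
      then show "m < Suc (?n * (E * E))" using cardS[of N S] by simp
    qed
    ultimately have "\<exists>m. ?pr m \<and> (\<forall>m'. ?pr m' \<longrightarrow> m' \<le> m)"
      by (rule ex_has_greatest_nat[where f = "\<lambda>x. x"])
    then obtain m S N where m: "derives F ar ?P G N S" "N \<le> m * D" "m \<le> card (forks ?n S)"
      and max: "\<And>m'. ?pr m' \<Longrightarrow> m' \<le> m" by blast
    note S = SU[OF m(1)] and GS = derives_superset[OF m(1)]
    let ?T = "{e \<in> Sg F ar ?P G. reach F ar ?P Q S {e}}"
    have "subuniverse F ar ?P ?T"
      unfolding subuniverse_def
    proof (intro conjI ballI impI)
      show "?T \<subseteq> univ ?P" using Sg_subset_univ[OF alg G(1)] by auto
    next
      fix f xs assume f: "f \<in> F" and xs: "xs \<in> lists ?T" "length xs = ar f"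
      let ?e = "oper ?P f xs"
      have eSg: "?e \<in> Sg F ar ?P G" using Sg_oper[OF alg G(1) f _ xs(2)] xs(1) by auto
      have "reach F ar ?P (card (set xs) * Q) S (\<Union>x\<in>set xs. {x})"
        using xs by (intro reach_UN) auto
      then have "reach F ar ?P (R * Q) S (set xs)"
        by (rule reach_mono) (use card_length[of xs] R[OF f] xs(2) in auto)
      then have re: "reach F ar ?P (Suc (R * Q)) S {?e}" by (rule reach_oper) (fact f xs(2))+
      show "?e \<in> ?T"
      proof (rule ccontr)
        assume "?e \<notin> ?T"
        then have "\<not> reach F ar ?P Q S {?e}" using eSg by simp
        then obtain i u where u: "i < ?n" "\<forall>p<i. u ! p = ?e ! p"
          "(i, u ! i, ?e ! i) \<notin> forks ?n S" "reach F ar ?P Q S {u}"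
          using reach_or_new_fork[OF q As GS S _ eSg] G(2) GS unfolding Q_def c1_def by blast
        have "reach F ar ?P D S {?e, u}"
          by (rule reach_trans[OF re u(4)]) (auto simp: D_def)
        then obtain N' S' where S': "N' \<le> D" "derives F ar ?P S N' S'" "?e \<in> S'" "u \<in> S'"
          by (auto simp: reach_def)
        have dS': "derives F ar ?P G (N + N') S'" using derives_trans[OF S'(2) m(1)] .
        have "(i, u ! i, ?e ! i) \<in> forks ?n S'"
          using u(1,2) S'(3,4) unfolding forks_def by blast
        then have "forks ?n S \<subset> forks ?n S'"
          using forks_mono[OF derives_superset[OF S'(2)], of ?n] u(3) by blast
        then have "Suc m \<le> card (forks ?n S')"
          using psubset_card_mono[of "forks ?n S'" "forks ?n S"] m(3)
            finite_subset[OF forks_subset[OF As SU[OF dS']] finB] by auto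
        moreover have "N + N' \<le> Suc m * D" using m(2) S'(1) by simp
        ultimately have "Suc m \<le> m" using dS' by (intro max) blast
        then show False by simp
      qed
    qed
    moreover have "G \<subseteq> ?T" using GS subset_Sg[of G F ar ?P] by (auto intro: reach_refl)
    ultimately have "b \<in> ?T" using Sg_minimal[of F ar ?P ?T G] b by auto
    then have rS: "reach F ar ?P Q S {b}" by simp
    have rG: "reach F ar ?P (m * D) G S" using m unfolding reach_def by blast
    have re: "reach F ar ?P (m * D + Q) G {b}"
      by (rule reach_trans[OF rG rS]) auto
    have n1: "1 \<le> ?n" using False by (simp add: Suc_le_eq)
    \<comment> \<open>As \<open>n\<close> is positive, the 1 in \<open>D\<close> is absorbed by
      \<open>n ^ d\<close>, and \<open>Q\<close> by \<open>n * Q\<close>.\<close>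
    have "m * D + Q \<le> (?n * (E * E)) * (Suc R * Q + ?n ^ d) + ?n * Q"
      unfolding D_def using cardS[OF m(1)] m(3) n1
      by (intro add_mono mult_mono) (auto simp: mult_le_mono)
    also have "\<dots> = c * ?n ^ (d + 1)"
      by (simp add: c_def Q_def algebra_simps)
    finally show ?thesis by (intro reach_mono[OF re]) auto
  qed
  then show ?thesis using that by blast
qed

end

section \<open>Terms and circuits from derivations\<close>

text \<open>Sharing keeps the count linear: the term chosen for a new element applies a symbol to
  terms chosen before, so a step adds at most one nonvariable subterm to the union. Counting the
  terms separately would lose this.\<close>

lemma terms_of_derives:
  assumes "derives F ar A (set as) N S"
  shows "\<exists>\<tau>. (\<forall>s\<in>S. \<tau> s \<in> terms F ar {..<length as} \<and> eval A (\<lambda>i. as ! i) (\<tau> s) = s) \<and>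
     finite ((\<Union>s\<in>S. subterms (\<tau> s)) - range Var) \<and>
     card ((\<Union>s\<in>S. subterms (\<tau> s)) - range Var) \<le> N"
  using assms
proof (induction rule: derives.induct)
  case derives_0
  have "\<forall>s\<in>set as. \<exists>i<length as. as ! i = s" by (auto simp: in_set_conv_nth)
  then obtain h where h: "\<forall>s\<in>set as. h s < length as \<and> as ! h s = s" by metis
  have "(\<Union>s\<in>set as. subterms (Var (h s))) - range Var = {}" by auto
  then show ?case using h by (intro exI[of _ "\<lambda>s. Var (h s)"]) (auto intro: terms.intros)
next
  case (derives_Suc N S f xs)
  then obtain \<tau> where \<tau>: "\<forall>s\<in>S. \<tau> s \<in> terms F ar {..<length as} \<and> eval A (\<lambda>i. as ! i) (\<tau> s) = s"
    "finite ((\<Union>s\<in>S. subterms (\<tau> s)) - range Var)"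
    "card ((\<Union>s\<in>S. subterms (\<tau> s)) - range Var) \<le> N" by blast
  let ?x = "oper A f xs"
  show ?case
  proof (cases "?x \<in> S")
    case True
    then show ?thesis using \<tau> by (intro exI[of _ \<tau>]) (auto simp: insert_absorb)
  next
    case False
    define t where "t = Fun f (map \<tau> xs)"
    define \<tau>' where "\<tau>' = \<tau>(?x := t)"
    have "map (eval A (\<lambda>i. as ! i)) (map \<tau> xs) = xs"
      using \<tau>(1) derives_Suc.hyps by (auto intro!: map_idI)
    then have "eval A (\<lambda>i. as ! i) t = ?x" unfolding t_def by (metis eval.simps(2))
    moreover have "t \<in> terms F ar {..<length as}"
      unfolding t_def using \<tau>(1) derives_Suc.hyps by (intro terms.intros(2)) auto
    ultimately have 1: "\<forall>s\<in>insert ?x S. \<tau>' s \<in> terms F ar {..<length as} \<and> eval A (\<lambda>i. as ! i) (\<tau>' s) = s"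
      using \<tau>(1) by (simp add: \<tau>'_def)
    have "(\<Union>s\<in>S. subterms (\<tau>' s)) = (\<Union>s\<in>S. subterms (\<tau> s))"
      using False by (intro SUP_cong) (auto simp: \<tau>'_def)
    then have "(\<Union>s\<in>insert ?x S. subterms (\<tau>' s)) = subterms t \<union> (\<Union>s\<in>S. subterms (\<tau> s))"
      by (simp add: \<tau>'_def)
    also have "\<dots> = insert t (\<Union>s\<in>S. subterms (\<tau> s))"
      using derives_Suc.hyps by (auto simp: t_def)
    finally have "(\<Union>s\<in>insert ?x S. subterms (\<tau>' s)) - range Var
        \<subseteq> insert t ((\<Union>s\<in>S. subterms (\<tau> s)) - range Var)" by auto
    moreover have "card (insert t ((\<Union>s\<in>S. subterms (\<tau> s)) - range Var)) \<le> Suc N"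
      using \<tau>(2,3) by (simp add: card_insert_if)
    moreover have "finite (insert t ((\<Union>s\<in>S. subterms (\<tau> s)) - range Var))" using \<tau>(2) by simp
    ultimately show ?thesis using 1
      by (intro exI[of _ \<tau>']) (meson card_mono finite_subset order_trans)
  qed
qed

section \<open>Minimal circuits from subterms\<close>

lemma self_subterm: "t \<in> subterms t"
  by (cases t) auto

lemma subterms_args: "Fun f ts \<in> subterms t \<Longrightarrow> set ts \<subseteq> subterms t"
  by (induction t) (auto intro: self_subterm)

lemma finite_subterms: "finite (subterms t)"
  by (induction t) auto

lemma subterms_in_terms: "t \<in> terms F ar X \<Longrightarrow> s \<in> subterms t \<Longrightarrow> s \<in> terms F ar X"
proof (induction rule: terms.induct)
  case (1 i)
  then show ?case by (auto intro: terms.intros(1))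
next
  case (2 f ts)
  then show ?case using terms.intros(2)[of f F ts ar X] by auto
qed

lemma size_arg: "t \<in> set ts \<Longrightarrow> size t < size (Fun f ts)"
  using size_list_estimation'[of t ts "size t" size] by simp

lemma gate_terms_snoc:
  "foldl (\<lambda>ts (f, ws). ts @ [Fun f (map (wire_term ts) ws)]) [] (gs @ [g]) =
   (let ts = foldl (\<lambda>ts (f, ws). ts @ [Fun f (map (wire_term ts) ws)]) [] gs
    in ts @ [Fun (fst g) (map (wire_term ts) (snd g))])"
  by (simp add: Let_def split: prod.split)

text \<open>One gate is used per nonvariable subterm. Sorting by size gives a topological order,
  because arguments are strictly smaller than the term in which they occur.\<close>

lemma minimal_circuit_exists:
  assumes t: "t \<in> terms F ar {..<k}"
  shows "\<exists>C. is_minimal_circuit F ar k C t \<and> circuit_size C = card (subterms t - range Var)"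
proof -
  obtain ys where ys: "set ys = subterms t - range Var" "distinct ys"
    using finite_distinct_list[of "subterms t - range Var"] finite_subterms by blast
  define xs where "xs = sort_key size ys"
  have xs: "set xs = subterms t - range Var" "distinct xs" "sorted (map size xs)"
    using ys by (simp_all add: xs_def)
  define pos where "pos s = (SOME j. j < length xs \<and> xs ! j = s)" for s
  have pos: "pos s < length xs \<and> xs ! pos s = s" if "s \<in> set xs" for s
  proof -
    have "\<exists>j. j < length xs \<and> xs ! j = s" using that by (auto simp: in_set_conv_nth)
    then show ?thesis unfolding pos_def by (rule someI_ex)
  qed
  define wire where "wire s = (case s of Var i \<Rightarrow> Input i | Fun f ts \<Rightarrow> Gate (pos s))" for s :: "'a trm"
  define gate where "gate s = (case s of Var i \<Rightarrow> undefined | Fun f ts \<Rightarrow> (f, map wire ts))" for s :: "'a trm"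
  define C where "C = \<lparr>gates = map gate xs, out_wire = wire t\<rparr>"
  have wire: "wire_ok k l (wire s) \<and> wire_term (take l xs) (wire s) = s"
    if "s \<in> subterms t" "\<And>f ts. s = Fun f ts \<Longrightarrow> pos s < l" for s l
  proof (cases s)
    case (Var i)
    then have "i < k" using subterms_in_terms[OF t that(1)] by (auto elim: terms.cases)
    then show ?thesis using Var by (simp add: wire_def)
  next
    case (Fun f ts)
    then show ?thesis using that pos[of s] xs(1) by (auto simp: wire_def)
  qed
  have arg: "pos s < l"
    if l: "l < length xs" "xs ! l = Fun f ts" "s \<in> set ts" "s = Fun f' ts'" for l f ts s f' ts'
  proof (rule ccontr)
    assume "\<not> pos s < l"
    moreover have "s \<in> set xs"
      using subterms_args[of f ts t] nth_mem[OF l(1)] l xs(1) by auto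
    ultimately have "size (xs ! l) \<le> size s"
      using pos[of s] sorted_nth_mono[OF xs(3), of l "pos s"] l by auto
    then show False using size_arg[of s ts f] l by simp
  qed
  have gate: "\<exists>f ts. xs ! l = Fun f ts \<and> gate (xs ! l) = (f, map wire ts) \<and> set ts \<subseteq> subterms t
      \<and> f \<in> F \<and> length ts = ar f" if "l < length xs" for l
  proof -
    have "xs ! l \<in> subterms t - range Var" using that xs(1) nth_mem by blast
    then obtain f ts where f: "xs ! l = Fun f ts" "Fun f ts \<in> subterms t"
      by (cases "xs ! l") auto
    moreover have "Fun f ts \<in> terms F ar {..<k}" using subterms_in_terms[OF t f(2)] .
    then have "f \<in> F \<and> length ts = ar f" by (auto elim: terms.cases)
    ultimately show ?thesis using subterms_args[OF f(2)] by (simp add: gate_def)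
  qed
  have terms_take: "foldl (\<lambda>ts (f, ws). ts @ [Fun f (map (wire_term ts) ws)]) [] (map gate (take l xs))
      = take l xs" if "l \<le> length xs" for l
    using that
  proof (induction l)
    case (Suc l)
    then obtain f ts where f: "xs ! l = Fun f ts" "gate (xs ! l) = (f, map wire ts)" "set ts \<subseteq> subterms t"
      using gate[of l] by auto
    have "map (wire_term (take l xs)) (map wire ts) = ts"
      unfolding map_map using wire arg f Suc.prems by (intro map_idI) fastforce
    then show ?case using Suc f
      by (simp add: take_Suc_conv_app_nth gate_terms_snoc Let_def del: foldl_append)
  qed simp
  have gt: "gate_terms C = xs"
    using terms_take[of "length xs"] by (simp add: gate_terms_def C_def)
  have out: "wire_ok k (length xs) (wire t) \<and> wire_term xs (wire t) = t"
    using wire[of t "length xs"] pos[of t] xs(1) self_subterm[of t] by auto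
  have "is_circuit F ar k C"
    unfolding is_circuit_def
  proof (intro conjI allI impI)
    fix l assume "l < length (gates C)"
    then have l: "l < length xs" by (simp add: C_def)
    from gate[OF l] obtain f ts where f: "xs ! l = Fun f ts" "gate (xs ! l) = (f, map wire ts)"
      "set ts \<subseteq> subterms t" "f \<in> F" "length ts = ar f" by blast
    have "wire_ok k l (wire s)" if "s \<in> set ts" for s
      using wire[of s l] arg[OF l f(1) that] f(3) that by blast
    then show "case gates C ! l of (f, ws) \<Rightarrow> f \<in> F \<and> length ws = ar f \<and> (\<forall>w\<in>set ws. wire_ok k l w)"
      using f l by (simp add: C_def)
  qed (use out in \<open>simp add: C_def\<close>)
  then have "is_minimal_circuit F ar k C t"
    using xs out by (simp add: is_minimal_circuit_def represents_def gt) (simp add: C_def)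
  moreover have "circuit_size C = card (subterms t - range Var)"
    using distinct_card[OF xs(2)] xs(1) by (simp add: circuit_size_def C_def)
  ultimately show ?thesis by blast
qed

lemma circuit_of_reach:
  assumes "reach F ar A N (set as) {b}"
  shows "\<exists>t\<in>terms F ar {..<length as}. eval A (\<lambda>i. as ! i) t = b \<and>
    (\<exists>C. is_minimal_circuit F ar (length as) C t \<and> circuit_size C \<le> N)"
proof -
  obtain N' S where S: "N' \<le> N" "derives F ar A (set as) N' S" "b \<in> S"
    using assms by (auto simp: reach_def)
  from terms_of_derives[OF S(2)] obtain \<tau>
    where \<tau>: "\<forall>s\<in>S. \<tau> s \<in> terms F ar {..<length as} \<and> eval A (\<lambda>i. as ! i) (\<tau> s) = s"
      "finite ((\<Union>s\<in>S. subterms (\<tau> s)) - range Var)"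
      "card ((\<Union>s\<in>S. subterms (\<tau> s)) - range Var) \<le> N'" by blast
  have "card (subterms (\<tau> b) - range Var) \<le> card ((\<Union>s\<in>S. subterms (\<tau> s)) - range Var)"
    using \<tau>(2) S(3) by (intro card_mono) auto
  then have le: "card (subterms (\<tau> b) - range Var) \<le> N" using \<tau>(3) S(1) by simp
  have b: "\<tau> b \<in> terms F ar {..<length as}" "eval A (\<lambda>i. as ! i) (\<tau> b) = b"
    using \<tau>(1) S(3) by auto
  show ?thesis using minimal_circuit_exists[OF b(1)] le b by (intro bexI[of _ "\<tau> b"]) auto
qed

section \<open>A nondeterministic machine for the subpower membership problem\<close>

text \<open>Only \<open>App\<close> writes a new symbol, and it is used at the end of the contents
  only. Tapes therefore never change except by growing, and lists can model them.\<close>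

datatype 's action = Hold | Lft | Rgt | App 's

datatype 'f mode = Init | Header | Free | Load | Apply 'f | Copy | Compare | Accept

primrec written :: "'s action \<Rightarrow> 's \<Rightarrow> 's" where
  "written Hold s = s" | "written Lft s = s" | "written Rgt s = s" | "written (App a) s = a"

primrec moved :: "'s action \<Rightarrow> move" where
  "moved Hold = Stay" | "moved Lft = MoveLeft" | "moved Rgt = MoveRight" | "moved (App a) = MoveRight"

text \<open>A relation, since a left move from position 0 and \<open>App\<close> in the interior
  have no counterpart on lists.\<close>

primrec effect :: "'s action \<Rightarrow> 's list \<Rightarrow> nat \<Rightarrow> 's list \<Rightarrow> nat \<Rightarrow> bool" where
  "effect Hold xs p xs' p' \<longleftrightarrow> xs' = xs \<and> p' = p"
| "effect Lft xs p xs' p' \<longleftrightarrow> xs' = xs \<and> p = Suc p'"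
| "effect Rgt xs p xs' p' \<longleftrightarrow> xs' = xs \<and> p' = Suc p"
| "effect (App a) xs p xs' p' \<longleftrightarrow> xs' = xs @ [a] \<and> p = length xs \<and> p' = Suc p"

definition scan :: "'s tape_sym list \<Rightarrow> nat \<Rightarrow> 's tape_sym" where
  "scan xs p = (if p < length xs then xs ! p else blank)"

definition tape_of :: "'s tape_sym list \<Rightarrow> nat \<Rightarrow> 's tape" where
  "tape_of xs p = ((\<lambda>i. if 0 \<le> i \<and> i < int (length xs) then xs ! nat i else blank), int p)"

lemma read_tape_of: "read (tape_of xs p) = scan xs p"
  by (simp add: read_def tape_of_def scan_def)

lemma act_tape_of:
  assumes "effect a xs p xs' p'"
  shows "act (written a (scan xs p)) (moved a) (tape_of xs p) = tape_of xs' p'"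
proof -
  have [simp]: "nat (1 + int m) = Suc m" for m by (simp add: nat_add_distrib)
  show ?thesis using assms
    by (cases a) (auto simp: act_def tape_of_def scan_def nth_append fun_eq_iff nat_eq_iff)
qed

lemma scan_blank: "blank \<notin> set xs \<Longrightarrow> scan xs p = blank \<longleftrightarrow> length xs \<le> p"
  by (auto simp: scan_def in_set_conv_nth)

section \<open>Formats of the tape contents\<close>

abbreviation left_mark :: "'s tape_sym" where "left_mark \<equiv> Inr 3"
abbreviation open_mark :: "'s tape_sym" where "open_mark \<equiv> Inr 2"

text \<open>There is no end mark: the end of a tuple is recognised on tape 1, whose head passes
  through the algebras in step with the entries.\<close>

definition block :: "'a list \<Rightarrow> ('f, 'a) smp_sym tape_sym list" where
  "block t = open_mark # map (\<lambda>x. Inl (Elem x)) t"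

definition listing :: "'a list list \<Rightarrow> ('f, 'a) smp_sym tape_sym list" where
  "listing ts = left_mark # concat (map block ts)"

definition alg_tape :: "('f, 'a) algebra list \<Rightarrow> ('f, 'a) smp_sym tape_sym list" where
  "alg_tape As = left_mark # map (\<lambda>A. Inl (Alg A)) As"

definition header :: "('f, 'a) algebra list \<Rightarrow> 'a list list \<Rightarrow> ('f, 'a) smp_sym list" where
  "header As as = map Alg As @ [Sep] @ concat (map (\<lambda>a. map Elem a @ [Sep]) as)"

lemma smp_encode_header: "smp_encode As as b = header As as @ map Elem b"
  by (simp add: smp_encode_def header_def)

lemma header_snoc: "header As (as @ [a]) = header As as @ map Elem a @ [Sep]"
  by (simp add: header_def)

lemma listing_snoc: "listing (ts @ [t]) = listing ts @ block t"
  by (simp add: listing_def)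

lemma blank_notin: "blank \<notin> set (block t)" "blank \<notin> set (listing ts)" "blank \<notin> set (alg_tape As)"
  by (auto simp: block_def listing_def alg_tape_def)

lemma scan_alg_tape: "scan (alg_tape As) p = Inl (Alg A) \<longleftrightarrow> 0 < p \<and> p \<le> length As \<and> As ! (p - 1) = A"
  by (cases p) (auto simp: scan_def alg_tape_def)

lemma scan_alg_tape_blank: "scan (alg_tape As) p = blank \<longleftrightarrow> length As < p"
  using scan_blank[OF blank_notin(3), of As p] by (auto simp: alg_tape_def)

lemma scan_alg_tape_mark: "scan (alg_tape As) p = left_mark \<longleftrightarrow> p = 0"
  by (cases p) (auto simp: scan_def alg_tape_def)

lemma scan_block: "m < length t \<Longrightarrow> scan (pre @ block t @ suf) (Suc (length pre + m)) = Inl (Elem (t ! m))"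
  by (simp add: scan_def block_def nth_append)

text \<open>Head positions are guessed; scanning \<open>open_mark\<close> certifies that the head
  stands at the beginning of a listed tuple.\<close>

lemma scan_listing_open:
  fixes ts :: "'a list list"
  assumes "scan (listing ts :: ('f, 'a) smp_sym tape_sym list) p = open_mark"
  obtains pre t suf where "t \<in> set ts" "listing ts = pre @ (block t :: ('f, 'a) smp_sym tape_sym list) @ suf" "length pre = p"
proof -
  let ?L = "listing :: 'a list list \<Rightarrow> ('f, 'a) smp_sym tape_sym list"
  let ?b = "block :: 'a list \<Rightarrow> ('f, 'a) smp_sym tape_sym list"
  have "\<exists>us t vs. ts = us @ t # vs \<and> p = length (?L us)"
    using assms
  proof (induction ts rule: rev_induct)
    case Nil
    then show ?case by (cases p) (auto simp: scan_def listing_def)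
  next
    case (snoc t ts)
    have "p < length (?L (ts @ [t]))" using snoc.prems by (auto simp: scan_def split: if_splits)
    then consider "p < length (?L ts)" | "p = length (?L ts)"
      | "length (?L ts) < p" "p < length (?L (ts @ [t]))"
      by linarith
    then show ?case
    proof cases
      case 1
      then have "scan (?L ts) p = open_mark"
        using snoc.prems by (simp add: scan_def listing_snoc nth_append)
      from snoc.IH[OF this] obtain us t' vs where "ts = us @ t' # vs" "p = length (?L us)" by blast
      then show ?thesis by (intro exI[of _ us] exI[of _ t'] exI[of _ "vs @ [t]"]) simp
    next
      case 3
      then have "scan (?L (ts @ [t])) p = ?b t ! (p - length (?L ts))"
        by (simp add: scan_def listing_snoc nth_append)
      moreover have "?b t ! j = Inl (Elem (t ! (j - 1)))" if "0 < j" "j < length (?b t)" for j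
        using that by (cases j) (auto simp: block_def)
      ultimately show ?thesis using snoc.prems 3 by (auto simp: listing_snoc)
    qed auto
  qed
  then obtain us t vs where ts: "ts = us @ t # vs" "p = length (?L us)" by blast
  show ?thesis
    by (rule that[of t "?L us" "concat (map ?b vs)"]) (auto simp: ts listing_def)
qed

lemma scan_input:
  "scan (map Inl (u @ v)) (length u) = Inl s \<longleftrightarrow> (\<exists>v'. v = s # v')"
  "scan (map Inl (u @ v)) (length u) = blank \<longleftrightarrow> v = []"
  by (cases v; auto simp: scan_def nth_append)+

lemma block_snoc: "block (a @ [x]) = block a @ [Inl (Elem x)]"
  by (simp add: block_def)

lemma alg_tape_snoc: "alg_tape (As @ [A]) = alg_tape As @ [Inl (Alg A)]"
  by (simp add: alg_tape_def)

section \<open>The machine and its rules\<close>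

locale smp_machine =
  fixes F :: "'f set" and ar :: "'f \<Rightarrow> nat" and K :: "('f, 'a) algebra set"
    and r :: nat and idx :: "'f \<Rightarrow> nat"
  assumes finite_F: "finite F" and finite_K: "finite K"
    and algebra: "\<And>A. A \<in> K \<Longrightarrow> is_algebra F ar A"
    and finite_univ: "\<And>A. A \<in> K \<Longrightarrow> finite (univ A)"
    and ar_le: "\<And>f. f \<in> F \<Longrightarrow> ar f \<le> r" and idx: "inj_on idx F"
begin

definition syms :: "('f, 'a) smp_sym tape_sym set" where
  "syms = Inl ` smp_alphabet K \<union> {blank, left_mark, open_mark}"

text \<open>Tape 0 holds the input, tape 1 the list of algebras, tape 2 receives new tuples, and the
  \<open>r\<close> further tapes provide the arguments of the basic operations.\<close>

abbreviation num_tapes :: nat where "num_tapes \<equiv> r + 3"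

text \<open>The guessing happens in \<open>Free\<close>, where all heads but that of the input may
  wander and the next task is chosen. Each task begun there is one pass of head 1 from the left mark
  to the blank, and the symbol \<open>Alg A\<close> under this head names the current factor.
  \<open>Load\<close> ends only at \<open>Sep\<close>, so \<open>b\<close> cannot be taken for a
  generator; \<open>Compare\<close> accepts only if the tuple exhausts the input, so no generator
  can be skipped.\<close>

inductive rule :: "'f mode \<Rightarrow> ('f, 'a) smp_sym tape_sym list \<Rightarrow> 'f mode \<Rightarrow>
    (nat \<Rightarrow> ('f, 'a) smp_sym tape_sym action) \<Rightarrow> bool" where
  init: "rule Init ss Header (\<lambda>i. if i = 0 then Hold else App left_mark)"
| header_alg: "ss ! 0 = Inl (Alg A) \<Longrightarrow>
    rule Header ss Header (\<lambda>i. if i = 0 then Rgt else if i = 1 then App (Inl (Alg A)) else Hold)"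
| header_end: "ss ! 0 = Inl Sep \<Longrightarrow> rule Header ss Free (\<lambda>i. if i = 0 then Rgt else Hold)"
| free: "acts 0 = Hold \<Longrightarrow> (\<And>i. acts i \<in> {Hold, Lft, Rgt}) \<Longrightarrow> rule Free ss Free acts"
| load_start: "ss ! 1 = left_mark \<Longrightarrow>
    rule Free ss Load (\<lambda>i. if i = 1 then Rgt else if i = 2 then App open_mark else Hold)"
| load: "ss ! 1 = Inl (Alg A) \<Longrightarrow> ss ! 0 = Inl (Elem x) \<Longrightarrow> x \<in> univ A \<Longrightarrow>
    rule Load ss Load (\<lambda>i. if i \<le> 1 then Rgt else if i = 2 then App (Inl (Elem x)) else Hold)"
| load_end: "ss ! 1 = blank \<Longrightarrow> ss ! 0 = Inl Sep \<Longrightarrow>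
    rule Load ss Free (\<lambda>i. if i = 0 then Rgt else Hold)"
| op_start: "f \<in> F \<Longrightarrow> ss ! 1 = left_mark \<Longrightarrow> (\<And>j. j < ar f \<Longrightarrow> ss ! (3 + j) = open_mark) \<Longrightarrow>
    rule Free ss (Apply f) (\<lambda>i. if i = 1 then Rgt else if i = 2 then App open_mark
      else if 3 \<le> i \<and> i < 3 + ar f then Rgt else Hold)"
| op_step: "f \<in> F \<Longrightarrow> ss ! 1 = Inl (Alg A) \<Longrightarrow> length xs = ar f \<Longrightarrow>
    (\<And>j. j < ar f \<Longrightarrow> ss ! (3 + j) = Inl (Elem (xs ! j))) \<Longrightarrow>
    rule (Apply f) ss (Apply f) (\<lambda>i. if i = 1 then Rgt else if i = 2 then App (Inl (Elem (oper A f xs)))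
      else if 3 \<le> i \<and> i < 3 + ar f then Rgt else Hold)"
| op_end: "f \<in> F \<Longrightarrow> ss ! 1 = blank \<Longrightarrow> rule (Apply f) ss Free (\<lambda>i. Hold)"
| copy_start: "ss ! 1 = left_mark \<Longrightarrow> ss ! 2 = open_mark \<Longrightarrow>
    rule Free ss Copy (\<lambda>i. if i = 0 then Hold else if i \<le> 2 then Rgt else App open_mark)"
| copy: "ss ! 1 = Inl (Alg A) \<Longrightarrow> ss ! 2 = Inl (Elem x) \<Longrightarrow>
    rule Copy ss Copy (\<lambda>i. if i = 0 then Hold else if i \<le> 2 then Rgt else App (Inl (Elem x)))"
| copy_end: "ss ! 1 = blank \<Longrightarrow> rule Copy ss Free (\<lambda>i. Hold)"
| compare_start: "ss ! 1 = left_mark \<Longrightarrow> ss ! 2 = open_mark \<Longrightarrow>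
    rule Free ss Compare (\<lambda>i. if i = 1 \<or> i = 2 then Rgt else Hold)"
| compare: "ss ! 1 = Inl (Alg A) \<Longrightarrow> ss ! 0 = Inl (Elem x) \<Longrightarrow> ss ! 2 = Inl (Elem x) \<Longrightarrow>
    rule Compare ss Compare (\<lambda>i. if i \<le> 2 then Rgt else Hold)"
| accept: "ss ! 1 = blank \<Longrightarrow> ss ! 0 = blank \<Longrightarrow> rule Compare ss Accept (\<lambda>i. Hold)"

text \<open>These conditions keep the run within the scope of \<open>effect\<close>: no head moves
  left from the left mark or right from a blank, and symbols are appended at blanks only.\<close>

primrec allowed :: "('f, 'a) smp_sym tape_sym action \<Rightarrow> ('f, 'a) smp_sym tape_sym \<Rightarrow> bool" where
  "allowed Hold s \<longleftrightarrow> True"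
| "allowed Lft s \<longleftrightarrow> s \<noteq> left_mark"
| "allowed Rgt s \<longleftrightarrow> s \<noteq> blank"
| "allowed (App a) s \<longleftrightarrow> s = blank \<and> a \<in> syms \<and> a \<noteq> blank"

primrec code :: "'f mode \<Rightarrow> nat" where
  "code Init = 0" | "code Header = 1" | "code Free = 2" | "code Load = 3" | "code Copy = 4"
| "code Compare = 5" | "code Accept = 6" | "code (Apply f) = 7 + idx f"

definition modes :: "'f mode set" where
  "modes = {Init, Header, Free, Load, Copy, Compare, Accept} \<union> Apply ` F"

lemma inj_code: "q \<in> modes \<Longrightarrow> q' \<in> modes \<Longrightarrow> code q = code q' \<Longrightarrow> q = q'"
  using idx by (cases q; cases q') (auto simp: modes_def inj_on_def)

lemma rule_modes: "rule q ss q' acts \<Longrightarrow> q \<in> modes \<and> q' \<in> modes"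
  by (induction rule: rule.induct) (auto simp: modes_def)

definition machine :: "('f, 'a) smp_sym ntm" where
  "machine = \<lparr>tapes = num_tapes, states = code ` modes, symbols = syms, start = code Init,
     accept = code Accept,
     transitions = {(code q, ss, code q', map (\<lambda>i. written (acts i) (ss ! i)) [0..<num_tapes],
         map (\<lambda>i. moved (acts i)) [0..<num_tapes]) | q ss q' acts.
       length ss = num_tapes \<and> set ss \<subseteq> syms \<and> rule q ss q' acts \<and>
       (\<forall>i<num_tapes. allowed (acts i) (ss ! i))}\<rparr>"

lemma finite_alphabet: "finite (smp_alphabet K)"
  using finite_K finite_univ by (simp add: smp_alphabet_def)

lemma is_ntm_machine: "is_ntm (smp_alphabet K) machine"
proof -
  have wr: "written a s \<in> syms" if "allowed a s" "s \<in> syms" for a s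
    using that by (cases a) auto
  have "finite modes" using finite_F by (simp add: modes_def)
  moreover have "0 \<in> code ` modes" "6 \<in> code ` modes" by (force simp: modes_def)+
  moreover have "finite syms" "Inl ` smp_alphabet K \<subseteq> syms" "blank \<in> syms"
    using finite_alphabet by (auto simp: syms_def)
  moreover have "set (map (\<lambda>i. written (acts i) (ss ! i)) [0..<num_tapes]) \<subseteq> syms"
    if "length ss = num_tapes" "set ss \<subseteq> syms" "\<forall>i<num_tapes. allowed (acts i) (ss ! i)" for ss acts
    using that wr by (auto simp: subset_iff)
  ultimately show ?thesis
    unfolding is_ntm_def machine_def ntm.select_convs
    by (auto dest: rule_modes simp: in_lists_conv_set subset_iff simp del: upt_Suc)
qed

section \<open>Configurations given by lists and head positions\<close>

definition conf :: "'f mode \<Rightarrow> (nat \<Rightarrow> ('f, 'a) smp_sym tape_sym list) \<Rightarrow> (nat \<Rightarrow> nat) \<Rightarrow>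
    ('f, 'a) smp_sym config" where
  "conf q X P = (code q, map (\<lambda>i. tape_of (X i) (P i)) [0..<num_tapes])"

definition scans :: "(nat \<Rightarrow> ('f, 'a) smp_sym tape_sym list) \<Rightarrow> (nat \<Rightarrow> nat) \<Rightarrow>
    ('f, 'a) smp_sym tape_sym list" where
  "scans X P = map (\<lambda>i. scan (X i) (P i)) [0..<num_tapes]"

lemma length_scans: "length (scans X P) = num_tapes"
  by (simp add: scans_def)

lemma scans_nth: "i < num_tapes \<Longrightarrow> scans X P ! i = scan (X i) (P i)"
  by (simp add: scans_def)

lemma step_conf:
  assumes "rule q (scans X P) q' acts" "set (scans X P) \<subseteq> syms"
    and "\<And>i. i < num_tapes \<Longrightarrow> allowed (acts i) (scan (X i) (P i)) \<and>
      effect (acts i) (X i) (P i) (X' i) (P' i)"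
  shows "(conf q X P, conf q' X' P') \<in> step machine"
proof -
  let ?bs = "map (\<lambda>i. written (acts i) (scans X P ! i)) [0..<num_tapes]"
  let ?ms = "map (\<lambda>i. moved (acts i)) [0..<num_tapes]"
  have "(code q, scans X P, code q', ?bs, ?ms) \<in> transitions machine"
    unfolding machine_def ntm.select_convs mem_Collect_eq
    by (intro exI[of _ q] exI[of _ "scans X P"] exI[of _ q'] exI[of _ acts])
      (use assms in \<open>auto simp: scans_nth length_scans\<close>)
  moreover have "map read (map (\<lambda>i. tape_of (X i) (P i)) [0..<num_tapes]) = scans X P"
    by (simp add: scans_def read_tape_of)
  moreover have "map (\<lambda>i. tape_of (X' i) (P' i)) [0..<num_tapes] =
      map (\<lambda>i. act (?bs ! i) (?ms ! i) (map (\<lambda>i. tape_of (X i) (P i)) [0..<num_tapes] ! i)) [0..<num_tapes]"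
  proof (rule map_cong[OF refl])
    fix i assume "i \<in> set [0..<num_tapes]"
    then have "i < num_tapes" by simp
    then show "tape_of (X' i) (P' i) =
        act (?bs ! i) (?ms ! i) (map (\<lambda>i. tape_of (X i) (P i)) [0..<num_tapes] ! i)"
      using assms(3)[of i] act_tape_of[of "acts i" "X i" "P i" "X' i" "P' i"]
      by (simp add: scans_nth del: upt_Suc)
  qed
  ultimately show ?thesis unfolding conf_def step_def by force
qed

text \<open>The successor is described by any lists and positions related by \<open>effect\<close>.
  Their existence depends on the invariant and is settled in \<open>effect_exists\<close>.\<close>

lemma step_confE:
  assumes "(conf q X P, c) \<in> step machine" "q \<in> modes"
  obtains q' acts where "rule q (scans X P) q' acts"
    "\<And>i. i < num_tapes \<Longrightarrow> allowed (acts i) (scan (X i) (P i))"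
    "\<And>X' P'. (\<And>i. i < num_tapes \<Longrightarrow> effect (acts i) (X i) (P i) (X' i) (P' i)) \<Longrightarrow> c = conf q' X' P'"
proof -
  let ?ts = "map (\<lambda>i. tape_of (X i) (P i)) [0..<num_tapes]"
  have rd: "map read ?ts = scans X P" by (simp add: scans_def read_tape_of)
  obtain q'' ts' bs ms where c: "c = (q'', ts')"
    and tr: "(code q, scans X P, q'', bs, ms) \<in> transitions machine"
    and ts': "ts' = map (\<lambda>i. act (bs ! i) (ms ! i) (?ts ! i)) [0..<length ?ts]"
    using assms(1) rd unfolding conf_def step_def by auto
  obtain q0 q' acts where q': "code q = code q0" "q'' = code q'" "rule q0 (scans X P) q' acts"
    "\<forall>i<num_tapes. allowed (acts i) (scans X P ! i)"
    "bs = map (\<lambda>i. written (acts i) (scans X P ! i)) [0..<num_tapes]"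
    "ms = map (\<lambda>i. moved (acts i)) [0..<num_tapes]"
    using tr by (auto simp: machine_def)
  have "q0 = q" using inj_code[OF assms(2) _ q'(1)] rule_modes[OF q'(3)] by simp
  show ?thesis
  proof (rule that)
    show "rule q (scans X P) q' acts" using q' \<open>q0 = q\<close> by simp
    show "allowed (acts i) (scan (X i) (P i))" if "i < num_tapes" for i
      using q'(4) that by (simp add: scans_nth)
    fix X' P' assume eff: "\<And>i. i < num_tapes \<Longrightarrow> effect (acts i) (X i) (P i) (X' i) (P' i)"
    have "ts' = map (\<lambda>i. tape_of (X' i) (P' i)) [0..<num_tapes]"
      unfolding ts'
    proof (rule map_cong)
      fix i assume "i \<in> set [0..<num_tapes]"
      then have "i < num_tapes" by simp
      then show "act (bs ! i) (ms ! i) (?ts ! i) = tape_of (X' i) (P' i)"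
        using eff[of i] act_tape_of[of "acts i" "X i" "P i" "X' i" "P' i"] q'(5,6)
        by (simp add: scans_nth del: upt_Suc)
    qed simp
    then show "c = conf q' X' P'" using c q'(2) by (simp add: conf_def)
  qed
qed

lemma init_config_conf:
  "init_config machine w = conf Init (\<lambda>i. if i = 0 then map Inl w else []) (\<lambda>i. 0)"
proof -
  have "input_tape w = tape_of (map Inl w) 0" for w :: "('f, 'a) smp_sym list"
    by (auto simp: input_tape_def tape_of_def fun_eq_iff nat_less_iff)
  then have "input_tape w # replicate (r + 2) (input_tape []) =
      map (\<lambda>i. tape_of (if i = 0 then map Inl w else []) 0) [0..<num_tapes]"
    by (intro nth_equalityI) (auto simp: nth_Cons' simp del: upt_Suc)
  then show ?thesis by (simp add: init_config_def conf_def machine_def)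
qed

subsection \<open>Soundness\<close>

abbreviation gen :: "('f, 'a) algebra list \<Rightarrow> 'a list list \<Rightarrow> 'a list set" where
  "gen As as \<equiv> Sg F ar (prod_alg As) (set as)"

definition listed :: "'a list set \<Rightarrow> ('f, 'a) smp_sym tape_sym list \<Rightarrow> bool" where
  "listed S xs \<longleftrightarrow> (\<exists>ts. set ts \<subseteq> S \<and> xs = listing ts)"

lemma listed_mono: "listed S xs \<Longrightarrow> S \<subseteq> S' \<Longrightarrow> listed S' xs"
  by (auto simp: listed_def)

lemma listed_snoc: "set ts \<subseteq> S \<Longrightarrow> t \<in> S \<Longrightarrow> listed S (listing ts @ block t)"
  unfolding listed_def by (rule exI[of _ "ts @ [t]"]) (simp add: listing_snoc)

definition wf_tapes :: "(nat \<Rightarrow> ('f, 'a) smp_sym tape_sym list) \<Rightarrow> (nat \<Rightarrow> nat) \<Rightarrow> bool" where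
  "wf_tapes X P \<longleftrightarrow> (\<forall>i<num_tapes. blank \<notin> set (X i) \<and> P i \<le> length (X i))"

definition base :: "('f, 'a) smp_sym list \<Rightarrow> ('f, 'a) algebra list \<Rightarrow> 'a list list \<Rightarrow>
    (nat \<Rightarrow> ('f, 'a) smp_sym tape_sym list) \<Rightarrow> bool" where
  "base w As as X \<longleftrightarrow> X 0 = map Inl w \<and> As \<in> lists K \<and> set as \<subseteq> univ (prod_alg As) \<and>
     X 1 = alg_tape As"

text \<open>From \<open>Free\<close> on, the input left of head 0 is parsed as the algebras, the
  generators loaded so far and, in \<open>Load\<close> and \<open>Compare\<close>, a part of the
  tuple being read. The complete tuples that are still of use belong to the subalgebra generated by
  these generators. During a pass \<open>P 1\<close> is one more than the number of entries
  handled.\<close>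

primrec inv :: "('f, 'a) smp_sym list \<Rightarrow> 'f mode \<Rightarrow> (nat \<Rightarrow> ('f, 'a) smp_sym tape_sym list) \<Rightarrow>
    (nat \<Rightarrow> nat) \<Rightarrow> bool" where
  "inv w Init X P \<longleftrightarrow> X 0 = map Inl w \<and> P 0 = 0 \<and> (\<forall>i<num_tapes. 0 < i \<longrightarrow> X i = [])"
| "inv w Header X P \<longleftrightarrow> (\<exists>As rest. w = map Alg As @ rest \<and> X 0 = map Inl w \<and>
     P 0 = length As \<and> X 1 = alg_tape As \<and> (\<forall>i<num_tapes. 1 < i \<longrightarrow> X i = [left_mark]))"
| "inv w Free X P \<longleftrightarrow> (\<exists>As as rest. base w As as X \<and> w = header As as @ rest \<and>
     P 0 = length (header As as) \<and> (\<forall>i<num_tapes. 1 < i \<longrightarrow> listed (gen As as) (X i)))"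
| "inv w Load X P \<longleftrightarrow> (\<exists>As as a rest ts. base w As as X \<and>
     w = (header As as @ map Elem a) @ rest \<and> P 0 = length (header As as @ map Elem a) \<and>
     P 1 = Suc (length a) \<and> length a \<le> length As \<and> (\<forall>p<length a. a ! p \<in> univ (As ! p)) \<and>
     set ts \<subseteq> gen As as \<and> X 2 = listing ts @ block a \<and>
     (\<forall>i<num_tapes. 2 < i \<longrightarrow> listed (gen As as) (X i)))"
| "inv w (Apply f) X P \<longleftrightarrow> (\<exists>As as a rest ts pre tt suf. base w As as X \<and>
     w = header As as @ rest \<and> P 0 = length (header As as) \<and>
     P 1 = Suc (length a) \<and> length a \<le> length As \<and>
     (\<forall>p<length a. a ! p = oper (As ! p) f (map (\<lambda>j. tt j ! p) [0..<ar f])) \<and>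
     (\<forall>j<ar f. tt j \<in> gen As as \<and> X (3 + j) = pre j @ block (tt j) @ suf j \<and>
        P (3 + j) = Suc (length (pre j) + length a)) \<and>
     set ts \<subseteq> gen As as \<and> X 2 = listing ts @ block a \<and>
     (\<forall>i<num_tapes. 2 < i \<longrightarrow> listed (gen As as) (X i)))"
| "inv w Copy X P \<longleftrightarrow> (\<exists>As as m rest t pre suf. base w As as X \<and>
     w = header As as @ rest \<and> P 0 = length (header As as) \<and>
     P 1 = Suc m \<and> m \<le> length As \<and> t \<in> gen As as \<and> listed (gen As as) (X 2) \<and>
     X 2 = pre @ block t @ suf \<and> P 2 = Suc (length pre + m) \<and>
     (\<forall>i<num_tapes. 2 < i \<longrightarrow> (\<exists>ts. set ts \<subseteq> gen As as \<and> X i = listing ts @ block (take m t))))"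
| "inv w Compare X P \<longleftrightarrow> (\<exists>As as m rest t pre suf. base w As as X \<and>
     w = (header As as @ map Elem (take m t)) @ rest \<and>
     P 0 = length (header As as @ map Elem (take m t)) \<and>
     P 1 = Suc m \<and> m \<le> length As \<and> t \<in> gen As as \<and>
     X 2 = pre @ block t @ suf \<and> P 2 = Suc (length pre + m))"
| "inv w Accept X P \<longleftrightarrow> w \<in> SMP F ar K"

lemma wf_tapes_step:
  assumes "wf_tapes X P"
    and "\<And>i. i < num_tapes \<Longrightarrow> allowed (acts i) (scan (X i) (P i))"
    and "\<And>i. i < num_tapes \<Longrightarrow> effect (acts i) (X i) (P i) (X' i) (P' i)"
  shows "wf_tapes X' P'"
  unfolding wf_tapes_def
proof (intro allI impI)
  fix i assume i: "i < num_tapes"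
  have 1: "blank \<notin> set (X i)" "P i \<le> length (X i)" using assms(1) i by (auto simp: wf_tapes_def)
  show "blank \<notin> set (X' i) \<and> P' i \<le> length (X' i)"
    using 1 assms(2,3)[OF i] scan_blank[OF 1(1), of "P i"] by (cases "acts i") auto
qed

lemma rule_Lft: "rule q ss q' acts \<Longrightarrow> acts i = Lft \<Longrightarrow> q = Free \<and> i \<noteq> 0"
  by (erule rule.cases) (auto split: if_splits intro!: gr0I)

text \<open>Left moves occur in \<open>Free\<close> only and not on the input; there every other
  tape begins with \<open>left_mark\<close>, so an allowed left move does not start in cell 0. On a
  well-formed tape a head scanning a blank stands right after the contents, as \<open>App\<close>
  requires.\<close>

lemma effect_exists:
  assumes wf: "wf_tapes X P" and inv: "inv w q X P" and rule: "rule q (scans X P) q' acts"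
    and allowed: "\<And>i. i < num_tapes \<Longrightarrow> allowed (acts i) (scan (X i) (P i))"
  shows "\<exists>X' P'. \<forall>i<num_tapes. effect (acts i) (X i) (P i) (X' i) (P' i)"
proof -
  have Lft: "0 < P i" if i: "i < num_tapes" and a: "acts i = Lft" for i
  proof -
    have q: "q = Free" "i \<noteq> 0" using rule_Lft[OF rule a] by auto
    then obtain As as where "base w As as X" "\<forall>i<num_tapes. 1 < i \<longrightarrow> listed (gen As as) (X i)"
      using inv by auto
    then have *: "X 1 = alg_tape As" "1 < i \<longrightarrow> listed (gen As as) (X i)"
      using i by (auto simp: base_def)
    have "\<exists>xs. X i = left_mark # xs"
    proof (cases "i = 1")
      case False
      then show ?thesis using * q(2) by (auto simp: listed_def listing_def)
    qed (use * in \<open>simp add: alg_tape_def\<close>)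
    then show ?thesis using allowed[OF i] a by (cases "P i") (auto simp: scan_def)
  qed
  have "\<exists>xs' p'. effect (acts i) (X i) (P i) xs' p'" if i: "i < num_tapes" for i
  proof (cases "acts i")
    case Lft
    then show ?thesis using \<open>\<And>i. _ \<Longrightarrow> _ \<Longrightarrow> 0 < P i\<close>[OF i Lft] by (cases "P i") auto
  next
    case (App a)
    have "blank \<notin> set (X i)" "P i \<le> length (X i)" using wf i by (auto simp: wf_tapes_def)
    then show ?thesis using App allowed[OF i] scan_blank[of "X i" "P i"] by auto
  qed auto
  then show ?thesis by metis
qed

lemma scans_0: "scans X P ! 0 = scan (X 0) (P 0)" and scans_1: "scans X P ! Suc 0 = scan (X (Suc 0)) (P (Suc 0))"
  and scans_2: "scans X P ! 2 = scan (X 2) (P 2)"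
  by (rule scans_nth, simp)+

lemma scans_args: "f \<in> F \<Longrightarrow> j < ar f \<Longrightarrow> scans X P ! (3 + j) = scan (X (3 + j)) (P (3 + j))"
  using ar_le[of f] by (intro scans_nth) simp

lemma is_algebra_prod_K: "As \<in> lists K \<Longrightarrow> is_algebra F ar (prod_alg As)"
  using algebra by (intro is_algebra_prod) auto

lemma length_gen:
  assumes "base w As as X" "t \<in> gen As as"
  shows "length t = length As"
proof -
  have "t \<in> univ (prod_alg As)"
    using assms Sg_subset_univ[OF is_algebra_prod_K] by (auto simp: base_def)
  then show ?thesis by (simp add: univ_prod_alg)
qed

lemma inv_step:
  assumes w: "w \<in> lists (smp_alphabet K)" and inv: "inv w q X P"
    and rule: "rule q (scans X P) q' acts"
    and eff: "\<And>i. i < num_tapes \<Longrightarrow> effect (acts i) (X i) (P i) (X' i) (P' i)"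
  shows "inv w q' X' P'"
proof -
  note eff0 = eff[of 0] and eff1 = eff[of 1] and eff2 = eff[of 2]
  have same: "X' i = X i" if "i < num_tapes" "acts i \<in> {Hold, Lft, Rgt}" for i
    using eff[OF that(1)] that(2) by auto
  have arT: "3 + j < num_tapes" if "f \<in> F" "j < ar f" for f j using ar_le[OF that(1)] that by simp
  show ?thesis
    using rule
  proof cases
    case init
    then have "X' i = (if i = 0 then map Inl w else [left_mark])" if "i < num_tapes" for i
      using inv eff[OF that] that by (auto split: if_splits)
    then show ?thesis using init inv eff0
      by (auto simp: alg_tape_def intro!: exI[of _ "[]"])
  next
    case (header_alg A)
    with inv obtain As rest where *: "w = map Alg As @ rest" "X 0 = map Inl w" "P 0 = length As"
      "X 1 = alg_tape As" "\<forall>i<num_tapes. 1 < i \<longrightarrow> X i = [left_mark]" by auto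
    obtain rest' where "rest = Alg A # rest'"
      using header_alg(4) scan_input(1)[of "map Alg As" rest] * by (auto simp: scans_0)
    then have "w = map Alg (As @ [A]) @ rest'" using * by simp
    moreover have "X' 1 = alg_tape (As @ [A])" "X' 0 = map Inl w" "P' 0 = length (As @ [A])"
      using eff0 eff1 header_alg * by (auto simp: alg_tape_snoc)
    moreover have "\<forall>i<num_tapes. 1 < i \<longrightarrow> X' i = [left_mark]" using eff header_alg * by fastforce
    ultimately show ?thesis unfolding inv.simps header_alg(2) by blast
  next
    case header_end
    with inv obtain As rest where *: "w = map Alg As @ rest" "X 0 = map Inl w" "P 0 = length As"
      "X 1 = alg_tape As" "\<forall>i<num_tapes. 1 < i \<longrightarrow> X i = [left_mark]" by auto
    obtain rest' where "rest = Sep # rest'"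
      using header_end(4) scan_input(1)[of "map Alg As" rest] * by (auto simp: scans_0)
    then have "w = header As [] @ rest'" using * by (simp add: header_def)
    \<comment> \<open>This uses that \<open>w\<close> is a word over the alphabet, whose letters
      \<open>Alg A\<close> have \<open>A \<in> K\<close>.\<close>
    moreover have "As \<in> lists K" using w * by (auto simp: smp_alphabet_def)
    moreover have "X' 0 = map Inl w" "X' 1 = alg_tape As" "P' 0 = length (header As [])"
      using eff0 eff1 header_end * by (auto simp: header_def)
    moreover have "\<forall>i<num_tapes. 1 < i \<longrightarrow> listed (gen As []) (X' i)"
      using eff header_end * by (fastforce simp: listed_def listing_def intro: exI[of _ "[]"])
    ultimately show ?thesis unfolding header_end(2) inv.simps base_def
      by (intro exI[of _ As] exI[of _ "[]"] exI[of _ rest']) auto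
  next
    case free
    have "X' i = X i" if "i < num_tapes" for i
      using eff[OF that] free(4)[of i] by auto
    then have "X' 0 = X 0" "X' 1 = X 1" "P' 0 = P 0" "\<forall>i<num_tapes. X' i = X i"
      using eff0 free(3) by auto
    then show ?thesis using inv free(1,2) by (auto simp: base_def)
  next
    case load_start
    with inv obtain As as rest where *: "base w As as X" "w = header As as @ rest"
      "P 0 = length (header As as)" "\<forall>i<num_tapes. 1 < i \<longrightarrow> listed (gen As as) (X i)" by auto
    obtain ts where ts: "set ts \<subseteq> gen As as" "X 2 = listing ts"
      using *(4)[rule_format, of 2] by (auto simp: listed_def)
    have "P 1 = 0" using load_start(4) * by (simp add: scans_1 base_def scan_alg_tape_mark)
    then have "base w As as X'" "P' 0 = length (header As as @ map Elem [])" "P' 1 = Suc (length [])"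
      "X' 2 = listing ts @ block []"
      using eff0 eff1 eff2 load_start * ts by (auto simp: base_def block_def)
    moreover have "\<forall>i<num_tapes. 2 < i \<longrightarrow> listed (gen As as) (X' i)"
      using *(4) same load_start(3) by simp
    moreover have "w = (header As as @ map Elem []) @ rest" using *(2) by simp
    moreover have "\<forall>p<length ([] :: 'a list). [] ! p \<in> univ (As ! p)" "length [] \<le> length As" by auto
    ultimately show ?thesis using ts(1) unfolding inv.simps load_start(2) by blast
  next
    case (load A x)
    with inv obtain As as a rest ts where *: "base w As as X"
      "w = (header As as @ map Elem a) @ rest" "P 0 = length (header As as @ map Elem a)"
      "P 1 = Suc (length a)" "length a \<le> length As" "\<forall>p<length a. a ! p \<in> univ (As ! p)"
      "set ts \<subseteq> gen As as" "X 2 = listing ts @ block a"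
      "\<forall>i<num_tapes. 2 < i \<longrightarrow> listed (gen As as) (X i)" by auto
    have a: "length a < length As" "As ! length a = A"
      using load(4) * by (auto simp: scans_1 base_def scan_alg_tape)
    obtain rest' where "rest = Elem x # rest'"
      using load(5) scan_input(1)[of "header As as @ map Elem a" rest] * by (auto simp: scans_0 base_def)
    then have "w = (header As as @ map Elem (a @ [x])) @ rest'" using * by simp
    moreover have "\<forall>p<length (a @ [x]). (a @ [x]) ! p \<in> univ (As ! p)"
      using * a load(6) by (auto simp: nth_append less_Suc_eq)
    moreover have "base w As as X'" "P' 0 = length (header As as @ map Elem (a @ [x]))"
      "P' 1 = Suc (length (a @ [x]))" "X' 2 = listing ts @ block (a @ [x])"
      using eff0 eff1 eff2 load * by (auto simp: base_def block_snoc)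
    moreover have "\<forall>i<num_tapes. 2 < i \<longrightarrow> listed (gen As as) (X' i)"
      using *(9) same load(3) by simp
    moreover have "length (a @ [x]) \<le> length As" using a by simp
    ultimately show ?thesis using *(7) unfolding inv.simps load(2) by blast
  next
    case load_end
    with inv obtain As as a rest ts where *: "base w As as X"
      "w = (header As as @ map Elem a) @ rest" "P 0 = length (header As as @ map Elem a)"
      "P 1 = Suc (length a)" "length a \<le> length As" "\<forall>p<length a. a ! p \<in> univ (As ! p)"
      "set ts \<subseteq> gen As as" "X 2 = listing ts @ block a"
      "\<forall>i<num_tapes. 2 < i \<longrightarrow> listed (gen As as) (X i)" by auto
    have a: "length a = length As"
      using load_end(4) * by (auto simp: scans_1 base_def scan_alg_tape_blank)
    obtain rest' where "rest = Sep # rest'"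
      using load_end(5) scan_input(1)[of "header As as @ map Elem a" rest] * by (auto simp: scans_0 base_def)
    then have "w = header As (as @ [a]) @ rest'" using * by (simp add: header_snoc)
    moreover have "base w As (as @ [a]) X'" "P' 0 = length (header As (as @ [a]))"
      using eff0 eff1 load_end * a by (auto simp: base_def header_snoc univ_prod_alg)
    moreover have "listed (gen As (as @ [a])) (X' i)" if i: "i < num_tapes" "1 < i" for i
    proof -
      have sub: "gen As as \<subseteq> gen As (as @ [a])" by (rule Sg_mono) auto
      have "a \<in> gen As (as @ [a])" using subset_Sg[of "set (as @ [a])" F ar "prod_alg As"] by auto
      then have "listed (gen As (as @ [a])) (X 2)"
        using sub *(7) unfolding *(8) by (intro listed_snoc) auto
      moreover have "X' i = X i" using eff[OF i(1)] load_end i(2) by auto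
      ultimately show ?thesis using listed_mono[OF _ sub] *(9) i by (cases "i = 2") auto
    qed
    ultimately show ?thesis unfolding inv.simps load_end(2) by blast
  next
    case (op_start f)
    with inv obtain As as rest where *: "base w As as X" "w = header As as @ rest"
      "P 0 = length (header As as)" "\<forall>i<num_tapes. 1 < i \<longrightarrow> listed (gen As as) (X i)" by auto
    obtain ts where ts: "set ts \<subseteq> gen As as" "X 2 = listing ts"
      using *(4)[rule_format, of 2] by (auto simp: listed_def)
    have P1: "P 1 = 0" using op_start(5) * by (simp add: scans_1 base_def scan_alg_tape_mark)
    have "\<exists>pre t suf. t \<in> gen As as \<and> X (3 + j) = pre @ block t @ suf \<and> length pre = P (3 + j)"
      if j: "j < ar f" for j
    proof -
      obtain us where us: "set us \<subseteq> gen As as" "X (3 + j) = listing us"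
        using *(4)[rule_format, OF arT[OF op_start(4) j]] by (auto simp: listed_def)
      then have "scan (listing us :: ('f, 'a) smp_sym tape_sym list) (P (3 + j)) = open_mark"
        using op_start(6)[OF j] scans_args[OF op_start(4) j] by simp
      from scan_listing_open[OF this] show ?thesis using us by (metis subsetD)
    qed
    then obtain pre tt suf where pre: "\<forall>j<ar f. tt j \<in> gen As as \<and>
        X (3 + j) = pre j @ block (tt j) @ suf j \<and> length (pre j) = P (3 + j)" by metis
    have "tt j \<in> gen As as \<and> X' (3 + j) = pre j @ block (tt j) @ suf j \<and>
        P' (3 + j) = Suc (length (pre j) + length [])" if j: "j < ar f" for j
      using pre eff[OF arT[OF op_start(4) j]] op_start(3) j by auto
    moreover have "base w As as X'" "P' 0 = length (header As as)" "P' 1 = Suc (length [])"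
      "X' 2 = listing ts @ block []"
      using eff0 eff1 eff2 op_start * ts P1 by (auto simp: base_def block_def)
    moreover have "\<forall>i<num_tapes. 2 < i \<longrightarrow> listed (gen As as) (X' i)"
    proof (intro allI impI)
      fix i assume i: "i < num_tapes" "2 < i"
      then have "X' i = X i" using eff[OF i(1)] op_start(3) by (auto split: if_splits)
      then show "listed (gen As as) (X' i)" using * i by simp
    qed
    moreover have "\<forall>p<length ([] :: 'a list). [] ! p = oper (As ! p) f (map (\<lambda>j. tt j ! p) [0..<ar f])"
      "length [] \<le> length As" by auto
    ultimately show ?thesis using ts(1) *(2) unfolding inv.simps op_start(2) by blast
  next
    case (op_step f A xs)
    from inv[unfolded op_step(1) inv.simps]
    obtain As as a rest ts pre tt suf where *: "base w As as X"
      "w = header As as @ rest" "P 0 = length (header As as)"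
      "P 1 = Suc (length a)" "length a \<le> length As"
      "\<forall>p<length a. a ! p = oper (As ! p) f (map (\<lambda>j. tt j ! p) [0..<ar f])"
      "\<forall>j<ar f. tt j \<in> gen As as \<and> X (3 + j) = pre j @ block (tt j) @ suf j \<and>
        P (3 + j) = Suc (length (pre j) + length a)"
      "set ts \<subseteq> gen As as" "X 2 = listing ts @ block a"
      "\<forall>i<num_tapes. 2 < i \<longrightarrow> listed (gen As as) (X i)" by blast
    have a: "length a < length As" "As ! length a = A"
      using op_step(5) * by (auto simp: scans_1 base_def scan_alg_tape)
    \<comment> \<open>All argument heads stand at the entry with index \<open>length a\<close>, so
      the values read are the arguments in the current factor.\<close>
    have "xs ! j = tt j ! length a" if j: "j < ar f" for j
      using op_step(7)[OF j] *(7) j a(1) length_gen[OF *(1), of "tt j"]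
      by (simp add: scans_args[OF op_step(4) j] scan_block)
    then have xs: "xs = map (\<lambda>j. tt j ! length a) [0..<ar f]"
      using op_step(6) by (auto intro: nth_equalityI)
    let ?a = "a @ [oper A f xs]"
    have "\<forall>p<length ?a. ?a ! p = oper (As ! p) f (map (\<lambda>j. tt j ! p) [0..<ar f])"
      using *(6) a xs by (auto simp: nth_append less_Suc_eq)
    moreover have "tt j \<in> gen As as \<and> X' (3 + j) = pre j @ block (tt j) @ suf j \<and>
        P' (3 + j) = Suc (length (pre j) + length ?a)" if j: "j < ar f" for j
      using *(7) eff[OF arT[OF op_step(4) j]] op_step(3) j by auto
    moreover have "base w As as X'" "P' 0 = length (header As as)" "P' 1 = Suc (length ?a)"
      "X' 2 = listing ts @ block ?a"
      using eff0 eff1 eff2 op_step(3) * by (auto simp: base_def block_snoc)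
    moreover have "\<forall>i<num_tapes. 2 < i \<longrightarrow> listed (gen As as) (X' i)"
    proof (intro allI impI)
      fix i assume i: "i < num_tapes" "2 < i"
      then have "X' i = X i" using eff[OF i(1)] op_step(3) by (auto split: if_splits)
      then show "listed (gen As as) (X' i)" using * i by simp
    qed
    moreover have "length ?a \<le> length As" using a by simp
    ultimately show ?thesis using *(2,8) unfolding inv.simps op_step(2) by blast
  next
    case (op_end f)
    from inv[unfolded op_end(1) inv.simps]
    obtain As as a rest ts pre tt suf where *: "base w As as X"
      "w = header As as @ rest" "P 0 = length (header As as)"
      "P 1 = Suc (length a)" "length a \<le> length As"
      "\<forall>p<length a. a ! p = oper (As ! p) f (map (\<lambda>j. tt j ! p) [0..<ar f])"
      "\<forall>j<ar f. tt j \<in> gen As as \<and> X (3 + j) = pre j @ block (tt j) @ suf j \<and>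
        P (3 + j) = Suc (length (pre j) + length a)"
      "set ts \<subseteq> gen As as" "X 2 = listing ts @ block a"
      "\<forall>i<num_tapes. 2 < i \<longrightarrow> listed (gen As as) (X i)" by blast
    have len: "length a = length As"
      using op_end(5) * by (auto simp: scans_1 base_def scan_alg_tape_blank)
    have "a = oper (prod_alg As) f (map tt [0..<ar f])"
      using *(6) len by (intro nth_equalityI) (auto simp: length_oper_prod oper_prod_nth o_def)
    moreover have "oper (prod_alg As) f (map tt [0..<ar f]) \<in> gen As as"
      using *(1,7) is_algebra_prod_K op_end(4) by (intro Sg_oper) (auto simp: base_def)
    ultimately have "listed (gen As as) (X 2)" unfolding *(9) using *(8) by (intro listed_snoc) auto
    moreover have X': "\<forall>i<num_tapes. X' i = X i \<and> P' i = P i" using eff op_end(3) by auto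
    ultimately have "\<forall>i<num_tapes. 1 < i \<longrightarrow> listed (gen As as) (X' i)"
      using *(10) by (metis Suc_lessI numeral_2_eq_2 One_nat_def)
    moreover have "base w As as X'" "P' 0 = length (header As as)" using X' * by (auto simp: base_def)
    ultimately show ?thesis using *(2) unfolding inv.simps op_end(2) by blast
  next
    case copy_start
    with inv obtain As as rest where *: "base w As as X" "w = header As as @ rest"
      "P 0 = length (header As as)" "\<forall>i<num_tapes. 1 < i \<longrightarrow> listed (gen As as) (X i)" by auto
    obtain ts where ts: "set ts \<subseteq> gen As as" "X 2 = listing ts"
      using *(4)[rule_format, of 2] by (auto simp: listed_def)
    then have "scan (listing ts :: ('f, 'a) smp_sym tape_sym list) (P 2) = open_mark"
      using copy_start(5) by (simp add: scans_2)
    then obtain pre t suf where t: "t \<in> set ts" "X 2 = pre @ block t @ suf" "length pre = P 2"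
      using ts by (metis scan_listing_open)
    have "P 1 = 0" using copy_start(4) * by (simp add: scans_1 base_def scan_alg_tape_mark)
    then have "base w As as X'" "P' 0 = length (header As as)" "P' 1 = Suc 0" "X' 2 = X 2"
      "P' 2 = Suc (length pre + 0)"
      using eff0 eff1 eff2 copy_start * t by (auto simp: base_def)
    moreover have "\<exists>us. set us \<subseteq> gen As as \<and> X' i = listing us @ block (take 0 t)"
      if i: "i < num_tapes" "2 < i" for i
    proof -
      obtain us where "set us \<subseteq> gen As as" "X i = listing us"
        using *(4)[rule_format, OF i(1)] i(2) by (auto simp: listed_def)
      then show ?thesis using eff[OF i(1)] i copy_start(3) by (auto simp: block_def)
    qed
    moreover have "listed (gen As as) (X 2)" using *(4) by simp
    moreover have "0 \<le> length As" "t \<in> gen As as" using ts t by auto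
    ultimately show ?thesis using *(2) t(2) unfolding inv.simps copy_start(2) by metis
  next
    case (copy A x)
    with inv obtain As as m rest t pre suf where *: "base w As as X"
      "w = header As as @ rest" "P 0 = length (header As as)"
      "P 1 = Suc m" "m \<le> length As" "t \<in> gen As as" "listed (gen As as) (X 2)"
      "X 2 = pre @ block t @ suf" "P 2 = Suc (length pre + m)"
      "\<forall>i<num_tapes. 2 < i \<longrightarrow> (\<exists>ts. set ts \<subseteq> gen As as \<and> X i = listing ts @ block (take m t))" by auto
    have m: "m < length As" "m < length t"
      using copy(4) * length_gen[OF *(1,6)] by (auto simp: scans_1 base_def scan_alg_tape)
    have x: "x = t ! m" using copy(5) * m(2) by (simp add: scans_2 scan_block)
    have "base w As as X'" "P' 0 = length (header As as)" "P' 1 = Suc (Suc m)" "X' 2 = X 2"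
      "P' 2 = Suc (length pre + Suc m)"
      using eff0 eff1 eff2 copy(3) * by (auto simp: base_def)
    moreover have "\<exists>us. set us \<subseteq> gen As as \<and> X' i = listing us @ block (take (Suc m) t)"
      if i: "i < num_tapes" "2 < i" for i
    proof -
      obtain us where "set us \<subseteq> gen As as" "X i = listing us @ block (take m t)"
        using *(10) i by auto
      then show ?thesis using eff[OF i(1)] i copy(3) m(2) x
        by (auto simp: take_Suc_conv_app_nth block_snoc)
    qed
    moreover have "Suc m \<le> length As" using m by simp
    ultimately show ?thesis using *(2,6,7,8) unfolding inv.simps copy(2) by metis
  next
    case copy_end
    with inv obtain As as m rest t pre suf where *: "base w As as X"
      "w = header As as @ rest" "P 0 = length (header As as)"
      "P 1 = Suc m" "m \<le> length As" "t \<in> gen As as" "listed (gen As as) (X 2)"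
      "X 2 = pre @ block t @ suf" "P 2 = Suc (length pre + m)"
      "\<forall>i<num_tapes. 2 < i \<longrightarrow> (\<exists>ts. set ts \<subseteq> gen As as \<and> X i = listing ts @ block (take m t))" by auto
    have m: "take m t = t"
      using copy_end(4) * length_gen[OF *(1,6)] by (auto simp: scans_1 base_def scan_alg_tape_blank)
    have X': "\<forall>i<num_tapes. X' i = X i \<and> P' i = P i" using eff copy_end(3) by auto
    have "listed (gen As as) (X' i)" if i: "i < num_tapes" "1 < i" for i
    proof (cases "i = 2")
      case False
      then obtain us where "set us \<subseteq> gen As as" "X i = listing us @ block t" using *(10) i m by auto
      then show ?thesis using X' i *(6) listed_snoc by simp
    qed (use X' * i in simp)
    moreover have "base w As as X'" "P' 0 = length (header As as)" using X' * by (auto simp: base_def)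
    ultimately show ?thesis using *(2) unfolding inv.simps copy_end(2) by blast
  next
    case compare_start
    with inv obtain As as rest where *: "base w As as X" "w = header As as @ rest"
      "P 0 = length (header As as)" "\<forall>i<num_tapes. 1 < i \<longrightarrow> listed (gen As as) (X i)" by auto
    obtain ts where ts: "set ts \<subseteq> gen As as" "X 2 = listing ts"
      using *(4)[rule_format, of 2] by (auto simp: listed_def)
    then have "scan (listing ts :: ('f, 'a) smp_sym tape_sym list) (P 2) = open_mark"
      using compare_start(5) by (simp add: scans_2)
    then obtain pre t suf where t: "t \<in> set ts" "X 2 = pre @ block t @ suf" "length pre = P 2"
      using ts by (metis scan_listing_open)
    have "P 1 = 0" using compare_start(4) * by (simp add: scans_1 base_def scan_alg_tape_mark)
    then have "base w As as X'" "P' 0 = length (header As as @ map Elem (take 0 t))" "P' 1 = Suc 0"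
      "X' 2 = pre @ block t @ suf" "P' 2 = Suc (length pre + 0)"
      using eff0 eff1 eff2 compare_start * t by (auto simp: base_def)
    moreover have "w = (header As as @ map Elem (take 0 t)) @ rest" using *(2) by simp
    moreover have "0 \<le> length As" "t \<in> gen As as" using ts t by auto
    ultimately show ?thesis unfolding inv.simps compare_start(2) by metis
  next
    case (compare A x)
    with inv obtain As as m rest t pre suf where *: "base w As as X"
      "w = (header As as @ map Elem (take m t)) @ rest"
      "P 0 = length (header As as @ map Elem (take m t))"
      "P 1 = Suc m" "m \<le> length As" "t \<in> gen As as"
      "X 2 = pre @ block t @ suf" "P 2 = Suc (length pre + m)" by auto
    have m: "m < length As" "m < length t"
      using compare(4) * length_gen[OF *(1,6)] by (auto simp: scans_1 base_def scan_alg_tape)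
    have x: "x = t ! m" using compare(6) * m(2) by (simp add: scans_2 scan_block)
    obtain rest' where "rest = Elem x # rest'"
      using compare(5) scan_input(1)[of "header As as @ map Elem (take m t)" rest] *
      by (auto simp: scans_0 base_def)
    then have "w = (header As as @ map Elem (take (Suc m) t)) @ rest'"
      using * m x by (simp add: take_Suc_conv_app_nth)
    moreover have "base w As as X'" "P' 0 = length (header As as @ map Elem (take (Suc m) t))"
      "P' 1 = Suc (Suc m)" "X' 2 = pre @ block t @ suf" "P' 2 = Suc (length pre + Suc m)"
      using eff0 eff1 eff2 compare(3) * m by (auto simp: base_def)
    moreover have "Suc m \<le> length As" using m by simp
    ultimately show ?thesis using *(6) unfolding inv.simps compare(2) by metis
  next
    case accept
    with inv obtain As as m rest t where *: "base w As as X"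
      "w = (header As as @ map Elem (take m t)) @ rest"
      "P 0 = length (header As as @ map Elem (take m t))"
      "P 1 = Suc m" "m \<le> length As" "t \<in> gen As as" by auto
    have m: "take m t = t"
      using accept(4) * length_gen[OF *(1,6)] by (auto simp: scans_1 base_def scan_alg_tape_blank)
    \<comment> \<open>The blank on the input shows that nothing follows \<open>t\<close>; hence
      \<open>as\<close> contains all generators of the input.\<close>
    have "rest = []"
      using accept(5) scan_input(2)[of "header As as @ map Elem (take m t)" rest] *
      by (auto simp: scans_0 base_def)
    then have "w = smp_encode As as t" using * m by (simp add: smp_encode_header)
    moreover have "t \<in> univ (prod_alg As)"
      using * Sg_subset_univ[OF is_algebra_prod_K] by (auto simp: base_def)
    ultimately show ?thesis using *(1,6) unfolding accept(2) inv.simps SMP_def mem_Collect_eq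
      by (intro exI[of _ As] exI[of _ as] exI[of _ t]) (auto simp: base_def)
  qed
qed

lemma machine_sound:
  assumes w: "w \<in> lists (smp_alphabet K)" and acc: "accepts_in machine w n"
  shows "w \<in> SMP F ar K"
proof -
  have reach: "\<exists>q X P. c = conf q X P \<and> q \<in> modes \<and> wf_tapes X P \<and> inv w q X P"
    if "(init_config machine w, c) \<in> step machine ^^ n" for c n
    using that
  proof (induction n arbitrary: c)
    case 0
    then have "c = conf Init (\<lambda>i. if i = 0 then map Inl w else []) (\<lambda>i. 0)"
      by (simp add: init_config_conf)
    moreover have "wf_tapes (\<lambda>i. if i = 0 then map Inl w else []) (\<lambda>i. 0)"
      by (auto simp: wf_tapes_def)
    moreover have "inv w Init (\<lambda>i. if i = 0 then map Inl w else []) (\<lambda>i. 0)" by simp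
    moreover have "Init \<in> modes" by (simp add: modes_def)
    ultimately show ?case by blast
  next
    case (Suc n)
    then obtain c0 where c0: "(init_config machine w, c0) \<in> step machine ^^ n" "(c0, c) \<in> step machine"
      by auto
    from Suc.IH[OF c0(1)] obtain q X P where q: "c0 = conf q X P" "q \<in> modes" "wf_tapes X P" "inv w q X P"
      by blast
    obtain q' acts where r: "rule q (scans X P) q' acts"
      "\<And>i. i < num_tapes \<Longrightarrow> allowed (acts i) (scan (X i) (P i))"
      "\<And>X' P'. (\<And>i. i < num_tapes \<Longrightarrow> effect (acts i) (X i) (P i) (X' i) (P' i)) \<Longrightarrow> c = conf q' X' P'"
      using step_confE[OF c0(2)[unfolded q(1)] q(2)] by blast
    obtain X' P' where eff: "\<And>i. i < num_tapes \<Longrightarrow> effect (acts i) (X i) (P i) (X' i) (P' i)"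
      using effect_exists[OF q(3,4) r(1,2)] by blast
    have "c = conf q' X' P'" by (rule r(3)) (rule eff)
    moreover have "wf_tapes X' P'" by (rule wf_tapes_step[OF q(3) r(2) eff])
    moreover have "inv w q' X' P'" by (rule inv_step[OF w q(4) r(1) eff])
    ultimately show ?case using rule_modes[OF r(1)] by blast
  qed
  obtain \<tau>s where "(init_config machine w, (accept machine, \<tau>s)) \<in> step machine ^^ n"
    using acc by (auto simp: accepts_in_def)
  from reach[OF this] obtain q X P where q: "(accept machine, \<tau>s) = conf q X P" "q \<in> modes" "inv w q X P"
    by blast
  then have "code q = code Accept" by (simp add: conf_def machine_def)
  then have "q = Accept" using inj_code[OF q(2)] by (simp add: modes_def)
  then show ?thesis using q(3) by simp
qed

subsection \<open>Accepting computations\<close>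

definition runs :: "nat \<Rightarrow> ('f, 'a) smp_sym config \<Rightarrow> ('f, 'a) smp_sym config \<Rightarrow> bool" where
  "runs N c c' \<longleftrightarrow> (\<exists>m\<le>N. (c, c') \<in> step machine ^^ m)"

lemma runs_step: "(c, c') \<in> step machine \<Longrightarrow> runs 1 c c'"
  unfolding runs_def by (rule exI[of _ 1]) simp

lemma runs_trans: "runs N c c' \<Longrightarrow> runs M c' c'' \<Longrightarrow> runs (N + M) c c''"
  unfolding runs_def by (elim exE conjE) (meson add_mono relpow_trans)

lemma runs_mono: "runs N c c' \<Longrightarrow> N \<le> M \<Longrightarrow> runs M c c'"
  unfolding runs_def by (meson order_trans)

lemma runs_chain:
  assumes "\<And>m. m < n \<Longrightarrow> (c m, c (Suc m)) \<in> step machine"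
  shows "runs n (c 0) (c n)"
proof -
  have "(c 0, c m) \<in> step machine ^^ m" if "m \<le> n" for m
    using that
  proof (induction m)
    case (Suc m)
    then show ?case using assms[of m] by (intro relpow_Suc_I) auto
  qed simp
  then show ?thesis unfolding runs_def by blast
qed

lemma scans_syms:
  assumes "\<And>i. i < num_tapes \<Longrightarrow> set (X i) \<subseteq> syms"
  shows "set (scans X P) \<subseteq> syms"
proof -
  have "scan (X i) (P i) \<in> syms" if "i < num_tapes" for i
  proof (cases "P i < length (X i)")
    case True
    then show ?thesis using subsetD[OF assms[OF that] nth_mem[OF True]] by (simp add: scan_def)
  qed (simp add: scan_def syms_def)
  then show ?thesis by (auto simp: scans_def)
qed

text \<open>All heads approach their targets simultaneously, so the time is bounded by the largest
  distance.\<close>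

lemma runs_free:
  assumes "\<And>i. i < num_tapes \<Longrightarrow> set (X i) \<subseteq> syms \<and> blank \<notin> set (X i)"
    and "\<And>i p. i < num_tapes \<Longrightarrow> 0 < i \<Longrightarrow> 0 < p \<Longrightarrow> p < length (X i) \<Longrightarrow> X i ! p \<noteq> left_mark"
    and "P' 0 = P 0" and "\<And>i. i < num_tapes \<Longrightarrow> P i \<le> length (X i) \<and> P' i \<le> length (X i)"
    and "\<And>i. i < num_tapes \<Longrightarrow> P i \<le> P' i + L \<and> P' i \<le> P i + L"
  shows "runs L (conf Free X P) (conf Free X P')"
  using assms(3-)
proof (induction L arbitrary: P)
  case 0
  then have "P i = P' i" if "i < num_tapes" for i using that by (simp add: le_antisym)
  then have "conf Free X P = conf Free X P'" by (simp add: conf_def)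
  then show ?case unfolding runs_def by (intro exI[of _ 0]) simp
next
  case (Suc L)
  define Q where "Q i = (if P i < P' i then Suc (P i) else if P' i < P i then P i - 1 else P i)" for i
  define acts where "acts i = (if P i < P' i then Rgt else if P' i < P i then Lft
    else (Hold :: ('f, 'a) smp_sym tape_sym action))" for i
  have "(conf Free X P, conf Free X Q) \<in> step machine"
  proof (rule step_conf[of _ _ _ _ acts])
    show "rule Free (scans X P) Free acts"
      using Suc.prems(1) by (intro rule.free) (auto simp: acts_def)
    show "set (scans X P) \<subseteq> syms" using assms(1) by (intro scans_syms) auto
    fix i assume i: "i < num_tapes"
    have b: "P i \<le> length (X i)" "P' i \<le> length (X i)" using Suc.prems(2)[OF i] by auto
    have "scan (X i) (P i) \<noteq> blank" if "P i < P' i"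
      using that b scan_blank[of "X i" "P i"] assms(1)[OF i] by auto
    moreover have "scan (X i) (P i) \<noteq> left_mark" if "P' i < P i"
    proof -
      have "0 < i" using that Suc.prems(1) by (cases i) auto
      then show ?thesis using that assms(2)[OF i, of "P i"] by (auto simp: scan_def)
    qed
    ultimately show "allowed (acts i) (scan (X i) (P i)) \<and> effect (acts i) (X i) (P i) (X i) (Q i)"
      by (auto simp: acts_def Q_def)
  qed
  moreover have "runs L (conf Free X Q) (conf Free X P')"
  proof (rule Suc.IH)
    show "P' 0 = Q 0" using Suc.prems(1) by (simp add: Q_def)
    fix i assume i: "i < num_tapes"
    show "Q i \<le> length (X i) \<and> P' i \<le> length (X i)" using Suc.prems(2)[OF i] by (auto simp: Q_def)
    show "Q i \<le> P' i + L \<and> P' i \<le> Q i + L" using Suc.prems(3)[OF i] by (auto simp: Q_def)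
  qed
  ultimately show ?case using runs_trans[OF runs_step] by fastforce
qed

section \<open>An accepting run on a given instance\<close>

context
  fixes As :: "('f, 'a) algebra list" and as :: "'a list list" and b :: "'a list"
    and w :: "('f, 'a) smp_sym list" and n :: nat
  assumes As: "As \<in> lists K" and as: "set as \<subseteq> univ (prod_alg As)"
    and b: "b \<in> univ (prod_alg As)"
  defines "w \<equiv> smp_encode As as b" and "n \<equiv> length As"
begin

text \<open>Between two stages the argument tapes agree, and tape 2 is equal to them or one tuple
  ahead.\<close>

definition content :: "('f, 'a) smp_sym tape_sym list \<Rightarrow> ('f, 'a) smp_sym tape_sym list \<Rightarrow> nat \<Rightarrow>
    ('f, 'a) smp_sym tape_sym list" where
  "content xs ys i = (if i = 0 then map Inl w else if i = 1 then alg_tape As else if i = 2 then xs else ys)"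

lemma content_simps:
  "content xs ys 0 = map Inl w" "content xs ys (Suc 0) = alg_tape As" "content xs ys 2 = xs"
  "content xs ys (3 + j) = ys" "2 < i \<Longrightarrow> content xs ys i = ys"
  by (auto simp: content_def)

lemma Elem_in_alphabet: "t \<in> univ (prod_alg As) \<Longrightarrow> x \<in> set t \<Longrightarrow> Elem x \<in> smp_alphabet K"
  using As by (fastforce simp: univ_prod_alg smp_alphabet_def in_set_conv_nth)

lemma Sep_in_alphabet: "Sep \<in> smp_alphabet K"
  by (simp add: smp_alphabet_def)

lemma input_syms: "set w \<subseteq> smp_alphabet K"
proof
  fix s assume "s \<in> set w"
  then consider A where "s = Alg A" "A \<in> set As" | "s = Sep"
    | x t where "s = Elem x" "x \<in> set t" "t \<in> insert b (set as)"
    by (auto simp: w_def smp_encode_def split: if_splits)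
  then show "s \<in> smp_alphabet K"
  proof cases
    case 1
    then show ?thesis using As by (auto simp: smp_alphabet_def)
  next
    case 3
    then show ?thesis using Elem_in_alphabet[of t x] as b by auto
  qed (simp add: Sep_in_alphabet)
qed

lemma alg_tape_syms: "set (alg_tape As) \<subseteq> syms"
  using As by (auto simp: alg_tape_def syms_def smp_alphabet_def)

lemma block_syms: "t \<in> univ (prod_alg As) \<Longrightarrow> set (block (take m t)) \<subseteq> syms"
  using Elem_in_alphabet[of t] set_take_subset[of m t] by (auto simp: block_def syms_def)

lemma listing_syms: "set ts \<subseteq> univ (prod_alg As) \<Longrightarrow> set (listing ts) \<subseteq> syms"
proof -
  assume ts: "set ts \<subseteq> univ (prod_alg As)"
  have "set (block t) \<subseteq> syms" if "t \<in> set ts" for t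
    using block_syms[of t "length t"] ts that by auto
  moreover have "left_mark \<in> syms" by (simp add: syms_def)
  ultimately show ?thesis by (auto simp: listing_def)
qed

lemma content_syms:
  assumes "set xs \<subseteq> syms" "set ys \<subseteq> syms"
  shows "set (scans (content xs ys) P) \<subseteq> syms"
  using assms input_syms alg_tape_syms
  by (intro scans_syms) (auto simp: content_def syms_def)

lemma length_listing:
  "set ts \<subseteq> univ (prod_alg As) \<Longrightarrow> length (listing ts :: ('f, 'a) smp_sym tape_sym list) = 1 + length ts * (n + 1)"
  by (induction ts) (auto simp: listing_def block_def univ_prod_alg n_def)

lemma no_left_mark:
  "0 < p \<Longrightarrow> p < length (listing ts :: ('f, 'a) smp_sym tape_sym list) \<Longrightarrow>
    (listing ts :: ('f, 'a) smp_sym tape_sym list) ! p \<noteq> left_mark"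
  "0 < p \<Longrightarrow> p < length (alg_tape As) \<Longrightarrow> alg_tape As ! p \<noteq> left_mark"
proof -
  let ?c = "concat (map block ts) :: ('f, 'a) smp_sym tape_sym list"
  have "left_mark \<notin> set ?c" by (auto simp: block_def)
  then have "?c ! m \<noteq> left_mark" if "m < length ?c" for m using nth_mem[OF that] by metis
  then show "0 < p \<Longrightarrow> p < length (listing ts :: ('f, 'a) smp_sym tape_sym list) \<Longrightarrow>
      (listing ts :: ('f, 'a) smp_sym tape_sym list) ! p \<noteq> left_mark"
    by (cases p) (auto simp: listing_def)
  show "0 < p \<Longrightarrow> p < length (alg_tape As) \<Longrightarrow> alg_tape As ! p \<noteq> left_mark"
    by (cases p) (auto simp: alg_tape_def)
qed

lemma runs_free_content:
  assumes "set ts \<subseteq> univ (prod_alg As)" "set us \<subseteq> univ (prod_alg As)"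
    and "P' 0 = P 0" "P 0 \<le> length w"
    and "\<And>i. i < num_tapes \<Longrightarrow> 0 < i \<Longrightarrow> P i \<le> length (content (listing ts) (listing us) i) \<and>
      P' i \<le> length (content (listing ts) (listing us) i)"
    and "length ts \<le> q" "length us \<le> q"
  shows "runs (1 + (q + 1) * (n + 1)) (conf Free (content (listing ts) (listing us)) P)
    (conf Free (content (listing ts) (listing us)) P')"
proof (rule runs_free)
  let ?X = "content (listing ts) (listing us)"
  fix i assume i: "i < num_tapes"
  show "set (?X i) \<subseteq> syms \<and> blank \<notin> set (?X i)"
    using input_syms alg_tape_syms listing_syms[OF assms(1)] listing_syms[OF assms(2)]
    by (auto simp: content_def blank_notin) (auto simp: syms_def)
  show "?X i ! p \<noteq> left_mark" if "0 < i" "0 < p" "p < length (?X i)" for p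
    using that by (auto simp: content_def no_left_mark)
  show "P i \<le> length (?X i) \<and> P' i \<le> length (?X i)"
    using assms(3,4) assms(5)[OF i] by (cases "i = 0") (auto simp: content_simps)
  \<comment> \<open>The factor \<open>q + 1\<close> in place of \<open>q\<close> makes the bound
    cover the algebra tape even if \<open>q = 0\<close>.\<close>
  have "length (?X i) \<le> 1 + (q + 1) * (n + 1)" if "0 < i"
  proof -
    have "length ts * (n + 1) \<le> (q + 1) * (n + 1)" "length us * (n + 1) \<le> (q + 1) * (n + 1)"
      using assms(6,7) by (intro mult_le_mono; simp)+
    then show ?thesis using that assms(1,2)
      by (auto simp: content_def length_listing alg_tape_def n_def)
  qed
  then show "P i \<le> P' i + (1 + (q + 1) * (n + 1)) \<and> P' i \<le> P i + (1 + (q + 1) * (n + 1))"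
    using assms(3) assms(5)[OF i] by (cases "i = 0") auto
qed (use assms in auto)

lemma scan_alg:
  "m < n \<Longrightarrow> scan (alg_tape As) (Suc m) = Inl (Alg (As ! m))"
  "scan (alg_tape As) (Suc n) = blank" "scan (alg_tape As) 0 = left_mark"
  by (auto simp: scan_alg_tape scan_alg_tape_blank scan_alg_tape_mark n_def)

lemma take_Suc_block: "m < length t \<Longrightarrow> block (take (Suc m) t) = block (take m t) @ [Inl (Elem (t ! m))]"
  by (simp add: take_Suc_conv_app_nth block_snoc)

lemma scan_at: "v = u @ s # u' \<Longrightarrow> p = length u \<Longrightarrow> scan (map Inl v) p = Inl s"
  by (simp add: scan_def nth_append)

lemma header_append: "header As (us @ vs) = header As us @ concat (map (\<lambda>a. map Elem a @ [Sep]) vs)"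
  by (simp add: header_def)

lemma header_split:
  assumes "j < length as"
  obtains rest where "w = header As (take j as) @ map Elem (as ! j) @ Sep # rest"
proof -
  have "header As as = header As (take j as @ as ! j # drop (Suc j) as)"
    using arg_cong[OF id_take_nth_drop[OF assms]] .
  then show ?thesis using that by (simp add: header_append w_def smp_encode_header)
qed

lemma scan_load:
  assumes "j < length as"
  shows "m < n \<Longrightarrow> scan (map Inl w) (length (header As (take j as)) + m) = Inl (Elem (as ! j ! m))"
    and "scan (map Inl w) (length (header As (take j as)) + n) = Inl Sep"
proof -
  have "as ! j \<in> univ (prod_alg As)" using as nth_mem[OF assms] by blast
  then have len: "length (as ! j) = n" by (simp add: univ_prod_alg n_def)
  obtain rest where w: "w = header As (take j as) @ map Elem (as ! j) @ Sep # rest"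
    using header_split[OF assms] .
  show "scan (map Inl w) (length (header As (take j as)) + m) = Inl (Elem (as ! j ! m))" if m: "m < n"
  proof (rule scan_at)
    have "as ! j = take m (as ! j) @ as ! j ! m # drop (Suc m) (as ! j)"
      using m len by (intro id_take_nth_drop) simp
    from arg_cong[OF this, of "map Elem"]
    show "w = (header As (take j as) @ map Elem (take m (as ! j))) @ Elem (as ! j ! m) #
        (map Elem (drop (Suc m) (as ! j)) @ Sep # rest)"
      unfolding w by (metis append.assoc append_Cons list.simps(9) map_append)
  qed (use m len in simp)
  show "scan (map Inl w) (length (header As (take j as)) + n) = Inl Sep"
    by (rule scan_at[of _ "header As (take j as) @ map Elem (as ! j)" _ rest]) (simp_all add: w len)
qed

lemma length_header_Suc:
  "j < length as \<Longrightarrow> length (header As (take (Suc j) as)) = length (header As (take j as)) + n + 1"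
proof -
  assume j: "j < length as"
  then have "as ! j \<in> univ (prod_alg As)" using as nth_mem by blast
  then show ?thesis using j by (simp add: take_Suc_conv_app_nth header_snoc univ_prod_alg n_def)
qed

lemma header_le: "length (header As (take j as)) \<le> length w"
proof -
  have "header As as = header As (take j as @ drop j as)" by simp
  then have "length (header As (take j as)) \<le> length (header As as)"
    unfolding header_append by simp
  then show ?thesis by (simp add: w_def smp_encode_header)
qed

abbreviation lst :: "'a list list \<Rightarrow> ('f, 'a) smp_sym tape_sym list" where "lst \<equiv> listing"
abbreviation blk :: "'a list \<Rightarrow> ('f, 'a) smp_sym tape_sym list" where "blk \<equiv> block"

definition heads_ok :: "'a list list \<Rightarrow> 'a list list \<Rightarrow> (nat \<Rightarrow> nat) \<Rightarrow> bool" where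
  "heads_ok ts us P \<longleftrightarrow> P 0 \<le> length w \<and>
     (\<forall>i<num_tapes. 0 < i \<longrightarrow> P i \<le> length (content (lst ts) (lst us) i))"

text \<open>Repositioning of the heads, a starting step, one step per entry and a closing
  step.\<close>

definition stage :: "nat \<Rightarrow> nat" where
  "stage q = (1 + (q + 1) * (n + 1)) + 1 + n + 1"

lemma runs_stage:
  assumes "runs (1 + (q + 1) * (n + 1)) c c1" "(c1, c2 0) \<in> step machine"
    and "\<And>m. m < n \<Longrightarrow> (c2 m, c2 (Suc m)) \<in> step machine" "(c2 n, c') \<in> step machine"
  shows "runs (stage q) c c'"
  unfolding stage_def
  using runs_trans[OF runs_trans[OF runs_trans[OF assms(1) runs_step[OF assms(2)]]
    runs_chain[of n c2, OF assms(3)]] runs_step[OF assms(4)]] .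

lemma runs_free_heads:
  assumes "set ts \<subseteq> univ (prod_alg As)" "set us \<subseteq> univ (prod_alg As)"
    and "heads_ok ts us P" "heads_ok ts us P'" "P' 0 = P 0" "length ts \<le> q" "length us \<le> q"
  shows "runs (1 + (q + 1) * (n + 1)) (conf Free (content (lst ts) (lst us)) P)
    (conf Free (content (lst ts) (lst us)) P')"
  using assms by (intro runs_free_content) (auto simp: heads_ok_def)

lemma Elem_in_syms: "t \<in> univ (prod_alg As) \<Longrightarrow> m < n \<Longrightarrow> Inl (Elem (t ! m)) \<in> syms"
  using Elem_in_alphabet[of t "t ! m"] by (auto simp: syms_def univ_prod_alg n_def)

lemma marks_in_syms: "open_mark \<in> syms" "left_mark \<in> syms"
  by (auto simp: syms_def)

lemma append_syms:
  assumes "set ts \<subseteq> univ (prod_alg As)" "t \<in> univ (prod_alg As)"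
  shows "set (lst ts @ blk (take m t)) \<subseteq> syms"
  using listing_syms[OF assms(1)] block_syms[OF assms(2)] by simp

lemma scan_append_end: "scan (lst ts @ blk t) (length (lst ts) + length (blk t)) = blank"
  "scan (lst ts) (length (lst ts)) = blank"
  by (simp_all add: scan_def)

lemma load_stage:
  assumes ts: "set ts \<subseteq> univ (prod_alg As)" "length ts \<le> q" and j: "j < length as"
    and P: "heads_ok ts ts P" "P 0 = length (header As (take j as))"
  obtains P' where "heads_ok (ts @ [as ! j]) ts P'" "P' 0 = length (header As (take (Suc j) as))"
    "runs (stage q) (conf Free (content (lst ts) (lst ts)) P)
       (conf Free (content (lst (ts @ [as ! j])) (lst ts)) P')"
proof -
  define a where "a = as ! j"
  have aU: "a \<in> univ (prod_alg As)" using as nth_mem[OF j] by (auto simp: a_def)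
  then have len: "length a = n" by (simp add: univ_prod_alg n_def)
  have au: "a ! m \<in> univ (As ! m)" if "m < n" for m using aU that by (simp add: univ_prod_alg n_def)
  let ?A = "\<lambda>m. lst ts @ blk (take m a)"
  \<comment> \<open>\<open>P1\<close> is the position to which the heads are moved in
    \<open>Free\<close>, and \<open>Q m\<close> the position after \<open>m\<close> entries. The
    other stages follow the same scheme.\<close>
  define P1 where "P1 i = (if i = 0 then P 0 else if i = 2 then length (lst ts) else 0)" for i :: nat
  define Q where "Q m i = (if i = 0 then P 0 + m else if i = 1 then Suc m
    else if i = 2 then length (?A m) else 0)" for m i :: nat
  define P' where "P' i = (if i = 0 then P 0 + n + 1 else Q n i)" for i
  have P'0: "P' 0 = length (header As (take (Suc j) as))"
    using P(2) length_header_Suc[OF j] by (simp add: P'_def)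
  have "P' 0 \<le> length w" using header_le[of "Suc j"] P'0 by simp
  then have ok': "heads_ok (ts @ [a]) ts P'"
    by (auto simp: heads_ok_def P'_def Q_def content_def listing_snoc len alg_tape_def n_def[symmetric])
  have "heads_ok ts ts P1" using P(1) by (auto simp: heads_ok_def P1_def content_def)
  then have r: "runs (1 + (q + 1) * (n + 1)) (conf Free (content (lst ts) (lst ts)) P)
      (conf Free (content (lst ts) (lst ts)) P1)"
    using ts P by (intro runs_free_heads) (auto simp: P1_def)
  note S = content_syms[OF append_syms[OF ts(1) aU] listing_syms[OF ts(1)]]
  have "runs (stage q) (conf Free (content (lst ts) (lst ts)) P)
      (conf Free (content (?A n) (lst ts)) P')"
  proof (rule runs_stage[OF r, of "\<lambda>m. conf Load (content (?A m) (lst ts)) (Q m)"])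
    show "(conf Free (content (lst ts) (lst ts)) P1, conf Load (content (?A 0) (lst ts)) (Q 0)) \<in> step machine"
      by (rule step_conf[OF rule.load_start content_syms])
        (use listing_syms[OF ts(1)] in \<open>auto simp: scans_1 content_def P1_def Q_def scan_alg(3)
          scan_append_end marks_in_syms block_def\<close>)
  next
    fix m assume m: "m < n"
    show "(conf Load (content (?A m) (lst ts)) (Q m), conf Load (content (?A (Suc m)) (lst ts)) (Q (Suc m)))
        \<in> step machine"
      by (rule step_conf[OF rule.load[of _ "As ! m" "a ! m"] S])
        (use m au[OF m] scan_load(1)[OF j m] P(2) Elem_in_syms[OF aU m] in \<open>auto simp: scans_0 scans_1 content_def Q_def scan_alg(1)
          scan_append_end take_Suc_block len a_def[symmetric]\<close>)
  next
    show "(conf Load (content (?A n) (lst ts)) (Q n), conf Free (content (?A n) (lst ts)) P') \<in> step machine"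
      by (rule step_conf[OF rule.load_end S])
        (use scan_load(2)[OF j] P(2) in \<open>auto simp: scans_0 scans_1 content_def Q_def P'_def scan_alg(2)\<close>)
  qed
  then show ?thesis using that[of P'] ok' P'0 by (simp add: len a_def[symmetric] listing_snoc)
qed

lemma scan_block_open: "scan (pre @ blk t @ suf) (length pre) = open_mark"
  by (simp add: scan_def block_def)

text \<open>With equal tapes restored, later operations can place each argument head on any tuple,
  also several heads on the same one. The strict bound on \<open>length ts\<close> leaves room for
  the tuple by which tape 2 is ahead.\<close>

lemma copy_stage:
  assumes ts: "set ts \<subseteq> univ (prod_alg As)" "length ts < q" and t: "t \<in> univ (prod_alg As)"
    and P: "heads_ok (ts @ [t]) ts P"
  obtains P' where "heads_ok (ts @ [t]) (ts @ [t]) P'" "P' 0 = P 0"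
    "runs (stage q) (conf Free (content (lst (ts @ [t])) (lst ts)) P)
       (conf Free (content (lst (ts @ [t])) (lst (ts @ [t]))) P')"
proof -
  have len: "length t = n" using t by (simp add: univ_prod_alg n_def)
  let ?A = "\<lambda>m. lst ts @ blk (take m t)" and ?L = "lst (ts @ [t])"
  define P1 where "P1 i = (if i = 0 then P 0 else if i = 1 then 0 else length (lst ts))" for i :: nat
  define Q where "Q m i = (if i = 0 then P 0 else if i = 1 then Suc m
    else if i = 2 then Suc (length (lst ts) + m) else length (?A m))" for m i :: nat
  have ok': "heads_ok (ts @ [t]) (ts @ [t]) (Q n)"
    using P by (auto simp: heads_ok_def Q_def content_def listing_snoc block_def len alg_tape_def n_def[symmetric])
  have "heads_ok (ts @ [t]) ts P1"
    using P by (auto simp: heads_ok_def P1_def content_def listing_snoc)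
  then have r: "runs (1 + (q + 1) * (n + 1)) (conf Free (content ?L (lst ts)) P)
      (conf Free (content ?L (lst ts)) P1)"
    using ts t P by (intro runs_free_heads) (auto simp: P1_def)
  have LS: "set ?L \<subseteq> syms" using listing_syms[of "ts @ [t]"] ts t by simp
  note S = content_syms[OF LS append_syms[OF ts(1) t]]
  have sc: "scan ?L (Suc (length (lst ts) + m)) = Inl (Elem (t ! m))" if "m < n" for m
    using scan_block[of m t "lst ts" "[]"] that len by (simp add: listing_snoc)
  have so: "scan ?L (length (lst ts)) = open_mark"
    using scan_block_open[of "lst ts" t "[]"] by (simp add: listing_snoc)
  have "runs (stage q) (conf Free (content ?L (lst ts)) P) (conf Free (content ?L (?A n)) (Q n))"
  proof (rule runs_stage[OF r, of "\<lambda>m. conf Copy (content ?L (?A m)) (Q m)"])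
    show "(conf Free (content ?L (lst ts)) P1, conf Copy (content ?L (?A 0)) (Q 0)) \<in> step machine"
      by (rule step_conf[OF rule.copy_start content_syms[OF LS listing_syms[OF ts(1)]]])
        (use so in \<open>auto simp: scans_1 scans_2 content_def P1_def Q_def scan_alg(3)
          scan_append_end marks_in_syms block_def\<close>)
  next
    fix m assume m: "m < n"
    show "(conf Copy (content ?L (?A m)) (Q m), conf Copy (content ?L (?A (Suc m))) (Q (Suc m)))
        \<in> step machine"
      by (rule step_conf[OF rule.copy[of _ "As ! m" "t ! m"] S])
        (use m sc[OF m] Elem_in_syms[OF t m] in \<open>auto simp: scans_1 scans_2 content_def Q_def scan_alg(1)
          scan_append_end take_Suc_block len\<close>)
  next
    show "(conf Copy (content ?L (?A n)) (Q n), conf Free (content ?L (?A n)) (Q n)) \<in> step machine"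
      by (rule step_conf[OF rule.copy_end S]) (auto simp: scans_1 content_def Q_def scan_alg(2))
  qed
  then show ?thesis using that[of "Q n"] ok' by (simp add: len listing_snoc Q_def)
qed

lemma listing_split:
  assumes "t \<in> set ts"
  obtains pre suf where "lst ts = pre @ blk t @ suf"
proof -
  obtain us vs where "ts = us @ t # vs" using split_list[OF assms] by blast
  then have "lst ts = lst us @ blk t @ concat (map block vs)" by (simp add: listing_def)
  then show ?thesis using that by blast
qed

lemma apply_stage:
  assumes ts: "set ts \<subseteq> univ (prod_alg As)" "length ts \<le> q" and f: "f \<in> F"
    and xs: "set xs \<subseteq> set ts" "length xs = ar f" and P: "heads_ok ts ts P"
  defines "t \<equiv> oper (prod_alg As) f xs"
  obtains P' where "heads_ok (ts @ [t]) ts P'" "P' 0 = P 0"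
    "runs (stage q) (conf Free (content (lst ts) (lst ts)) P)
       (conf Free (content (lst (ts @ [t])) (lst ts)) P')"
proof -
  have t: "t \<in> univ (prod_alg As)"
    using is_algebra_prod_K[OF As] f xs ts(1) unfolding t_def is_algebra_def
    by (auto simp: in_lists_conv_set subset_iff)
  then have len: "length t = n" by (simp add: univ_prod_alg n_def)
  have lenx: "length (xs ! j) = n" if "j < ar f" for j
  proof -
    have "xs ! j \<in> univ (prod_alg As)" using xs ts(1) that nth_mem[of j xs] by (metis subsetD)
    then show ?thesis by (simp add: univ_prod_alg n_def)
  qed
  have "\<forall>j<ar f. \<exists>pre suf. lst ts = pre @ blk (xs ! j) @ suf"
    using listing_split xs by (metis nth_mem subsetD)
  then obtain pre suf where pre: "\<And>j. j < ar f \<Longrightarrow> lst ts = pre j @ blk (xs ! j) @ suf j"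
    by metis
  have so: "scan (lst ts) (length (pre j)) = open_mark" if "j < ar f" for j
    using scan_block_open[of "pre j" "xs ! j" "suf j"] pre[OF that] by simp
  have sc: "scan (lst ts) (Suc (length (pre j) + m)) = Inl (Elem (xs ! j ! m))" if "j < ar f" "m < n" for j m
    using scan_block[of m "xs ! j" "pre j" "suf j"] pre[OF that(1)] lenx that by simp
  have le: "Suc (length (pre j) + m) \<le> length (lst ts)" if "j < ar f" "m \<le> n" for j m
    using arg_cong[OF pre[OF that(1)], of length] lenx that by (simp add: block_def)
  have tm: "oper (As ! m) f (map (\<lambda>x. x ! m) xs) = t ! m" if "m < n" for m
    using that by (simp add: t_def oper_prod_nth n_def)
  let ?A = "\<lambda>m. lst ts @ blk (take m t)"
  define P1 where "P1 i = (if i = 0 then P 0 else if i = 1 then 0 else if i = 2 then length (lst ts)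
    else if i < 3 + ar f then length (pre (i - 3)) else 0)" for i :: nat
  define Q where "Q m i = (if i = 0 then P 0 else if i = 1 then Suc m
    else if i = 2 then length (?A m) else if i < 3 + ar f then Suc (length (pre (i - 3)) + m) else 0)"
    for m i :: nat
  have ok': "heads_ok (ts @ [t]) ts (Q n)"
    using P le[of _ n] by (auto simp: heads_ok_def Q_def content_def listing_snoc len alg_tape_def n_def[symmetric])
  have "length (pre j) \<le> length (lst ts)" if "j < ar f" for j using le[OF that, of 0] by simp
  then have "heads_ok ts ts P1" using P by (auto simp: heads_ok_def P1_def content_def)
  then have r: "runs (1 + (q + 1) * (n + 1)) (conf Free (content (lst ts) (lst ts)) P)
      (conf Free (content (lst ts) (lst ts)) P1)"
    using ts P by (intro runs_free_heads) (auto simp: P1_def)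
  note S = content_syms[OF append_syms[OF ts(1) t] listing_syms[OF ts(1)]]
  have "runs (stage q) (conf Free (content (lst ts) (lst ts)) P)
      (conf Free (content (?A n) (lst ts)) (Q n))"
  proof (rule runs_stage[OF r, of "\<lambda>m. conf (Apply f) (content (?A m) (lst ts)) (Q m)"])
    have "scans (content (lst ts) (lst ts)) P1 ! (3 + j) = open_mark" if "j < ar f" for j
      using that so[OF that] by (simp add: scans_args[OF f] content_def P1_def)
    then show "(conf Free (content (lst ts) (lst ts)) P1, conf (Apply f) (content (?A 0) (lst ts)) (Q 0)) \<in> step machine"
      by (intro step_conf[OF rule.op_start[OF f] content_syms])
        (use listing_syms[OF ts(1)] so in \<open>auto simp: scans_1 content_def P1_def Q_def scan_alg(3)
          scan_append_end marks_in_syms block_def\<close>)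
  next
    fix m assume m: "m < n"
    have "scans (content (?A m) (lst ts)) (Q m) ! (3 + j) = Inl (Elem (map (\<lambda>x. x ! m) xs ! j))"
      if "j < ar f" for j
      using that sc[OF that m] xs(2) by (simp add: scans_args[OF f] content_def Q_def)
    then show "(conf (Apply f) (content (?A m) (lst ts)) (Q m),
        conf (Apply f) (content (?A (Suc m)) (lst ts)) (Q (Suc m))) \<in> step machine"
      by (intro step_conf[OF rule.op_step[of f _ "As ! m" "map (\<lambda>x. x ! m) xs", OF f] S])
        (use m sc[OF _ m] xs(2) Elem_in_syms[OF t m] in \<open>auto simp: scans_1 content_def Q_def scan_alg(1)
          scan_append_end take_Suc_block len tm[OF m]\<close>)
  next
    show "(conf (Apply f) (content (?A n) (lst ts)) (Q n), conf Free (content (?A n) (lst ts)) (Q n)) \<in> step machine"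
      by (rule step_conf[OF rule.op_end[OF f] S]) (auto simp: scans_1 content_def Q_def scan_alg(2))
  qed
  then show ?thesis using that[of "Q n"] ok' by (simp add: len listing_snoc Q_def)
qed

lemma compare_stage:
  assumes ts: "set ts \<subseteq> univ (prod_alg As)" "length ts \<le> q" and bts: "b \<in> set ts"
    and P: "heads_ok ts ts P" "P 0 = length (header As as)"
  obtains X P' where "runs (stage q) (conf Free (content (lst ts) (lst ts)) P) (conf Accept X P')"
proof -
  have len: "length b = n" using b by (simp add: univ_prod_alg n_def)
  obtain pre suf where pre: "lst ts = pre @ blk b @ suf" using listing_split[OF bts] .
  have so: "scan (lst ts) (length pre) = open_mark" unfolding pre by (rule scan_block_open)
  have sc: "scan (lst ts) (Suc (length pre + m)) = Inl (Elem (b ! m))" if "m < n" for m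
    unfolding pre using that len by (intro scan_block) simp
  have sw: "scan (map Inl w) (P 0 + m) = Inl (Elem (b ! m))" if m: "m < n" for m
  proof (rule scan_at)
    have "b = take m b @ b ! m # drop (Suc m) b" using m len by (intro id_take_nth_drop) simp
    from arg_cong[OF this, of "map Elem"]
    show "w = (header As as @ map Elem (take m b)) @ Elem (b ! m) # map Elem (drop (Suc m) b)"
      by (simp add: w_def smp_encode_header)
  qed (use P m len in simp)
  have sw': "scan (map Inl w) (P 0 + n) = blank"
    by (simp add: scan_def P(2) w_def smp_encode_header len)
  let ?X = "content (lst ts) (lst ts)"
  define P1 where "P1 i = (if i = 0 then P 0 else if i = 2 then length pre else 0)" for i :: nat
  define Q where "Q m i = (if i = 0 then P 0 + m else if i = 1 then Suc m
    else if i = 2 then Suc (length pre + m) else 0)" for m i :: nat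
  have "heads_ok ts ts P1" using P(1) by (auto simp: heads_ok_def P1_def content_def pre)
  then have r: "runs (1 + (q + 1) * (n + 1)) (conf Free ?X P) (conf Free ?X P1)"
    using ts P by (intro runs_free_heads) (auto simp: P1_def)
  note S = content_syms[OF listing_syms[OF ts(1)] listing_syms[OF ts(1)]]
  have "runs (stage q) (conf Free ?X P) (conf Accept ?X (Q n))"
  proof (rule runs_stage[OF r, of "\<lambda>m. conf Compare ?X (Q m)"])
    show "(conf Free ?X P1, conf Compare ?X (Q 0)) \<in> step machine"
      by (rule step_conf[OF rule.compare_start S])
        (use so in \<open>auto simp: scans_1 scans_2 content_def P1_def Q_def scan_alg(3)\<close>)
  next
    fix m assume m: "m < n"
    show "(conf Compare ?X (Q m), conf Compare ?X (Q (Suc m))) \<in> step machine"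
      by (rule step_conf[OF rule.compare[of _ "As ! m" "b ! m"] S])
        (use m sc[OF m] sw[OF m] in \<open>auto simp: scans_0 scans_1 scans_2 content_def Q_def scan_alg(1)\<close>)
  next
    show "(conf Compare ?X (Q n), conf Accept ?X (Q n)) \<in> step machine"
      by (rule step_conf[OF rule.accept S])
        (use sw' in \<open>auto simp: scans_0 scans_1 content_def Q_def scan_alg(2)\<close>)
  qed
  then show ?thesis using that by blast
qed

lemma start_stage:
  obtains P where "heads_ok [] [] P" "P 0 = length (header As [])"
    "runs (n + 2) (init_config machine w) (conf Free (content (lst []) (lst [])) P)"
proof -
  define X where "X m i = (if i = 0 then map Inl w else if i = 1 then alg_tape (take m As)
    else [left_mark])" for m i :: nat
  define Q where "Q m i = (if i = 0 then m else Suc (if i = 1 then m else 0))" for m i :: nat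
  define P where "P i = (if i = 0 then Suc n else Q n i)" for i
  have w: "w = map Alg As @ Sep # (concat (map (\<lambda>a. map Elem a @ [Sep]) as) @ map Elem b)"
    by (simp add: w_def smp_encode_def)
  have XS: "set (scans (X m) R) \<subseteq> syms" for m R
    using input_syms alg_tape_syms set_take_subset[of m As]
    by (intro scans_syms) (auto simp: X_def alg_tape_def syms_def)
  have sA: "scan (map Inl w) m = Inl (Alg (As ! m))" if m: "m < n" for m
    using m by (simp add: scan_def w nth_append n_def)
  have AS: "Inl (Alg (As ! m)) \<in> syms" if "m < n" for m
    using that alg_tape_syms by (auto simp: alg_tape_def n_def)
  have "(init_config machine w, conf Header (X 0) (Q 0)) \<in> step machine"
    unfolding init_config_conf
    by (rule step_conf[OF rule.init scans_syms])
      (use input_syms in \<open>auto simp: X_def Q_def scan_def marks_in_syms alg_tape_def syms_def\<close>)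
  moreover have "(conf Header (X m) (Q m), conf Header (X (Suc m)) (Q (Suc m))) \<in> step machine"
    if m: "m < n" for m
    by (rule step_conf[OF rule.header_alg[of _ "As ! m"] XS])
      (use m sA[OF m] AS[OF m] in \<open>auto simp: scans_0 X_def Q_def alg_tape_def scan_def n_def
        take_Suc_conv_app_nth\<close>)
  moreover have "(conf Header (X n) (Q n), conf Free (X n) P) \<in> step machine"
    by (rule step_conf[OF rule.header_end XS])
      (auto simp: scans_0 X_def Q_def P_def scan_def w n_def nth_append)
  ultimately have "runs (1 + n + 1) (init_config machine w) (conf Free (X n) P)"
    by (intro runs_trans[OF runs_trans[OF runs_step runs_chain[of n "\<lambda>m. conf Header (X m) (Q m)"]]
      runs_step])
  moreover have "X n = content (lst []) (lst [])"
    by (auto simp: fun_eq_iff X_def content_def listing_def n_def)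
  moreover have "heads_ok [] [] P"
    by (auto simp: heads_ok_def P_def Q_def content_def listing_def alg_tape_def w n_def)
  moreover have "P 0 = length (header As [])" by (simp add: P_def header_def n_def)
  ultimately show ?thesis using that by simp
qed

lemma load_all:
  assumes "length as \<le> q" "j \<le> length as"
  shows "\<exists>P. heads_ok (take j as) (take j as) P \<and> P 0 = length (header As (take j as)) \<and>
    runs (n + 2 + j * (2 * stage q)) (init_config machine w)
      (conf Free (content (lst (take j as)) (lst (take j as))) P)"
  using assms(2)
proof (induction j)
  case 0
  obtain P where "heads_ok [] [] P" "P 0 = length (header As [])"
    "runs (n + 2) (init_config machine w) (conf Free (content (lst []) (lst [])) P)"
    by (rule start_stage)
  then show ?case by auto
next
  case (Suc j)
  let ?ts = "take j as"
  from Suc obtain P where P: "heads_ok ?ts ?ts P" "P 0 = length (header As ?ts)"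
    "runs (n + 2 + j * (2 * stage q)) (init_config machine w) (conf Free (content (lst ?ts) (lst ?ts)) P)"
    by auto
  have j: "j < length as" using Suc.prems by simp
  have ts: "set ?ts \<subseteq> univ (prod_alg As)" "length ?ts < q" "length ?ts \<le> q"
    using as set_take_subset[of j as] j assms(1) by auto
  have aj: "as ! j \<in> univ (prod_alg As)" using as nth_mem[OF j] by blast
  obtain P1 where P1: "heads_ok (?ts @ [as ! j]) ?ts P1" "P1 0 = length (header As (take (Suc j) as))"
    "runs (stage q) (conf Free (content (lst ?ts) (lst ?ts)) P)
       (conf Free (content (lst (?ts @ [as ! j])) (lst ?ts)) P1)"
    by (rule load_stage[OF ts(1,3) j P(1,2)])
  obtain P2 where P2: "heads_ok (?ts @ [as ! j]) (?ts @ [as ! j]) P2" "P2 0 = P1 0"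
    "runs (stage q) (conf Free (content (lst (?ts @ [as ! j])) (lst ?ts)) P1)
       (conf Free (content (lst (?ts @ [as ! j])) (lst (?ts @ [as ! j]))) P2)"
    by (rule copy_stage[OF ts(1,2) aj P1(1)])
  have "runs (n + 2 + Suc j * (2 * stage q)) (init_config machine w)
      (conf Free (content (lst (?ts @ [as ! j])) (lst (?ts @ [as ! j]))) P2)"
    by (rule runs_mono[OF runs_trans[OF runs_trans[OF P(3) P1(3)] P2(3)]]) simp
  moreover have "take (Suc j) as = ?ts @ [as ! j]" using j by (simp add: take_Suc_conv_app_nth)
  ultimately show ?case using P1(2) P2(1,2) by (intro exI[of _ P2]) simp
qed

text \<open>Every tuple takes two stages, one writing it to tape 2 and one copying it. Repetitions
  are not removed, hence the exact length of \<open>ts\<close>.\<close>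

lemma derive_all:
  assumes "derives F ar (prod_alg As) (set as) N S" "length as + N \<le> q"
  shows "\<exists>ts P. length ts = length as + N \<and> set ts \<subseteq> univ (prod_alg As) \<and> S \<subseteq> set ts \<and>
    heads_ok ts ts P \<and> P 0 = length (header As as) \<and>
    runs (n + 2 + (length as + N) * (2 * stage q)) (init_config machine w)
      (conf Free (content (lst ts) (lst ts)) P)"
  using assms
proof (induction rule: derives.induct)
  case derives_0
  then show ?case using load_all[of q "length as"] as by (intro exI[of _ as]) auto
next
  case (derives_Suc N S f xs)
  then obtain ts P where ts: "length ts = length as + N" "set ts \<subseteq> univ (prod_alg As)" "S \<subseteq> set ts"
    and P: "heads_ok ts ts P" "P 0 = length (header As as)"
    "runs (n + 2 + (length as + N) * (2 * stage q)) (init_config machine w)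
      (conf Free (content (lst ts) (lst ts)) P)" by auto
  let ?t = "oper (prod_alg As) f xs"
  have len: "length ts < q" "length ts \<le> q" using ts(1) derives_Suc.prems by auto
  have xs: "set xs \<subseteq> set ts" using derives_Suc.hyps(3) ts(3) by simp
  have t: "?t \<in> univ (prod_alg As)"
    using subuniverse_univ[OF is_algebra_prod_K[OF As]] derives_Suc.hyps(2,4) xs ts(2)
    unfolding subuniverse_def by (metis in_listsI subsetD)
  obtain P1 where P1: "heads_ok (ts @ [?t]) ts P1" "P1 0 = P 0"
    "runs (stage q) (conf Free (content (lst ts) (lst ts)) P)
       (conf Free (content (lst (ts @ [?t])) (lst ts)) P1)"
    by (rule apply_stage[OF ts(2) len(2) derives_Suc.hyps(2) xs derives_Suc.hyps(4) P(1)])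
  obtain P2 where P2: "heads_ok (ts @ [?t]) (ts @ [?t]) P2" "P2 0 = P1 0"
    "runs (stage q) (conf Free (content (lst (ts @ [?t])) (lst ts)) P1)
       (conf Free (content (lst (ts @ [?t])) (lst (ts @ [?t]))) P2)"
    by (rule copy_stage[OF ts(2) len(1) t P1(1)])
  have "runs (n + 2 + (length as + Suc N) * (2 * stage q)) (init_config machine w)
      (conf Free (content (lst (ts @ [?t])) (lst (ts @ [?t]))) P2)"
    by (rule runs_mono[OF runs_trans[OF runs_trans[OF P(3) P1(3)] P2(3)]]) simp
  then show ?case using ts t P(2) P1(2) P2(1,2)
    by (intro exI[of _ "ts @ [?t]"] exI[of _ P2]) auto
qed

text \<open>The factor \<open>2 * q + 1\<close> stands for two stages per tuple and the final
  comparison.\<close>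

lemma machine_complete:
  assumes "derives F ar (prod_alg As) (set as) N S" "b \<in> S" "length as + N \<le> q"
  shows "\<exists>m \<le> n + 2 + (2 * q + 1) * ((q + 1) * (n + 1) + n + 3). accepts_in machine w m"
proof -
  obtain ts P where ts: "length ts = length as + N" "set ts \<subseteq> univ (prod_alg As)" "S \<subseteq> set ts"
    and P: "heads_ok ts ts P" "P 0 = length (header As as)"
    "runs (n + 2 + (length as + N) * (2 * stage q)) (init_config machine w)
      (conf Free (content (lst ts) (lst ts)) P)" using derive_all[OF assms(1,3)] by blast
  obtain X P' where X: "runs (stage q) (conf Free (content (lst ts) (lst ts)) P) (conf Accept X P')"
    by (rule compare_stage[of ts q P]) (use ts P assms in auto)
  have "n + 2 + (length as + N) * (2 * stage q) + stage q \<le> n + 2 + (2 * q + 1) * stage q"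
    using mult_le_mono1[OF assms(3), of "2 * stage q"] by (simp add: algebra_simps)
  then have "runs (n + 2 + (2 * q + 1) * stage q) (init_config machine w) (conf Accept X P')"
    by (rule runs_mono[OF runs_trans[OF P(3) X]])
  moreover have "stage q = (q + 1) * (n + 1) + n + 3" by (simp add: stage_def)
  ultimately obtain m where "m \<le> n + 2 + (2 * q + 1) * ((q + 1) * (n + 1) + n + 3)"
    "(init_config machine w, conf Accept X P') \<in> step machine ^^ m" by (auto simp: runs_def)
  then show ?thesis unfolding accepts_in_def conf_def by (auto simp: machine_def)
qed

end

end

section \<open>The main theorem\<close>

lemma Sg_empty_constant:
  assumes "is_algebra F ar A" "b \<in> Sg F ar A {}"
  obtains f where "f \<in> F" "ar f = 0"
proof -
  have "\<exists>f\<in>F. ar f = 0"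
  proof (rule ccontr)
    assume "\<not> (\<exists>f\<in>F. ar f = 0)"
    then have "subuniverse F ar A {}" by (auto simp: subuniverse_def)
    then show False using Sg_minimal[of F ar A "{}" "{}"] assms(2) by auto
  qed
  then show ?thesis using that by blast
qed

context cube_algebras
begin

text \<open>An instance may have no generators. If anything is generated then, there is a nullary
  symbol, since otherwise the empty set would be a subuniverse; its value serves as a generator and
  costs one more operation.\<close>

lemma reach_polynomial_with_empty:
  assumes reach: "\<And>As G b. \<lbrakk>As \<in> lists K; G \<subseteq> univ (prod_alg As); G \<noteq> {};
      b \<in> Sg F ar (prod_alg As) G\<rbrakk> \<Longrightarrow> reach F ar (prod_alg As) (c * length As ^ (d + 1)) G {b}"
    and As: "As \<in> lists K" and G: "G \<subseteq> univ (prod_alg As)" and b: "b \<in> Sg F ar (prod_alg As) G"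
  shows "reach F ar (prod_alg As) (c * length As ^ (d + 1) + 1) G {b}"
proof (cases "G = {}")
  case False
  then show ?thesis using reach_mono[OF reach[OF As G False b], of G "{b}"] by simp
next
  case True
  note alg = is_algebra_prod_K[OF As]
  obtain f where f: "f \<in> F" "ar f = 0" using Sg_empty_constant[OF alg] b True by blast
  let ?e = "oper (prod_alg As) f []"
  have e: "?e \<in> univ (prod_alg As)" using alg f by (auto simp: is_algebra_def)
  have "b \<in> Sg F ar (prod_alg As) {?e}"
    using b True Sg_mono[of "{}" "{?e}" F ar "prod_alg As"] by auto
  then have r: "reach F ar (prod_alg As) (c * length As ^ (d + 1)) {?e} {b}"
    using reach[OF As] e by auto
  have "reach F ar (prod_alg As) 1 G {?e}"
    using reach_oper[of F ar "prod_alg As" 0 G "[]" f] f by (simp add: reach_refl)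
  then show ?thesis by (rule reach_trans[OF _ r]) auto
qed

theorem SMP_in_NP:
  assumes reach: "\<And>As G b. \<lbrakk>As \<in> lists K; G \<subseteq> univ (prod_alg As); G \<noteq> {};
      b \<in> Sg F ar (prod_alg As) G\<rbrakk> \<Longrightarrow> reach F ar (prod_alg As) (c * length As ^ (d + 1)) G {b}"
  shows "SMP F ar K \<in> NP (smp_alphabet K)"
proof -
  define r where "r = Max (insert 0 (ar ` F))"
  obtain idx :: "'f \<Rightarrow> nat" where "inj_on idx F"
    using finite_imp_inj_to_nat_seg[OF finite_F] by blast
  then interpret smp_machine F ar K r idx
    using finite_F finite_K algebra finite_univ by unfold_locales (auto simp: r_def)
  \<comment> \<open>A bound for the number of tuples listed, generators and operations together, in
    terms of the input length. The final 1 stands for the possible nullary operation.\<close>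
  define Q where "Q s = s + c * s ^ (d + 1) + 1" for s :: nat
  define p where "p = (let x = [:0, 1:]; q = x + [:c:] * x ^ (d + 1) + 1
    in x + [:2:] + ([:2:] * q + 1) * ((q + 1) * (x + 1) + x + [:3:]))"
  have p: "poly p s = s + 2 + (2 * Q s + 1) * ((Q s + 1) * (s + 1) + s + 3)" for s
    by (simp add: p_def Let_def Q_def mult_ac)
  have acc: "w \<in> lists (smp_alphabet K) \<and> (\<exists>m \<le> poly p (length w). accepts_in machine w m)"
    if w: "w \<in> SMP F ar K" for w
  proof -
    obtain As as b where w: "w = smp_encode As as b" and As: "As \<in> lists K"
      and as: "as \<in> lists (univ (prod_alg As))" and b: "b \<in> univ (prod_alg As)"
      and bSg: "b \<in> Sg F ar (prod_alg As) (set as)"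
      using w by (auto simp: SMP_def)
    have as': "set as \<subseteq> univ (prod_alg As)" using as by auto
    let ?n = "length As" and ?s = "length w"
    obtain N S where N: "N \<le> c * ?n ^ (d + 1) + 1" "derives F ar (prod_alg As) (set as) N S" "b \<in> S"
      using reach_polynomial_with_empty[OF reach As as' bSg] by (auto simp: reach_def)
    have n: "?n \<le> ?s" by (simp add: w smp_encode_def)
    \<comment> \<open>Each generator contributes a separator, so the input length bounds their
      number even if the tuples are empty.\<close>
    have "length as \<le> length (concat (map (\<lambda>a. map Elem a @ [Sep :: ('f, 'a) smp_sym]) as))"
      by (induction as) auto
    then have k: "length as \<le> ?s" by (simp add: w smp_encode_def)
    have "c * ?n ^ (d + 1) \<le> c * ?s ^ (d + 1)" using n by (intro mult_le_mono2 power_mono) auto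
    then have q: "length as + N \<le> Q ?s" using N(1) k unfolding Q_def by linarith
    obtain m where m: "m \<le> ?n + 2 + (2 * Q ?s + 1) * ((Q ?s + 1) * (?n + 1) + ?n + 3)"
      "accepts_in machine w m"
      using machine_complete[OF As as' b N(2,3) q] w by blast
    have "?n + 2 + (2 * Q ?s + 1) * ((Q ?s + 1) * (?n + 1) + ?n + 3) \<le> poly p ?s"
      unfolding p using n by (intro add_mono mult_le_mono) auto
    then have "m \<le> poly p ?s" using m(1) by simp
    moreover have "w \<in> lists (smp_alphabet K)" using input_syms[OF As as' b] w by auto
    ultimately show ?thesis using m(2) by blast
  qed
  have "SMP F ar K = {w \<in> lists (smp_alphabet K). \<exists>n. accepts_in machine w n}"
    using acc machine_sound by blast
  then show ?thesis
    unfolding NP_def using finite_alphabet is_ntm_machine acc by blast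
qed

end

theorem theorem4p13:
  fixes F :: "'f set" and ar :: "'f \<Rightarrow> nat" and d :: nat
    and V K :: "('f, 'a) algebra set"
  assumes "finite F"
    and "variety F ar V"
    and "d > 1"
    and "\<exists>t. is_cube_term F ar V d t"
    and "finite K"
    and "K \<subseteq> V"
    and "\<forall>A\<in>K. finite (univ A)"
  shows "(\<exists>c :: nat. \<forall>n k As as b.
            As \<in> lists K \<and> length As = n \<and>
            as \<in> lists (univ (prod_alg As)) \<and> length as = k \<and> k \<ge> 1 \<and>
            b \<in> univ (prod_alg As) \<and>
            b \<in> Sg F ar (prod_alg As) (set as) \<longrightarrow>
            (\<exists>t \<in> terms F ar {..<k}. eval (prod_alg As) (\<lambda>i. as ! i) t = b \<and>
               (\<exists>C. is_minimal_circuit F ar k C t \<and>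
                    circuit_size C \<le> c * (k * n ^ (d + 2)))))
         \<and> SMP F ar K \<in> NP (smp_alphabet K)"
proof -
  obtain t where t: "is_cube_term F ar V d t" using assms(4) by blast
  have alg: "is_algebra F ar A" if "A \<in> K" for A
    using assms(2,6) that by (auto simp: variety_def)
  interpret cube_algebras F ar d K
    using assms alg by unfold_locales auto
  obtain q0 where "column_term (columns d) q0" using column_term_of_cube_term[OF t assms(6)] by blast
  then obtain q where q: "column_term (columns 2) q" using edge_term_exists by blast
  obtain c where c: "\<And>As G b. \<lbrakk>As \<in> lists K; G \<subseteq> univ (prod_alg As); G \<noteq> {};
      b \<in> Sg F ar (prod_alg As) G\<rbrakk> \<Longrightarrow> reach F ar (prod_alg As) (c * length As ^ (d + 1)) G {b}"
    using reach_polynomial[OF q] by blast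
  have "\<exists>t \<in> terms F ar {..<k}. eval (prod_alg As) (\<lambda>i. as ! i) t = b \<and>
      (\<exists>C. is_minimal_circuit F ar k C t \<and> circuit_size C \<le> c * (k * n ^ (d + 2)))"
    if "As \<in> lists K" "length As = n" "as \<in> lists (univ (prod_alg As))" "length as = k" "k \<ge> 1"
      "b \<in> Sg F ar (prod_alg As) (set as)" for n k As as b
  proof -
    have "set as \<noteq> {}" using that(4,5) by auto
    then have re: "reach F ar (prod_alg As) (c * n ^ (d + 1)) (set as) {b}"
      using c[of As "set as" b] that by auto
    \<comment> \<open>The cost found is independent of the number of generators and is weakened here
      to the stated form.\<close>
    have "n ^ (d + 1) \<le> n ^ (d + 2)" by (cases "n = 0") (auto intro: power_increasing)
    also have "\<dots> \<le> k * n ^ (d + 2)" using that(5) by simp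
    finally have "reach F ar (prod_alg As) (c * (k * n ^ (d + 2))) (set as) {b}"
      by (intro reach_mono[OF re]) auto
    from circuit_of_reach[OF this] show ?thesis using that(4) by simp
  qed
  then show ?thesis using SMP_in_NP[OF c] by blast
qed

end
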